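(* Let $G$ be an almost unimodular group with finite covolume subgroup $H\le G$. Then: (a) $H$ is almost unimodular; (b) $\Delta_G|_H=\Delta_H$; (c) $\ker\Delta_H$ has finite covolume in $\ker\Delta_G$; (d) $\Delta_H(H)$ is a finite index subgroup of $\Delta_G(G)$.
   Context: Locally compact groups are Hausdorff; $H\le G$ means $H$ is a closed subgroup. $\Delta_G\colon G\to\mathbb{R}_+=(0,\infty)$ is the modular function of a locally compact group $G$, $\mu_G(E\cdot s)=\Delta_G(s)\mu_G(E)$ for a left Haar measure $\mu_G$. $G$ is almost unimodular if $\ker\Delta_G$ is open in $G$. A closed subgroup $H\le G$ has finite covolume if the quotient space $G/H$ admits a finite non-trivial $G$-invariant Radon measure. *)

theory Defs
  imports "HOL-Analysis.Analysis" "HOL-Algebra.Left_Coset"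
begin

locale locally_compact_group = group G for G (structure) +
  fixes T :: "'a topology"
  assumes topspace_eq: "topspace T = carrier G"
    and continuous_mult: "continuous_map (prod_topology T T) T (\<lambda>(x, y). x \<otimes> y)"
    and continuous_inv: "continuous_map T T (\<lambda>x. inv x)"
    and locally_compact: "locally_compact_space T"
    and Hausdorff: "Hausdorff_space T"

definition borel_of :: "'a topology \<Rightarrow> 'a measure"
  where "borel_of T = sigma (topspace T) {U. openin T U}"

lemma space_borel_of: "space (borel_of T) = topspace T"
  unfolding borel_of_def by (rule space_measure_of) (auto dest: openin_subset)

lemma sets_borel_of: "sets (borel_of T) = sigma_sets (topspace T) {U. openin T U}"
  unfolding borel_of_def by (rule sets_measure_of) (auto dest: openin_subset)

text \<open>
  Radon measures on a locally compact Hausdorff space: Borel measures that are finite on compact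
  sets, outer regular on Borel sets and inner regular on open sets. No countability assumption is
  made, so inner regularity on all Borel sets is not required.
\<close>

definition radon_measure :: "'a topology \<Rightarrow> 'a measure \<Rightarrow> bool"
  where "radon_measure T M \<longleftrightarrow>
    sets M = sets (borel_of T) \<and>
    (\<forall>K. compactin T K \<longrightarrow> emeasure M K < \<infinity>) \<and>
    (\<forall>E\<in>sets M. emeasure M E = (INF U\<in>{U. openin T U \<and> E \<subseteq> U}. emeasure M U)) \<and>
    (\<forall>U. openin T U \<longrightarrow> emeasure M U = (SUP K\<in>{K. compactin T K \<and> K \<subseteq> U}. emeasure M K))"

definition left_haar_measure :: "('a, 'b) monoid_scheme \<Rightarrow> 'a topology \<Rightarrow> 'a measure \<Rightarrow> bool"
  where "left_haar_measure G T \<mu> \<longleftrightarrow>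
    radon_measure T \<mu> \<and>
    emeasure \<mu> (space \<mu>) \<noteq> 0 \<and>
    (\<forall>g\<in>carrier G. \<forall>E\<in>sets \<mu>. emeasure \<mu> (g <#\<^bsub>G\<^esub> E) = emeasure \<mu> E)"

text \<open>
  Left Haar measures exist and are unique up to a positive factor, so the description below
  determines a unique number for every element of a locally compact group, and quantifying over
  all left Haar measures is the same as fixing one.
\<close>

definition modular_function :: "('a, 'b) monoid_scheme \<Rightarrow> 'a topology \<Rightarrow> 'a \<Rightarrow> real"
  where "modular_function G T s =
    (THE c. 0 < c \<and>
      (\<forall>\<mu>. left_haar_measure G T \<mu> \<longrightarrow>
        (\<forall>E\<in>sets \<mu>. emeasure \<mu> (E #>\<^bsub>G\<^esub> s) = ennreal c * emeasure \<mu> E)))"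

definition pos_real_group :: "real monoid"
  where "pos_real_group = \<lparr>carrier = {0<..}, mult = (*), one = 1\<rparr>"

lemma comm_group_pos_real_group: "comm_group pos_real_group"
proof (rule comm_groupI)
  fix x :: real
  assume x: "x \<in> carrier pos_real_group"
  show "\<exists>y\<in>carrier pos_real_group. y \<otimes>\<^bsub>pos_real_group\<^esub> x = \<one>\<^bsub>pos_real_group\<^esub>"
    using x by (intro bexI[of _ "inverse x"]) (auto simp: pos_real_group_def)
qed (auto simp: pos_real_group_def)

definition almost_unimodular :: "('a, 'b) monoid_scheme \<Rightarrow> 'a topology \<Rightarrow> bool"
  where "almost_unimodular G T \<longleftrightarrow>
    locally_compact_group G T \<and> openin T (kernel G pos_real_group (modular_function G T))"

definition closed_subgroup :: "'a set \<Rightarrow> ('a, 'b) monoid_scheme \<Rightarrow> 'a topology \<Rightarrow> bool"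
  where "closed_subgroup H G T \<longleftrightarrow> subgroup H G \<and> closedin T H"

definition quotient_topology :: "'a topology \<Rightarrow> ('a \<Rightarrow> 'b) \<Rightarrow> 'b topology"
  where "quotient_topology T f =
    topology (\<lambda>U. U \<subseteq> f ` topspace T \<and> openin T {x \<in> topspace T. f x \<in> U})"

lemma openin_quotient_topology:
  "openin (quotient_topology T f) U \<longleftrightarrow>
    U \<subseteq> f ` topspace T \<and> openin T {x \<in> topspace T. f x \<in> U}"
proof -
  have "istopology (\<lambda>U. U \<subseteq> f ` topspace T \<and> openin T {x \<in> topspace T. f x \<in> U})"
    unfolding istopology_def
  proof (intro conjI allI impI)
    fix A B
    assume A: "A \<subseteq> f ` topspace T \<and> openin T {x \<in> topspace T. f x \<in> A}"
      and B: "B \<subseteq> f ` topspace T \<and> openin T {x \<in> topspace T. f x \<in> B}"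
    have "{x \<in> topspace T. f x \<in> A \<inter> B} =
        {x \<in> topspace T. f x \<in> A} \<inter> {x \<in> topspace T. f x \<in> B}"
      by auto
    with A B show "openin T {x \<in> topspace T. f x \<in> A \<inter> B}"
      by (simp add: openin_Int)
    from A show "A \<inter> B \<subseteq> f ` topspace T" by auto
  next
    fix \<K>
    assume K: "\<forall>K\<in>\<K>. K \<subseteq> f ` topspace T \<and> openin T {x \<in> topspace T. f x \<in> K}"
    have "{x \<in> topspace T. f x \<in> \<Union>\<K>} = (\<Union>K\<in>\<K>. {x \<in> topspace T. f x \<in> K})"
      by auto
    moreover have "openin T (\<Union>K\<in>\<K>. {x \<in> topspace T. f x \<in> K})"
      using K by (intro openin_Union) blast
    ultimately show "openin T {x \<in> topspace T. f x \<in> \<Union>\<K>}"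
      by simp
    from K show "\<Union>\<K> \<subseteq> f ` topspace T" by blast
  qed
  then show ?thesis
    by (simp add: quotient_topology_def)
qed

lemma topspace_quotient_topology: "topspace (quotient_topology T f) = f ` topspace T"
proof (rule antisym)
  show "topspace (quotient_topology T f) \<subseteq> f ` topspace T"
    using openin_topspace[of "quotient_topology T f"] by (simp only: openin_quotient_topology)
  have "{x \<in> topspace T. f x \<in> f ` topspace T} = topspace T"
    by auto
  then have "openin (quotient_topology T f) (f ` topspace T)"
    by (simp add: openin_quotient_topology)
  then show "f ` topspace T \<subseteq> topspace (quotient_topology T f)"
    by (rule openin_subset)
qed

lemma quotient_map_quotient_topology: "quotient_map T (quotient_topology T f) f"
  unfolding quotient_map_def topspace_quotient_topology
  by (simp add: openin_quotient_topology)

definition left_coset_space :: "('a, 'b) monoid_scheme \<Rightarrow> 'a topology \<Rightarrow> 'a set \<Rightarrow> 'a set topology"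
  where "left_coset_space G T H = quotient_topology T (\<lambda>g. g <#\<^bsub>G\<^esub> H)"

lemma (in locally_compact_group) topspace_left_coset_space:
  "topspace (left_coset_space G T H) = lcosets H"
  unfolding left_coset_space_def topspace_quotient_topology topspace_eq LCOSETS_def by blast

definition finite_covolume :: "('a, 'b) monoid_scheme \<Rightarrow> 'a topology \<Rightarrow> 'a set \<Rightarrow> bool"
  where "finite_covolume G T H \<longleftrightarrow>
    closed_subgroup H G T \<and>
    (\<exists>m. radon_measure (left_coset_space G T H) m \<and>
      finite_measure m \<and>
      emeasure m (space m) \<noteq> 0 \<and>
      (\<forall>g\<in>carrier G. \<forall>E\<in>sets m. emeasure m ((\<lambda>C. g <#\<^bsub>G\<^esub> C) ` E) = emeasure m E))"

definition finite_index_subgroup :: "'a set \<Rightarrow> ('a, 'b) monoid_scheme \<Rightarrow> bool"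
  where "finite_index_subgroup S K \<longleftrightarrow> subgroup S K \<and> finite (rcosets\<^bsub>K\<^esub> S)"

end

(*
  The heart of the matter is that the modular functions agree on H. Let m be an invariant measure
  on G/H and nu a left Haar measure of H. Integrating a compactly supported f first over the
  cosets xH against nu and then over G/H against m is a left invariant positive functional on G,
  hence a multiple of the Haar integral of G by uniqueness. Replacing f by x |-> f(x h) scales the
  functional by the modular function of H and the Haar integral by that of G.

  Given this, the kernel K of the modular function of G meets H in the kernel of that of H. The
  orbit KH/H is open in G/H, so it has positive measure and is homeomorphic to K/(K Int H), which
  therefore has finite covolume. Translates of KH/H by elements whose modular values lie in
  different cosets of the image of H are disjoint of equal measure, so there are finitely many
  such cosets.

  Haar measures exist by Weil's covering number argument. Uniqueness is proved for a functional
  against a measure, so that neither the Riesz representation theorem nor product measures are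
  needed.
*)

theory Submission
  imports Defs
begin

section \<open>Radon measures from contents on compact sets\<close>

text \<open>The obstacle is size: Haar measures here need not be sigma-finite, and Radon measures
  are inner regular on open sets only. Comparisons of measures therefore pass through integrals of
  compactly supported continuous functions: Urysohn functions squeezed between a compact and an open
  set recover open sets from inside, and outer regularity then recovers Borel sets. Finiteness of m
  makes the fibre integrals, which are bounded continuous functions on G/H, integrable, and it
  limits how many disjoint translates of an open set fit into G/H. The unknown factor between the
  iterated integral and the Haar integral cancels, because the two scaling laws are compared at a
  single bump function on which the iterated integral is positive. Integrating x |-> f(x s) amounts
  to measuring E s^-1, so the scaling factor is the modular function at the inverse; this is why the
  laws are applied to h^-1.\<close>

lemma Hausdorff_compactin_Un_split:
  assumes X: "Hausdorff_space X" and K: "compactin X K"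
    and U: "openin X U" and V: "openin X V" and sub: "K \<subseteq> U \<union> V"
  obtains A B where "compactin X A" "compactin X B" "A \<subseteq> U" "B \<subseteq> V" "K = A \<union> B"
proof -
  have cK: "closedin X K" using X K by (rule compactin_imp_closedin)
  have *: "compactin X (K - W)" if "openin X W" for W
    using K cK that by (meson Diff_subset closed_compactin closedin_diff)
  \<comment> \<open>Removing disjoint open neighbourhoods of the parts of K outside U and outside V
    leaves compact sets inside U and inside V, and every point of K survives one of the two
    removals.\<close>
  have "disjnt (K - U) (K - V)" using sub by (auto simp: disjnt_iff)
  then obtain P Q where PQ: "openin X P" "openin X Q" "K - U \<subseteq> P" "K - V \<subseteq> Q" "disjnt P Q"
    using Hausdorff_space_compact_separation[OF X *[OF U] *[OF V]] by blast
  show thesis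
    by (rule that[of "K - P" "K - Q"]) (use PQ * in \<open>auto simp: disjnt_iff\<close>)
qed

lemma borel_of_openin [intro]: "openin X U \<Longrightarrow> U \<in> sets (borel_of X)"
  by (simp add: sets_borel_of sigma_sets.Basic)

lemma borel_of_closedin [intro]: "closedin X C \<Longrightarrow> C \<in> sets (borel_of X)"
  using sets.compl_sets[of "topspace X - C" "borel_of X"]
  by (auto simp: space_borel_of closedin_def double_diff)

lemma sigma_algebra_borel_of: "sigma_algebra (topspace X) (sets (borel_of X))"
  by (metis sets.sigma_algebra_axioms space_borel_of)

lemma borel_of_compactin: "Hausdorff_space X \<Longrightarrow> compactin X K \<Longrightarrow> K \<in> sets (borel_of X)"
  by (intro borel_of_closedin compactin_imp_closedin)

text \<open>A content in the sense of Halmos: additivity is demanded for disjoint compact sets, and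
  regularity is left to the construction below.\<close>

locale compact_content =
  fixes X :: "'a topology" and c :: "'a set \<Rightarrow> ennreal"
  assumes Hausdorff: "Hausdorff_space X"
    and loc_compact: "locally_compact_space X"
    and content_mono: "compactin X K \<Longrightarrow> compactin X L \<Longrightarrow> K \<subseteq> L \<Longrightarrow> c K \<le> c L"
    and content_subadditive: "compactin X K \<Longrightarrow> compactin X L \<Longrightarrow> c (K \<union> L) \<le> c K + c L"
    and content_additive: "compactin X K \<Longrightarrow> compactin X L \<Longrightarrow> disjnt K L \<Longrightarrow> c (K \<union> L) = c K + c L"
    and content_finite: "compactin X K \<Longrightarrow> c K < \<infinity>"
begin

definition inner :: "'a set \<Rightarrow> ennreal"
  where "inner U = (SUP K\<in>{K. compactin X K \<and> K \<subseteq> U}. c K)"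

text \<open>The outer measure of Caratheodory's construction, induced by the inner content of open
  sets.\<close>

definition outer :: "'a set \<Rightarrow> ennreal"
  where "outer A = (INF U\<in>{U. openin X U \<and> A \<subseteq> U}. inner U)"

lemma content_empty: "c {} = 0"
  using content_additive[of "{}" "{}"] content_finite[of "{}"]
  by (metis Un_empty_left add.right_neutral compactin_empty disjnt_empty1 ennreal_add_left_cancel
      infinity_ennreal_def less_irrefl)

lemma content_le_inner: "compactin X K \<Longrightarrow> K \<subseteq> U \<Longrightarrow> c K \<le> inner U"
  unfolding inner_def by (rule SUP_upper) auto

lemma inner_mono: "U \<subseteq> V \<Longrightarrow> inner U \<le> inner V"
  unfolding inner_def by (rule SUP_subset_mono) auto

lemma inner_empty: "inner {} = 0"
  unfolding inner_def by (auto simp: content_empty intro!: antisym SUP_least)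

lemma outer_open: "openin X U \<Longrightarrow> outer U = inner U"
  unfolding outer_def by (rule antisym) (auto intro: INF_lower INF_greatest inner_mono)

lemma outer_le_inner: "openin X U \<Longrightarrow> A \<subseteq> U \<Longrightarrow> outer A \<le> inner U"
  unfolding outer_def by (rule INF_lower) auto

lemma outer_mono: "A \<subseteq> B \<Longrightarrow> outer A \<le> outer B"
  unfolding outer_def by (rule INF_superset_mono) auto

lemma inner_Un:
  assumes "openin X U" "openin X V"
  shows "inner (U \<union> V) \<le> inner U + inner V"
proof -
  have "c K \<le> inner U + inner V" if K: "compactin X K" "K \<subseteq> U \<union> V" for K
  proof -
    obtain A B where AB: "compactin X A" "compactin X B" "A \<subseteq> U" "B \<subseteq> V" "K = A \<union> B"
      using Hausdorff_compactin_Un_split[OF Hausdorff K(1) assms K(2)] .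
    have "c K \<le> c A + c B" using AB content_subadditive by simp
    also have "\<dots> \<le> inner U + inner V" using AB by (intro add_mono content_le_inner)
    finally show ?thesis .
  qed
  then show ?thesis
    unfolding inner_def[of "U \<union> V"] by (auto intro: SUP_least)
qed

lemma inner_UN_finite:
  assumes "finite I" "\<And>i. i \<in> I \<Longrightarrow> openin X (U i)"
  shows "inner (\<Union>i\<in>I. U i) \<le> (\<Sum>i\<in>I. inner (U i))"
  using assms
proof (induction I rule: finite_induct)
  case empty
  then show ?case by (simp add: inner_empty)
next
  case (insert i I)
  have "inner (\<Union>i\<in>insert i I. U i) \<le> inner (U i) + inner (\<Union>i\<in>I. U i)"
    using inner_Un[of "U i" "\<Union>i\<in>I. U i"] insert.prems by (auto intro: openin_Union)
  also have "\<dots> \<le> inner (U i) + (\<Sum>i\<in>I. inner (U i))"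
    using insert by (intro add_left_mono) auto
  finally show ?case using insert by simp
qed

text \<open>A supremum over compact subsets sees only finite unions: each compact K inside is
  covered by finitely many \<open>U i\<close>.\<close>

lemma inner_UN:
  fixes U :: "nat \<Rightarrow> 'a set"
  assumes U: "\<And>i. openin X (U i)"
  shows "inner (\<Union>i. U i) \<le> (\<Sum>i. inner (U i))"
proof -
  have "c K \<le> (\<Sum>i. inner (U i))" if K: "compactin X K" "K \<subseteq> (\<Union>i. U i)" for K
  proof -
    obtain \<F> where F: "finite \<F>" "\<F> \<subseteq> range U" "K \<subseteq> \<Union>\<F>"
      using compactinD[OF K(1), of "range U"] K(2) U by blast
    then obtain I where I: "finite I" "\<F> = U ` I"
      by (meson finite_subset_image)
    have "c K \<le> inner (\<Union>i\<in>I. U i)" using F I K by (intro content_le_inner) auto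
    also have "\<dots> \<le> (\<Sum>i\<in>I. inner (U i))" using I U by (intro inner_UN_finite)
    also have "\<dots> \<le> (\<Sum>i. inner (U i))" using I by (intro sum_le_suminf) auto
    finally show ?thesis .
  qed
  then show ?thesis
    unfolding inner_def[of "\<Union>i. U i"] by (auto intro: SUP_least)
qed

lemma outer_countably_subadditive: "countably_subadditive (Pow (topspace X)) outer"
  unfolding countably_subadditive_def
proof (intro allI impI)
  fix A :: "nat \<Rightarrow> 'a set"
  assume A: "range A \<subseteq> Pow (topspace X)" and "disjoint_family A" "(\<Union>i. A i) \<in> Pow (topspace X)"
  show "outer (\<Union>i. A i) \<le> (\<Sum>i. outer (A i))"
  proof (rule ennreal_le_epsilon)
    fix e :: real
    assume e: "0 < e" and fin: "(\<Sum>i. outer (A i)) < top_class.top"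
    \<comment> \<open>The error e is split as e/2 + e/4 + ..., one share per set. A strictly larger
      bound exists because \<open>fin\<close> makes every \<open>outer (A i)\<close> finite.\<close>
    have "\<exists>U. openin X U \<and> A i \<subseteq> U \<and> inner U \<le> outer (A i) + e * (1/2)^Suc i" for i
    proof -
      have "outer (A i) < top_class.top"
        using fin ennreal_suminf_lessD by blast
      then have "outer (A i) < outer (A i) + ennreal (e * (1/2)^Suc i)"
        using e ennreal_add_left_cancel_less[of "outer (A i)" 0] by simp
      then obtain U where "openin X U" "A i \<subseteq> U" "inner U < outer (A i) + ennreal (e * (1/2)^Suc i)"
        unfolding outer_def[of "A i"] INF_less_iff by blast
      then show ?thesis by (auto intro: less_imp_le)
    qed
    then obtain U where U: "\<And>i. openin X (U i)" "\<And>i. A i \<subseteq> U i"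
      "\<And>i. inner (U i) \<le> outer (A i) + e * (1/2)^Suc i"
      by metis
    have "outer (\<Union>i. A i) \<le> inner (\<Union>i. U i)"
      using U by (intro outer_le_inner) (blast intro: openin_Union)+
    also have "\<dots> \<le> (\<Sum>i. inner (U i))" by (intro inner_UN U)
    also have "\<dots> \<le> (\<Sum>i. outer (A i) + ennreal (e * (1/2)^Suc i))"
      by (intro suminf_le U) auto
    also have "\<dots> = (\<Sum>i. outer (A i)) + (\<Sum>i. ennreal (e * (1/2)^Suc i))"
      by (intro suminf_add[symmetric]) auto
    also have "(\<Sum>i. ennreal (e * (1/2)^Suc i)) = ennreal (\<Sum>i. e * (1/2)^Suc i)"
      using e by (intro suminf_ennreal2) (auto intro!: summable_mult summable_geometric simp: summable_Suc_iff)
    also have "(\<Sum>i. e * (1/2)^Suc i) = e"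
      using sums_mult[OF power_half_series, of e] sums_unique by fastforce
    finally show "outer (\<Union>i. A i) \<le> (\<Sum>i. outer (A i)) + ennreal e" .
  qed
qed

lemma outer_measure_space_outer: "outer_measure_space (Pow (topspace X)) outer"
  unfolding outer_measure_space_def positive_def increasing_def
  by (auto simp: outer_countably_subadditive outer_mono outer_open inner_empty)

lemma outer_Un:
  assumes "A \<subseteq> topspace X" "B \<subseteq> topspace X" "A \<inter> B = {}"
  shows "outer (A \<union> B) \<le> outer A + outer B"
proof -
  have "outer (\<Union>i. binaryset A B i) \<le> (\<Sum>i. outer (binaryset A B i))"
  proof (rule outer_countably_subadditive[unfolded countably_subadditive_def, rule_format])
    show "range (binaryset A B) \<subseteq> Pow (topspace X)" "(\<Union>i. binaryset A B i) \<in> Pow (topspace X)"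
      using assms by (auto simp: range_binaryset_eq UN_binaryset_eq)
    show "disjoint_family (binaryset A B)"
      using assms by (auto simp: disjoint_family_on_def binaryset_def)
  qed
  then show ?thesis
    using suminf_binaryset_eq[of outer A B] by (simp add: UN_binaryset_eq outer_open inner_empty)
qed

text \<open>The criterion is first tested on an open V in place of A. If K is compact in U \<inter>
  V, then V - K is open, contains V - U, and its compact subsets are disjoint from K, so additivity
  of the content suffices. The infimum defining \<open>outer A\<close> carries the inequality from V
  to A.\<close>

lemma open_caratheodory_measurable:
  assumes U: "openin X U"
  shows "U \<in> lambda_system (topspace X) (Pow (topspace X)) outer"
  unfolding lambda_system_def
proof (intro CollectI conjI ballI)
  show "U \<in> Pow (topspace X)" using openin_subset[OF U] by auto
  fix A assume "A \<in> Pow (topspace X)"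
  then have A: "A \<subseteq> topspace X" by auto
  have split: "inner (U \<inter> V) + outer (V - U) \<le> inner V" if V: "openin X V" for V
  proof -
    have "c K + outer (V - U) \<le> inner V" if K: "compactin X K" "K \<subseteq> U \<inter> V" for K
    proof -
      have "openin X (V - K)"
        using V K compactin_imp_closedin[OF Hausdorff] by blast
      then have "outer (V - U) \<le> inner (V - K)" using K by (intro outer_le_inner) auto
      also have "c K + inner (V - K) = (SUP L\<in>{L. compactin X L \<and> L \<subseteq> V - K}. c K + c L)"
        unfolding inner_def by (rule ennreal_SUP_add_right) (use compactin_empty in blast)
      also have "\<dots> \<le> inner V"
      proof (rule SUP_least, clarify)
        fix L assume L: "compactin X L" "L \<subseteq> V - K"
        have "c K + c L = c (K \<union> L)"
          using K L by (intro content_additive[symmetric]) (auto simp: disjnt_iff)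
        also have "\<dots> \<le> inner V"
          using K L by (intro content_le_inner compactin_Un) auto
        finally show "c K + c L \<le> inner V" .
      qed
      finally show ?thesis by (simp add: add_left_mono)
    qed
    then have "(SUP K\<in>{K. compactin X K \<and> K \<subseteq> U \<inter> V}. c K + outer (V - U)) \<le> inner V"
      by (auto intro: SUP_least)
    then show ?thesis
      unfolding inner_def[of "U \<inter> V"] by (subst ennreal_SUP_add_left[symmetric]) auto
  qed
  have "outer (U \<inter> A) + outer ((topspace X - U) \<inter> A) \<le> outer A"
    unfolding outer_def[of A]
  proof (rule INF_greatest, clarify)
    fix V assume V: "openin X V" "A \<subseteq> V"
    have "outer (U \<inter> A) + outer ((topspace X - U) \<inter> A) \<le> inner (U \<inter> V) + outer (V - U)"
      using U V by (intro add_mono outer_le_inner outer_mono) auto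
    also have "\<dots> \<le> inner V" by (rule split[OF V(1)])
    finally show "outer (U \<inter> A) + outer ((topspace X - U) \<inter> A) \<le> inner V" .
  qed
  moreover have "outer A \<le> outer (U \<inter> A) + outer ((topspace X - U) \<inter> A)"
  proof -
    have "A = (U \<inter> A) \<union> ((topspace X - U) \<inter> A)" using A by blast
    then show ?thesis using outer_Un[of "U \<inter> A" "(topspace X - U) \<inter> A"] A by auto
  qed
  ultimately show "outer (U \<inter> A) + outer ((topspace X - U) \<inter> A) = outer A"
    by (rule antisym)
qed

definition content_measure :: "'a measure"
  where "content_measure = measure_of (topspace X) (sets (borel_of X)) outer"

lemma sets_content_measure: "sets content_measure = sets (borel_of X)"
  unfolding content_measure_def
  by (rule sigma_algebra.sets_measure_of_eq[OF sigma_algebra_borel_of])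

text \<open>Caratheodory's measurable sets form a sigma algebra containing the open sets, so the
  outer measure restricts to a measure on the Borel sets.\<close>

lemma emeasure_content_measure:
  assumes A: "A \<in> sets (borel_of X)"
  shows "emeasure content_measure A = outer A"
proof -
  interpret sigma_algebra "topspace X" "Pow (topspace X)" by (rule sigma_algebra_Pow)
  have ms: "measure_space (topspace X) (lambda_system (topspace X) (Pow (topspace X)) outer) outer"
    by (rule caratheodory_lemma[OF outer_measure_space_outer])
  then have "sigma_algebra (topspace X) (lambda_system (topspace X) (Pow (topspace X)) outer)"
    by (simp add: measure_space_def)
  then have "sets (borel_of X) \<subseteq> lambda_system (topspace X) (Pow (topspace X)) outer"
    unfolding sets_borel_of
    by (rule sigma_algebra.sigma_sets_subset) (use open_caratheodory_measurable in auto)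
  then have "measure_space (topspace X) (sets (borel_of X)) outer"
    by (rule measure_down[OF ms sigma_algebra_borel_of])
  then show ?thesis
    unfolding content_measure_def measure_space_def
    using A by (intro emeasure_measure_of_sigma) auto
qed

lemma emeasure_content_measure_open:
  "openin X U \<Longrightarrow> emeasure content_measure U = inner U"
  by (simp add: emeasure_content_measure borel_of_openin outer_open)

text \<open>Equality may fail, since c K need not be the infimum over neighbourhoods of K. The lower
  bound is what inner regularity of open sets and nontriviality of the measure require.\<close>

lemma content_le_emeasure: "compactin X K \<Longrightarrow> c K \<le> emeasure content_measure K"
  by (auto simp: emeasure_content_measure borel_of_compactin[OF Hausdorff] outer_def
      intro!: INF_greatest content_le_inner)

lemma radon_content_measure: "radon_measure X content_measure"
  unfolding radon_measure_def
proof (intro conjI ballI allI impI)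
  show "sets content_measure = sets (borel_of X)" by (rule sets_content_measure)
next
  fix K assume K: "compactin X K"
  \<comment> \<open>A compact neighbourhood L of K bounds the measure of K by the finite number c L;
    c K itself is only a lower bound.\<close>
  then obtain U L where UL: "openin X U" "compactin X L" "K \<subseteq> U" "U \<subseteq> L"
    using loc_compact locally_compact_space_compact_closed_compact[of X] Hausdorff by blast
  have "emeasure content_measure K \<le> inner U"
    using UL K by (simp add: emeasure_content_measure borel_of_compactin Hausdorff outer_le_inner)
  also have "\<dots> \<le> c L"
    unfolding inner_def using UL by (auto intro!: SUP_least content_mono)
  also have "\<dots> < \<infinity>" using UL by (intro content_finite)
  finally show "emeasure content_measure K < \<infinity>" .
next
  fix E assume "E \<in> sets content_measure"
  then have "emeasure content_measure E = outer E"
    by (simp add: sets_content_measure emeasure_content_measure)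
  also have "\<dots> = (INF U\<in>{U. openin X U \<and> E \<subseteq> U}. emeasure content_measure U)"
    unfolding outer_def by (rule INF_cong) (auto simp: emeasure_content_measure_open)
  finally show "emeasure content_measure E = \<dots>" .
next
  fix U assume U: "openin X U"
  show "emeasure content_measure U = (SUP K\<in>{K. compactin X K \<and> K \<subseteq> U}. emeasure content_measure K)"
  proof (rule antisym)
    show "emeasure content_measure U \<le> (SUP K\<in>{K. compactin X K \<and> K \<subseteq> U}. emeasure content_measure K)"
      unfolding emeasure_content_measure_open[OF U] inner_def
      by (rule SUP_mono) (use content_le_emeasure in blast)
    show "(SUP K\<in>{K. compactin X K \<and> K \<subseteq> U}. emeasure content_measure K) \<le> emeasure content_measure U"
      using U by (auto intro!: SUP_least emeasure_mono simp: sets_content_measure borel_of_openin)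
  qed
qed

end

section \<open>Compactly supported functions and positive functionals\<close>

text \<open>The support condition asks for vanishing off some compact set, which avoids closures.
  Values outside \<open>topspace X\<close> are unconstrained, so equality of such functions is
  always tested on the space only.\<close>

definition Cc :: "'a topology \<Rightarrow> ('a \<Rightarrow> real) set"
  where "Cc X = {f. continuous_map X euclideanreal f \<and>
    (\<exists>K. compactin X K \<and> (\<forall>x\<in>topspace X - K. f x = 0))}"

lemma Cc_I:
  "continuous_map X euclideanreal f \<Longrightarrow> compactin X K \<Longrightarrow>
    (\<And>x. x \<in> topspace X \<Longrightarrow> x \<notin> K \<Longrightarrow> f x = 0) \<Longrightarrow> f \<in> Cc X"
  by (auto simp: Cc_def)

lemma Cc_support: "f \<in> Cc X \<Longrightarrow> \<exists>K. compactin X K \<and> (\<forall>x\<in>topspace X - K. f x = 0)"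
  by (simp add: Cc_def)

lemma Cc_continuous: "f \<in> Cc X \<Longrightarrow> continuous_map X euclideanreal f"
  by (simp add: Cc_def)

lemma Cc_mult:
  assumes f: "f \<in> Cc X" and g: "continuous_map X euclideanreal g"
  shows "(\<lambda>x. g x * f x) \<in> Cc X"
proof -
  obtain K where "compactin X K" "\<And>x. x \<in> topspace X \<Longrightarrow> x \<notin> K \<Longrightarrow> f x = 0"
    using Cc_support[OF f] by blast
  then show ?thesis
    using Cc_continuous[OF f] g by (intro Cc_I[of _ _ K] continuous_map_real_mult) auto
qed

lemma Cc_cmult: "f \<in> Cc X \<Longrightarrow> (\<lambda>x. a * f x) \<in> Cc X"
  by (rule Cc_mult) auto

lemma Cc_add:
  assumes f: "f \<in> Cc X" and g: "g \<in> Cc X"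
  shows "(\<lambda>x. f x + g x) \<in> Cc X"
proof -
  obtain K L where "compactin X K" "\<And>x. x \<in> topspace X \<Longrightarrow> x \<notin> K \<Longrightarrow> f x = 0"
    and "compactin X L" "\<And>x. x \<in> topspace X \<Longrightarrow> x \<notin> L \<Longrightarrow> g x = 0"
    using Cc_support[OF f] Cc_support[OF g] by blast
  then show ?thesis
    using Cc_continuous[OF f] Cc_continuous[OF g]
    by (intro Cc_I[of _ _ "K \<union> L"] continuous_map_add compactin_Un) auto
qed

lemma Cc_bounded:
  assumes f: "f \<in> Cc X"
  obtains B where "0 \<le> B" "\<And>x. x \<in> topspace X \<Longrightarrow> \<bar>f x\<bar> \<le> B"
proof -
  obtain K where K: "compactin X K" "\<And>x. x \<in> topspace X \<Longrightarrow> x \<notin> K \<Longrightarrow> f x = 0"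
    using Cc_support[OF f] by blast
  have "compactin euclideanreal (f ` K)"
    using K Cc_continuous[OF f] image_compactin by blast
  then have "bounded (f ` K)" by (simp add: compact_imp_bounded)
  then obtain B where B: "\<And>x. x \<in> K \<Longrightarrow> \<bar>f x\<bar> \<le> B" by (auto simp: bounded_iff)
  show thesis
    by (rule that[of "max 0 B"]) (use B K in fastforce)+
qed

section \<open>Urysohn functions on locally compact Hausdorff spaces\<close>

locale lch_space =
  fixes X :: "'a topology"
  assumes Hausdorff: "Hausdorff_space X" and loc_compact: "locally_compact_space X"
begin

text \<open>The open subspace U is itself locally compact and Hausdorff, so the neighbourhood can be
  found inside it.\<close>

lemma compact_neighbourhood:
  assumes "compactin X K" "openin X U" "K \<subseteq> U"
  obtains V L where "openin X V" "compactin X L" "K \<subseteq> V" "V \<subseteq> L" "L \<subseteq> U"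
proof -
  have lc: "locally_compact_space (subtopology X U)"
    using assms(2) loc_compact Hausdorff by (intro locally_compact_space_open_subset) auto
  have "compactin (subtopology X U) K" using assms by (simp add: compactin_subtopology)
  then obtain V L where "openin (subtopology X U) V" "compactin (subtopology X U) L" "K \<subseteq> V" "V \<subseteq> L"
    using lc locally_compact_space_compact_closed_compact[of "subtopology X U"]
      Hausdorff_space_subtopology[OF Hausdorff] by blast
  then show thesis
    using that assms(2) by (meson compactin_subtopology openin_trans_full)
qed

text \<open>The function is made to vanish off V, not merely off U, so that the compact set L with V
  \<subseteq> L \<subseteq> U carries its support.\<close>

lemma Urysohn_Cc:
  assumes K: "compactin X K" and U: "openin X U" "K \<subseteq> U"
  obtains f where "f \<in> Cc X" "\<And>x. x \<in> topspace X \<Longrightarrow> 0 \<le> f x" "\<And>x. x \<in> topspace X \<Longrightarrow> f x \<le> 1"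
    "\<And>x. x \<in> K \<Longrightarrow> f x = 1" "\<And>x. x \<in> topspace X \<Longrightarrow> x \<notin> U \<Longrightarrow> f x = 0"
proof -
  obtain V L where VL: "openin X V" "compactin X L" "K \<subseteq> V" "V \<subseteq> L" "L \<subseteq> U"
    using compact_neighbourhood[OF assms] .
  have "completely_regular_space X"
    using Hausdorff loc_compact locally_compact_regular_imp_completely_regular_space
      locally_compact_Hausdorff_imp_regular_space by blast
  moreover have "closedin X (topspace X - V)" "disjnt K (topspace X - V)"
    using VL by (auto simp: disjnt_iff)
  ultimately obtain f where f: "continuous_map X (top_of_set {0..1::real}) f"
    "f ` (topspace X - V) \<subseteq> {0}" "f ` K \<subseteq> {1}"
    using Urysohn_completely_regular_compact_closed[of 0 1 X K "topspace X - V"] K by auto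
  then have 01: "f x \<in> {0..1}" if "x \<in> topspace X" for x
    using that by (auto simp: continuous_map_in_subtopology)
  show thesis
  proof (rule that[of f])
    show "f \<in> Cc X"
    proof (rule Cc_I[of _ _ L])
      show "continuous_map X euclideanreal f" using f by (simp add: continuous_map_in_subtopology)
      show "f x = 0" if "x \<in> topspace X" "x \<notin> L" for x
        using that VL f(2) by (metis Diff_iff image_subset_iff singletonD subsetD)
    qed (rule VL)
    show "f x = 0" if "x \<in> topspace X" "x \<notin> U" for x
      using that VL f(2) by (metis Diff_iff image_subset_iff singletonD subsetD)
  qed (use 01 f in auto)
qed

lemma Urysohn_Cc_one:
  assumes K: "compactin X K"
  obtains f where "f \<in> Cc X" "\<And>x. x \<in> topspace X \<Longrightarrow> 0 \<le> f x" "\<And>x. x \<in> K \<Longrightarrow> f x = 1"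
  using Urysohn_Cc[OF K openin_topspace compactin_subset_topspace[OF K]] by metis

end

section \<open>Radon measures compared through integrals of compactly supported functions\<close>

lemma radon_sets: "radon_measure X M \<Longrightarrow> sets M = sets (borel_of X)"
  by (simp add: radon_measure_def)

lemma radon_space: "radon_measure X M \<Longrightarrow> space M = topspace X"
  using sets_eq_imp_space_eq[OF radon_sets] by (simp add: space_borel_of)

lemma radon_finite: "radon_measure X M \<Longrightarrow> compactin X K \<Longrightarrow> emeasure M K < \<infinity>"
  by (simp add: radon_measure_def)

lemma radon_outer:
  "radon_measure X M \<Longrightarrow> E \<in> sets M \<Longrightarrow>
    emeasure M E = (INF U\<in>{U. openin X U \<and> E \<subseteq> U}. emeasure M U)"
  by (simp add: radon_measure_def)

lemma radon_inner:
  "radon_measure X M \<Longrightarrow> openin X U \<Longrightarrow>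
    emeasure M U = (SUP K\<in>{K. compactin X K \<and> K \<subseteq> U}. emeasure M K)"
  by (simp add: radon_measure_def)

lemma continuous_map_borel_measurable:
  assumes f: "continuous_map X euclidean f" and M: "sets M = sets (borel_of X)"
  shows "f \<in> borel_measurable M"
proof (rule borel_measurableI)
  fix S :: "'b set" assume "open S"
  then have "openin X {x \<in> topspace X. f x \<in> S}"
    using openin_continuous_map_preimage[OF f] by simp
  moreover have "f -` S \<inter> space M = {x \<in> topspace X. f x \<in> S}"
    using sets_eq_imp_space_eq[OF M] by (auto simp: space_borel_of)
  ultimately show "f -` S \<inter> space M \<in> sets M"
    by (simp add: M borel_of_openin)
qed

context lch_space
begin

lemma integrable_Cc:
  assumes M: "radon_measure X M" and f: "f \<in> Cc X"
  shows "integrable M f"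
proof -
  obtain K where K: "compactin X K" "\<And>x. x \<in> topspace X \<Longrightarrow> x \<notin> K \<Longrightarrow> f x = 0"
    using Cc_support[OF f] by blast
  obtain B where B: "\<And>x. x \<in> topspace X \<Longrightarrow> \<bar>f x\<bar> \<le> B" using Cc_bounded[OF f] by metis
  show ?thesis
  proof (rule integrableI_bounded_set[of K])
    show "K \<in> sets M" using K M by (simp add: radon_sets borel_of_compactin Hausdorff)
    show "f \<in> borel_measurable M"
      using Cc_continuous[OF f] radon_sets[OF M] by (rule continuous_map_borel_measurable)
    show "emeasure M K < \<infinity>" using M K(1) by (rule radon_finite)
    show "AE x in M. x \<in> K \<longrightarrow> norm (f x) \<le> B"
      using B compactin_subset_topspace[OF K(1)] by (intro AE_I2) auto
    show "AE x in M. x \<notin> K \<longrightarrow> f x = 0"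
      using K by (intro AE_I2) (auto simp: radon_space[OF M])
  qed
qed

lemma integrable_indicator_Cc:
  assumes M: "radon_measure X M" and f: "f \<in> Cc X" and B: "B \<in> sets M"
  shows "integrable M (\<lambda>x. indicator B x * f x :: real)"
  using integrable_mult_indicator[OF B integrable_Cc[OF M f]] by simp

text \<open>A Urysohn function f with indicator K \<le> f \<le> indicator U gives the bound for open
  U by inner regularity of N; outer regularity of M extends it to Borel sets.\<close>

lemma radon_le_of_integral_le:
  assumes M: "radon_measure X M" and N: "radon_measure X N" and c: "0 < c"
    and le: "\<And>f. f \<in> Cc X \<Longrightarrow> (\<forall>x\<in>topspace X. 0 \<le> f x) \<Longrightarrow> (\<integral>x. f x \<partial>N) \<le> c * (\<integral>x. f x \<partial>M)"
    and E: "E \<in> sets (borel_of X)"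
  shows "emeasure N E \<le> ennreal c * emeasure M E"
proof -
  have op: "emeasure N U \<le> ennreal c * emeasure M U" if U: "openin X U" for U
  proof -
    have "emeasure N K \<le> ennreal c * emeasure M U" if K: "compactin X K" "K \<subseteq> U" for K
    proof -
      obtain f where f: "f \<in> Cc X" "\<And>x. x \<in> topspace X \<Longrightarrow> 0 \<le> f x"
        "\<And>x. x \<in> topspace X \<Longrightarrow> f x \<le> 1" "\<And>x. x \<in> K \<Longrightarrow> f x = 1"
        "\<And>x. x \<in> topspace X \<Longrightarrow> x \<notin> U \<Longrightarrow> f x = 0"
        using Urysohn_Cc[OF K(1) U K(2)] by blast
      have KN: "K \<in> sets N" using N K by (simp add: radon_sets borel_of_compactin Hausdorff)
      have UM: "U \<in> sets M" using M U by (simp add: radon_sets borel_of_openin)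
      have "emeasure N K = (\<integral>\<^sup>+x. indicator K x \<partial>N)" using KN by simp
      also have "\<dots> \<le> (\<integral>\<^sup>+x. ennreal (f x) \<partial>N)"
        using f by (intro nn_integral_mono) (auto simp: indicator_def)
      also have "\<dots> = ennreal (\<integral>x. f x \<partial>N)"
        using f by (intro nn_integral_eq_integral integrable_Cc N) (auto simp: radon_space[OF N])
      also have "\<dots> \<le> ennreal (c * (\<integral>x. f x \<partial>M))"
        using f by (intro ennreal_leI le) auto
      also have "\<dots> = ennreal c * ennreal (\<integral>x. f x \<partial>M)" using c by (simp add: ennreal_mult')
      also have "ennreal (\<integral>x. f x \<partial>M) = (\<integral>\<^sup>+x. ennreal (f x) \<partial>M)"
        using f by (intro nn_integral_eq_integral[symmetric] integrable_Cc M) (auto simp: radon_space[OF M])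
      also have "\<dots> \<le> (\<integral>\<^sup>+x. indicator U x \<partial>M)"
        using f by (intro nn_integral_mono) (auto simp: indicator_def radon_space[OF M])
      also have "\<dots> = emeasure M U" using UM by simp
      finally show ?thesis by (simp add: mult_left_mono)
    qed
    then show ?thesis
      unfolding radon_inner[OF N U] by (auto intro: SUP_least)
  qed
  \<comment> \<open>Moving the constant to the left leaves a bare infimum on the right, to which
    outer regularity of M applies directly.\<close>
  have "ennreal (1 / c) * emeasure N E \<le> emeasure M U" if U: "openin X U" "E \<subseteq> U" for U
  proof -
    have "emeasure N E \<le> emeasure N U"
      using U N by (intro emeasure_mono) (auto simp: radon_sets borel_of_openin)
    also have "\<dots> \<le> ennreal c * emeasure M U" by (rule op[OF U(1)])
    finally have "ennreal (1 / c) * emeasure N E \<le> ennreal (1 / c) * (ennreal c * emeasure M U)"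
      by (rule mult_left_mono) simp
    also have "\<dots> = emeasure M U"
      using c by (simp add: mult.assoc[symmetric] ennreal_mult'[symmetric])
    finally show ?thesis .
  qed
  then have "ennreal (1 / c) * emeasure N E \<le> emeasure M E"
    using M E by (subst radon_outer[OF M]) (auto simp: radon_sets intro: INF_greatest)
  then have "ennreal c * (ennreal (1 / c) * emeasure N E) \<le> ennreal c * emeasure M E"
    by (rule mult_left_mono) simp
  then show ?thesis
    using c by (simp add: mult.assoc[symmetric] ennreal_mult'[symmetric])
qed

lemma radon_proportional:
  assumes M: "radon_measure X M" and N: "radon_measure X N" and c: "0 < c"
    and eq: "\<And>f. f \<in> Cc X \<Longrightarrow> (\<integral>x. f x \<partial>N) = c * (\<integral>x. f x \<partial>M)"
    and E: "E \<in> sets (borel_of X)"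
  shows "emeasure N E = ennreal c * emeasure M E"
proof (rule antisym)
  show "emeasure N E \<le> ennreal c * emeasure M E"
    by (rule radon_le_of_integral_le[OF M N c _ E]) (simp add: eq)
  have "emeasure M E \<le> ennreal (1 / c) * emeasure N E"
    using c by (intro radon_le_of_integral_le[OF N M _ _ E]) (auto simp: eq)
  then have "ennreal c * emeasure M E \<le> ennreal c * (ennreal (1 / c) * emeasure N E)"
    by (rule mult_left_mono) simp
  then show "ennreal c * emeasure M E \<le> emeasure N E"
    using c by (simp add: mult.assoc[symmetric] ennreal_mult'[symmetric])
qed

end

text \<open>The cover may be uncountable, so countable subadditivity does not apply. Inner
  regularity reduces the claim to compact sets, where a finite subcover is available.\<close>

lemma radon_null_cover:
  assumes M: "radon_measure X M"
    and cover: "topspace X \<subseteq> \<Union>\<U>" and null: "\<And>U. U \<in> \<U> \<Longrightarrow> openin X U \<and> emeasure M U = 0"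
  shows "emeasure M (space M) = 0"
proof -
  have "emeasure M K = 0" if K: "compactin X K" for K
  proof -
    have "K \<subseteq> \<Union>\<U>" using cover compactin_subset_topspace[OF K] by (rule subset_trans[rotated])
    then obtain \<F> where F: "finite \<F>" "\<F> \<subseteq> \<U>" "K \<subseteq> \<Union>\<F>"
      using compactinD[OF K, of \<U>] null by metis
    have "emeasure M (\<Union>\<F>) \<le> (\<Sum>U\<in>\<F>. emeasure M U)"
      using emeasure_subadditive_finite[of \<F> id M] F null M by (auto simp: radon_sets)
    also have "\<dots> = 0" using F null by (auto intro!: sum.neutral)
    finally have "emeasure M (\<Union>\<F>) = 0" by simp
    moreover have "\<Union>\<F> \<in> sets M" using F null M by (auto simp: radon_sets openin_Union subset_iff)
    ultimately show ?thesis using emeasure_mono[OF F(3), of M] by simp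
  qed
  then show ?thesis
    unfolding radon_space[OF M] radon_inner[OF M openin_topspace]
    by (intro antisym SUP_least) auto
qed

section \<open>Positive functionals and their interchange with integrals\<close>

locale positive_functional = lch_space +
  fixes I :: "('a \<Rightarrow> real) \<Rightarrow> real"
  assumes add: "f \<in> Cc X \<Longrightarrow> g \<in> Cc X \<Longrightarrow> I (\<lambda>x. f x + g x) = I f + I g"
    and scale: "f \<in> Cc X \<Longrightarrow> I (\<lambda>x. a * f x) = a * I f"
    and mono: "f \<in> Cc X \<Longrightarrow> g \<in> Cc X \<Longrightarrow> (\<And>x. x \<in> topspace X \<Longrightarrow> f x \<le> g x) \<Longrightarrow> I f \<le> I g"
begin

text \<open>Since \<open>mono\<close> compares functions on \<open>topspace X\<close> only, it
  forces the functional to ignore their values elsewhere.\<close>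

lemma cong: "f \<in> Cc X \<Longrightarrow> g \<in> Cc X \<Longrightarrow> (\<And>x. x \<in> topspace X \<Longrightarrow> f x = g x) \<Longrightarrow> I f = I g"
  by (intro antisym mono) auto

lemma zero: "f \<in> Cc X \<Longrightarrow> (\<And>x. x \<in> topspace X \<Longrightarrow> f x = 0) \<Longrightarrow> I f = 0"
  using cong[of f "\<lambda>x. 0 * f x"] scale[of f 0] Cc_cmult[of f X 0] by simp

lemma nonneg: "f \<in> Cc X \<Longrightarrow> (\<And>x. x \<in> topspace X \<Longrightarrow> 0 \<le> f x) \<Longrightarrow> 0 \<le> I f"
  using mono[of "\<lambda>x. 0 * f x" f] scale[of f 0] Cc_cmult[of f X 0] by simp

text \<open>Positivity stands in for a norm: with p equal to 1 on a common compact support, this is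
  continuity under uniform convergence.\<close>

lemma close:
  assumes f: "f \<in> Cc X" and g: "g \<in> Cc X" and p: "p \<in> Cc X"
    and le: "\<And>x. x \<in> topspace X \<Longrightarrow> \<bar>f x - g x\<bar> \<le> e * p x"
  shows "\<bar>I f - I g\<bar> \<le> e * I p"
proof -
  have p': "(\<lambda>x. e * p x) \<in> Cc X" by (rule Cc_cmult[OF p])
  have "I f \<le> I (\<lambda>x. g x + e * p x)"
    using le by (intro mono f Cc_add g p') (auto simp: abs_le_iff algebra_simps)
  moreover have "I g \<le> I (\<lambda>x. f x + e * p x)"
    using le by (intro mono f Cc_add g p') (force simp: abs_le_iff algebra_simps)
  ultimately show ?thesis
    by (simp add: add[OF f p'] add[OF g p'] scale[OF p] abs_le_iff)
qed

end

text \<open>The indicator is carried along because the interchange argument below cuts the domain of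
  integration into Borel pieces.\<close>

lemma (in lch_space) positive_functional_integral:
  assumes M: "radon_measure X M" and B: "B \<in> sets M"
  shows "positive_functional X (\<lambda>f. \<integral>x. indicator B x * f x \<partial>M)"
proof
  fix f g assume f: "f \<in> Cc X" and g: "g \<in> Cc X"
  show "(\<integral>x. indicator B x * (f x + g x) \<partial>M) = (\<integral>x. indicator B x * f x \<partial>M) + (\<integral>x. indicator B x * g x \<partial>M)"
    using integrable_indicator_Cc[OF M _ B] f g by (simp add: distrib_left)
  assume "\<And>x. x \<in> topspace X \<Longrightarrow> f x \<le> g x"
  then show "(\<integral>x. indicator B x * f x \<partial>M) \<le> (\<integral>x. indicator B x * g x \<partial>M)"
    using integrable_indicator_Cc[OF M _ B] f g
    by (intro integral_mono) (auto simp: radon_space[OF M] mult_left_mono)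
next
  fix f a assume "f \<in> Cc X"
  show "(\<integral>x. indicator B x * (a * f x) \<partial>M) = a * (\<integral>x. indicator B x * f x \<partial>M)"
    by (subst integral_mult_right_zero[symmetric]) (simp add: mult.left_commute)
qed

lemma (in lch_space) positive_functional_integral_UNIV:
  assumes M: "radon_measure X M"
  shows "positive_functional X (\<lambda>f. \<integral>x. f x \<partial>M)"
proof
  fix f g assume f: "f \<in> Cc X" and g: "g \<in> Cc X"
  show "(\<integral>x. f x + g x \<partial>M) = (\<integral>x. f x \<partial>M) + (\<integral>x. g x \<partial>M)"
    using integrable_Cc[OF M] f g by simp
  assume "\<And>x. x \<in> topspace X \<Longrightarrow> f x \<le> g x"
  then show "(\<integral>x. f x \<partial>M) \<le> (\<integral>x. g x \<partial>M)"
    using integrable_Cc[OF M] f g by (intro integral_mono) (auto simp: radon_space[OF M])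
qed simp

lemma continuous_map_slice:
  assumes F: "continuous_map (prod_topology Y X) Z (\<lambda>(y, x). F y x)" and y: "y \<in> topspace Y"
  shows "continuous_map X Z (F y)"
proof -
  have "continuous_map X (prod_topology Y X) (\<lambda>x. (y, x))"
    using y by (intro continuous_map_pairedI) auto
  from continuous_map_compose[OF this F] show ?thesis by (simp add: o_def)
qed

text \<open>This is the tube lemma: the inequality holds on the compact set {y} x L, hence on A x L
  for a neighbourhood A of y, while off L both values vanish.\<close>

lemma equicontinuous_of_locally_compact_support:
  fixes F :: "'b \<Rightarrow> 'a \<Rightarrow> real"
  assumes F: "continuous_map (prod_topology Y X) euclideanreal (\<lambda>(y, x). F y x)"
    and y: "y \<in> topspace Y" "openin Y U" "y \<in> U" and L: "compactin X L"
    and supp: "\<And>u x. u \<in> U \<Longrightarrow> x \<in> topspace X \<Longrightarrow> x \<notin> L \<Longrightarrow> F u x = 0" and e: "0 < e"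
  obtains V where "openin Y V" "y \<in> V" "V \<subseteq> U"
    "\<And>u x. u \<in> V \<Longrightarrow> x \<in> topspace X \<Longrightarrow> \<bar>F u x - F y x\<bar> \<le> e"
    "\<And>u x. u \<in> V \<Longrightarrow> x \<in> L \<Longrightarrow> \<bar>F u x - F y x\<bar> \<le> e"
proof -
  let ?G = "\<lambda>z. F (fst z) (snd z) - F y (snd z)"
  have "continuous_map (prod_topology Y X) euclideanreal ?G"
  proof (intro continuous_map_diff)
    show "continuous_map (prod_topology Y X) euclideanreal (\<lambda>z. F (fst z) (snd z))"
      using F by (simp add: case_prod_beta')
    show "continuous_map (prod_topology Y X) euclideanreal (\<lambda>z. F y (snd z))"
      using continuous_map_compose[OF continuous_map_snd continuous_map_slice[OF F y(1)], of Y]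
      by (simp add: o_def)
  qed
  then have "openin (prod_topology Y X) {z \<in> topspace (prod_topology Y X). ?G z \<in> {-e<..<e}}" (is "openin _ ?W")
    by (rule openin_continuous_map_preimage) auto
  moreover have "{y} \<times> L \<subseteq> ?W"
    using y e compactin_subset_topspace[OF L] by auto
  ultimately obtain A B where AB: "openin Y A" "openin X B" "{y} \<subseteq> A" "L \<subseteq> B" "A \<times> B \<subseteq> ?W"
    using Wallace_theorem_prod_topology[of Y "{y}" X L ?W] L y by auto
  have L': "\<bar>F u x - F y x\<bar> \<le> e" if "u \<in> A \<inter> U" "x \<in> L" for u x
  proof -
    have "(u, x) \<in> ?W" using AB that by blast
    then show ?thesis by (auto simp: abs_le_iff)
  qed
  show thesis
    by (rule that[of "A \<inter> U"]) (use AB y e L' supp in \<open>auto, metis abs_zero diff_zero less_imp_le\<close>)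
qed

context positive_functional
begin

text \<open>Near each parameter the supports lie in one compact set L; a cutoff p equal to 1 on L
  turns uniform closeness of the functions into closeness of the values of I.\<close>

lemma continuous_map_functional:
  fixes F :: "'b \<Rightarrow> 'a \<Rightarrow> real"
  assumes F: "continuous_map (prod_topology Y X) euclideanreal (\<lambda>(y, x). F y x)"
    and supp: "\<And>y. y \<in> topspace Y \<Longrightarrow>
      \<exists>U L. openin Y U \<and> y \<in> U \<and> compactin X L \<and> (\<forall>u\<in>U. \<forall>x\<in>topspace X - L. F u x = 0)"
  shows "continuous_map Y euclideanreal (\<lambda>y. I (F y))"
proof -
  have FC: "F y \<in> Cc X" if y: "y \<in> topspace Y" for y
    using supp[OF y] continuous_map_slice[OF F y] by (auto intro: Cc_I)
  have "\<exists>V. openin Y V \<and> y \<in> V \<and> (\<forall>u\<in>V. I (F u) \<in> ball (I (F y)) e)"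
    if y: "y \<in> topspace Y" and e: "0 < e" for y e
  proof -
    obtain U L where UL: "openin Y U" "y \<in> U" "compactin X L"
      "\<And>u x. u \<in> U \<Longrightarrow> x \<in> topspace X \<Longrightarrow> x \<notin> L \<Longrightarrow> F u x = 0"
      using supp[OF y] by blast
    obtain p where p: "p \<in> Cc X" "\<And>x. x \<in> topspace X \<Longrightarrow> 0 \<le> p x" "\<And>x. x \<in> L \<Longrightarrow> p x = 1"
      using Urysohn_Cc_one[OF UL(3)] by metis
    \<comment> \<open>Chosen to give d I p < e; the summand 1 keeps the denominator positive when I
      p = 0.\<close>
    define d where "d = e / (2 * (I p + 1))"
    have Ip: "0 \<le> I p" using p by (intro nonneg) auto
    then have d: "0 < d" using e by (simp add: d_def)
    have "d * I p < e"
      using Ip e by (simp add: d_def field_simps) (smt (verit) mult_nonneg_nonneg)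
    obtain V where V: "openin Y V" "y \<in> V" "V \<subseteq> U"
      "\<And>u x. u \<in> V \<Longrightarrow> x \<in> L \<Longrightarrow> \<bar>F u x - F y x\<bar> \<le> d"
      using equicontinuous_of_locally_compact_support[OF F y UL(1,2,3) _ d] UL(4) by metis
    have "I (F u) \<in> ball (I (F y)) e" if u: "u \<in> V" for u
    proof -
      have "\<bar>F u x - F y x\<bar> \<le> d * p x" if "x \<in> topspace X" for x
        using that u V UL p d by (cases "x \<in> L") auto
      then have "\<bar>I (F u) - I (F y)\<bar> \<le> d * I p"
        using u V y openin_subset[OF V(1)] by (intro close FC p) auto
      then show ?thesis
        using \<open>d * I p < e\<close> by (simp add: dist_real_def abs_minus_commute)
    qed
    then show ?thesis using V by blast
  qed
  then show ?thesis
    using Met_TC.continuous_map_to_metric[of Y "\<lambda>y. I (F y)"] by simp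
qed

end

lemma continuous_map_swap_args:
  assumes "continuous_map (prod_topology Y X) Z (\<lambda>(y, x). F y x)"
  shows "continuous_map (prod_topology X Y) Z (\<lambda>(x, y). F y x)"
proof -
  have "continuous_map (prod_topology X Y) (prod_topology Y X) (\<lambda>z. (snd z, fst z))"
    by (intro continuous_map_pairedI continuous_map_fst continuous_map_snd)
  from continuous_map_compose[OF this assms] show ?thesis by (simp add: o_def case_prod_beta')
qed

text \<open>An instance of \<open>continuous_map_functional\<close> with the roles exchanged: the
  integral over Y is the functional and X is the parameter space.\<close>

lemma (in lch_space) Cc_integral_kernel:
  fixes F :: "'b \<Rightarrow> 'a \<Rightarrow> real"
  assumes Y: "lch_space Y" and M: "radon_measure Y M"
    and F: "continuous_map (prod_topology Y X) euclideanreal (\<lambda>(y, x). F y x)"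
    and K: "compactin Y K" and L: "compactin X L"
    and supp: "\<And>y x. y \<in> topspace Y \<Longrightarrow> x \<in> topspace X \<Longrightarrow> y \<notin> K \<or> x \<notin> L \<Longrightarrow> F y x = 0"
  shows "(\<lambda>x. \<integral>y. F y x \<partial>M) \<in> Cc X"
proof (rule Cc_I[OF _ L])
  interpret J: positive_functional Y "\<lambda>f. \<integral>x. f x \<partial>M"
    by (rule lch_space.positive_functional_integral_UNIV[OF Y M])
  show "continuous_map X euclideanreal (\<lambda>x. \<integral>y. F y x \<partial>M)"
    by (rule J.continuous_map_functional[OF continuous_map_swap_args[OF F]]) (use K supp in blast)
  show "(\<integral>y. F y x \<partial>M) = 0" if "x \<in> topspace X" "x \<notin> L" for x
    using continuous_map_slice[OF continuous_map_swap_args[OF F] that(1)] K that supp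
    by (intro J.zero Cc_I) auto
qed

text \<open>
  Both sides are additive in the domain of integration and agree up to a multiple of \<open>e\<close> on small
  pieces, so neither a product measure nor \<open>\<sigma>\<close>-finiteness is needed.
\<close>

lemma (in positive_functional) Fubini_functional:
  fixes F :: "'b \<Rightarrow> 'a \<Rightarrow> real"
  assumes Y: "lch_space Y" and M: "radon_measure Y M"
    and F: "continuous_map (prod_topology Y X) euclideanreal (\<lambda>(y, x). F y x)"
    and K: "compactin Y K" and L: "compactin X L"
    and supp: "\<And>y x. y \<in> topspace Y \<Longrightarrow> x \<in> topspace X \<Longrightarrow> y \<notin> K \<or> x \<notin> L \<Longrightarrow> F y x = 0"
  shows "(\<integral>y. I (F y) \<partial>M) = I (\<lambda>x. \<integral>y. F y x \<partial>M)"
proof -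
  interpret Y: lch_space Y by fact
  have Fy: "F y \<in> Cc X" if "y \<in> topspace Y" for y
    using continuous_map_slice[OF F that] L supp that by (intro Cc_I) auto
  have Fx: "(\<lambda>y. F y x) \<in> Cc Y" if "x \<in> topspace X" for x
    using continuous_map_slice[OF continuous_map_swap_args[OF F] that] K supp that by (intro Cc_I) auto
  have IF: "(\<lambda>y. I (F y)) \<in> Cc Y"
  proof (rule Cc_I[OF _ K])
    show "continuous_map Y euclideanreal (\<lambda>y. I (F y))"
      by (rule continuous_map_functional[OF F]) (use L supp in blast)
    show "I (F y) = 0" if "y \<in> topspace Y" "y \<notin> K" for y
      using that supp by (intro zero Fy) auto
  qed
  have JF: "(\<lambda>x. \<integral>y. indicator B y * F y x \<partial>M) \<in> Cc X" if B: "B \<in> sets M" for B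
  proof (rule Cc_I[OF _ L])
    interpret J: positive_functional Y "\<lambda>f. \<integral>x. indicator B x * f x \<partial>M"
      by (rule Y.positive_functional_integral[OF M B])
    show "continuous_map X euclideanreal (\<lambda>x. \<integral>y. indicator B y * F y x \<partial>M)"
      by (rule J.continuous_map_functional[OF continuous_map_swap_args[OF F]]) (use K supp in blast)
    show "(\<integral>y. indicator B y * F y x \<partial>M) = 0" if "x \<in> topspace X" "x \<notin> L" for x
      using that supp by (intro J.zero Fx) auto
  qed
  obtain p where p: "p \<in> Cc X" "\<And>x. x \<in> topspace X \<Longrightarrow> 0 \<le> p x" "\<And>x. x \<in> L \<Longrightarrow> p x = 1"
    using Urysohn_Cc_one[OF L] by metis
  have Ip: "0 \<le> I p" using p by (intro nonneg) auto
  \<comment> \<open>The defect of the interchange over a piece B of the domain of integration. It is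
    to vanish on K, which contains all y with a nonzero slice.\<close>
  define \<Phi> where "\<Phi> B = (\<integral>y. indicator B y * I (F y) \<partial>M) - I (\<lambda>x. \<integral>y. indicator B y * F y x \<partial>M)" for B
  have KM: "K \<in> sets M" using K M by (simp add: radon_sets borel_of_compactin Y.Hausdorff)
  have finM: "emeasure M B < \<infinity>" if "B \<subseteq> K" for B
    using emeasure_mono[OF that KM] radon_finite[OF M K] by simp
  have \<Phi>_Un: "\<Phi> (A \<union> B) = \<Phi> A + \<Phi> B" if AB: "A \<in> sets M" "B \<in> sets M" "A \<inter> B = {}" for A B
  proof -
    have ind: "indicator (A \<union> B) y * r = indicator A y * r + indicator B y * r" for y and r :: real
      using AB(3) by (auto simp: indicator_def)
    have "I (\<lambda>x. \<integral>y. indicator (A \<union> B) y * F y x \<partial>M) =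
        I (\<lambda>x. (\<integral>y. indicator A y * F y x \<partial>M) + (\<integral>y. indicator B y * F y x \<partial>M))"
      using AB JF[of "A \<union> B"] Fx
      by (intro cong Cc_add JF) (auto simp: ind Y.integrable_indicator_Cc[OF M])
    moreover have "(\<integral>y. indicator (A \<union> B) y * I (F y) \<partial>M) =
        (\<integral>y. indicator A y * I (F y) \<partial>M) + (\<integral>y. indicator B y * I (F y) \<partial>M)"
      using AB IF by (simp add: ind Y.integrable_indicator_Cc[OF M])
    ultimately show ?thesis
      unfolding \<Phi>_def using AB by (simp add: add JF)
  qed
  have \<Phi>_K: "\<bar>\<Phi> K\<bar> \<le> 2 * e * measure M K * I p" if e: "0 < e" for e
  proof -
    \<comment> \<open>Open sets on which every slice is uniformly within e of one fixed slice
      \<open>F v\<close>; finitely many of them cover K.\<close>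
    let ?good = "\<lambda>U. openin Y U \<and> (\<exists>v\<in>topspace Y. \<forall>u\<in>U. \<forall>x\<in>topspace X. \<bar>F u x - F v x\<bar> \<le> e)"
    \<comment> \<open>On such a piece both iterated expressions differ from
      \<open>measure M B * I (F v)\<close> by at most e times \<open>measure M B * I p\<close>,
      whence the factor 2.\<close>
    have small: "\<bar>\<Phi> B\<bar> \<le> 2 * e * measure M B * I p"
      if B: "B \<in> sets M" "B \<subseteq> K" "B \<subseteq> U" "?good U" for B U
    proof -
      obtain v where v: "v \<in> topspace Y" "\<And>u x. u \<in> U \<Longrightarrow> x \<in> topspace X \<Longrightarrow> \<bar>F u x - F v x\<bar> \<le> e"
        using B by blast
      have Bt: "B \<subseteq> topspace Y" using B(2) compactin_subset_topspace[OF K] by blast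
      have intB: "integrable M (\<lambda>y. indicator B y * r)" for r :: real
        using B finM by (intro integrable_mult_left integrable_real_indicator) auto
      have const: "(\<integral>y. indicator B y * r \<partial>M) = measure M B * r" for r :: real
        using B by simp
      have bound: "\<bar>(\<integral>y. indicator B y * f y \<partial>M) - measure M B * r\<bar> \<le> measure M B * q"
        if f: "f \<in> Cc Y" and fr: "\<And>y. y \<in> B \<Longrightarrow> \<bar>f y - r\<bar> \<le> q" for f r q
      proof -
        have "(\<integral>y. indicator B y * f y \<partial>M) - measure M B * r = (\<integral>y. indicator B y * f y - indicator B y * r \<partial>M)"
          using f B intB by (simp add: Y.integrable_indicator_Cc[OF M] const)
        also have "\<bar>\<dots>\<bar> \<le> (\<integral>y. \<bar>indicator B y * f y - indicator B y * r\<bar> \<partial>M)"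
          by (rule integral_abs_bound)
        also have "\<dots> \<le> (\<integral>y. indicator B y * q \<partial>M)"
          using fr f B intB
          by (intro integral_mono integrable_abs Bochner_Integration.integrable_diff
              Y.integrable_indicator_Cc[OF M f] intB) (auto split: split_indicator)
        also have "\<dots> = measure M B * q" by (rule const)
        finally show ?thesis .
      qed
      have pe: "\<bar>F y x - F v x\<bar> \<le> e * p x" if "y \<in> B" "x \<in> topspace X" for y x
      proof (cases "x \<in> L")
        case True
        then show ?thesis using v that B p by auto
      next
        case False
        then show ?thesis using v that Bt supp p e by (auto simp: subset_iff)
      qed
      have 1: "\<bar>(\<integral>y. indicator B y * I (F y) \<partial>M) - measure M B * I (F v)\<bar> \<le> measure M B * (e * I p)"
        using Bt pe by (intro bound IF close Fy v p) auto
      have "\<bar>I (\<lambda>x. \<integral>y. indicator B y * F y x \<partial>M) - I (\<lambda>x. measure M B * F v x)\<bar> \<le> (measure M B * e) * I p"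
      proof (rule close[OF JF[OF B(1)] Cc_cmult[OF Fy[OF v(1)]] p(1)])
        fix x assume x: "x \<in> topspace X"
        show "\<bar>(\<integral>y. indicator B y * F y x \<partial>M) - measure M B * F v x\<bar> \<le> measure M B * e * p x"
          using bound[OF Fx[OF x], of "F v x" "e * p x"] pe[OF _ x] by (simp add: mult.assoc)
      qed
      with 1 show ?thesis
        unfolding \<Phi>_def scale[OF Fy[OF v(1)]] by (simp add: algebra_simps abs_le_iff)
    qed
    \<comment> \<open>Splitting B into B \<inter> U and B - U, one U at a time, keeps the pieces
      disjoint, so the errors add up to the measure of B and do not grow with the size of the
      cover.\<close>
    have cover: "\<bar>\<Phi> B\<bar> \<le> 2 * e * measure M B * I p"
      if "finite \<U>" "\<And>U. U \<in> \<U> \<Longrightarrow> ?good U" "B \<in> sets M" "B \<subseteq> K" "B \<subseteq> \<Union>\<U>" for \<U> B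
      using that
    proof (induction \<U> arbitrary: B rule: finite_induct)
      case empty
      then show ?case using \<Phi>_Un[of "{}" "{}"] by simp
    next
      case (insert U \<U>)
      have U: "?good U" "U \<in> sets M" using insert.prems M by (auto simp: radon_sets)
      have a: "\<bar>\<Phi> (B \<inter> U)\<bar> \<le> 2 * e * measure M (B \<inter> U) * I p"
        using insert.prems U by (intro small[of _ U]) auto
      have b: "\<bar>\<Phi> (B - U)\<bar> \<le> 2 * e * measure M (B - U) * I p"
        using insert.prems U by (intro insert.IH) auto
      have "\<Phi> B = \<Phi> (B \<inter> U) + \<Phi> (B - U)"
        using insert.prems U \<Phi>_Un[of "B \<inter> U" "B - U"] by (simp add: Int_Diff_Un Int_Diff_disjoint)
      moreover have "measure M B = measure M (B \<inter> U) + measure M (B - U)"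
      proof -
        have "emeasure M (B \<inter> U) < \<infinity>" "emeasure M (B - U) < \<infinity>"
          by (meson Diff_subset finM inf_le1 insert.prems(3) subset_trans)+
        then have "measure M ((B \<inter> U) \<union> (B - U)) = measure M (B \<inter> U) + measure M (B - U)"
          using insert.prems U by (intro measure_Union) auto
        then show ?thesis by (simp add: Int_Diff_Un)
      qed
      ultimately show ?case using a b by (simp add: algebra_simps)
    qed
    have ex: "\<exists>V. ?good V \<and> y \<in> V" if "y \<in> K" for y
    proof -
      have y: "y \<in> topspace Y" using that compactin_subset_topspace[OF K] by blast
      obtain V where "openin Y V" "y \<in> V" "\<And>u x. u \<in> V \<Longrightarrow> x \<in> topspace X \<Longrightarrow> \<bar>F u x - F y x\<bar> \<le> e"
        using equicontinuous_of_locally_compact_support[OF F y openin_topspace y L _ e] supp by metis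
      then show ?thesis using y by blast
    qed
    have sub: "K \<subseteq> \<Union>(Collect ?good)"
    proof
      fix y assume "y \<in> K"
      then obtain V where "?good V" "y \<in> V" using ex by metis
      then show "y \<in> \<Union>(Collect ?good)" by (intro UnionI[of V] CollectI)
    qed
    have "\<exists>\<F>. finite \<F> \<and> \<F> \<subseteq> Collect ?good \<and> K \<subseteq> \<Union>\<F>"
      by (rule compactinD[OF K _ sub]) simp
    then obtain \<F> where F: "finite \<F>" "\<F> \<subseteq> Collect ?good" "K \<subseteq> \<Union>\<F>"
      by (elim exE conjE)
    show ?thesis by (rule cover[OF F(1) _ KM subset_refl F(3)]) (use F(2) in \<open>simp only: subset_iff mem_Collect_eq\<close>)
  qed
  have "\<Phi> K = 0"
  proof (rule ccontr)
    assume "\<Phi> K \<noteq> 0"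
    \<comment> \<open>With this d the bound is half of the defect, a contradiction; the summand 1
      prevents division by 0.\<close>
    define d where "d = \<bar>\<Phi> K\<bar> / (4 * (measure M K * I p + 1))"
    have q: "0 \<le> measure M K * I p" using Ip by simp
    have "0 < d" using \<open>\<Phi> K \<noteq> 0\<close> q by (simp add: d_def)
    then have "\<bar>\<Phi> K\<bar> \<le> 2 * d * (measure M K * I p)" using \<Phi>_K[of d] by (simp add: mult.assoc)
    also have "\<dots> \<le> 2 * d * (measure M K * I p + 1)" using \<open>0 < d\<close> by simp
    also have "\<dots> = \<bar>\<Phi> K\<bar> / 2" using q unfolding d_def by (simp add: field_simps)
    finally show False using \<open>\<Phi> K \<noteq> 0\<close> by simp
  qed
  moreover have "(\<integral>y. indicator K y * I (F y) \<partial>M) = (\<integral>y. I (F y) \<partial>M)"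
    using supp by (intro Bochner_Integration.integral_cong)
      (auto simp: indicator_def radon_space[OF M] intro!: zero Fy)
  moreover have JK: "(\<integral>y. indicator K y * F y x \<partial>M) = (\<integral>y. F y x \<partial>M)" if "x \<in> topspace X" for x
    using supp that by (intro Bochner_Integration.integral_cong) (auto simp: indicator_def radon_space[OF M])
  moreover have "I (\<lambda>x. \<integral>y. indicator K y * F y x \<partial>M) = I (\<lambda>x. \<integral>y. F y x \<partial>M)"
    by (rule cong[OF JF[OF KM] Cc_integral_kernel[OF Y M F K L supp] JK])
  ultimately show ?thesis by (simp add: \<Phi>_def)
qed

section \<open>Uniqueness of Haar measure\<close>

lemma continuous_map_measurable:
  assumes f: "continuous_map X Y f"
  shows "f \<in> measurable (borel_of X) (borel_of Y)"
  unfolding borel_of_def[of Y]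
proof (rule measurable_sigma_sets)
  show "sets (sigma (topspace Y) {U. openin Y U}) = sigma_sets (topspace Y) {U. openin Y U}"
    by (rule sets_measure_of) (auto dest: openin_subset)
  show "f \<in> space (borel_of X) \<rightarrow> topspace Y"
    using f by (auto simp: space_borel_of continuous_map_def)
  fix U assume "U \<in> {U. openin Y U}"
  then have "openin X {x \<in> topspace X. f x \<in> U}"
    using openin_continuous_map_preimage[OF f] by simp
  moreover have "f -` U \<inter> space (borel_of X) = {x \<in> topspace X. f x \<in> U}"
    by (auto simp: space_borel_of)
  ultimately show "f -` U \<inter> space (borel_of X) \<in> sets (borel_of X)"
    by (simp add: borel_of_openin)
qed (auto dest: openin_subset)

lemma emeasure_distr_radon:
  assumes M: "radon_measure X M" and f: "continuous_map X Y f" and E: "E \<in> sets (borel_of Y)"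
  shows "emeasure (distr M (borel_of Y) f) E = emeasure M {x \<in> topspace X. f x \<in> E}"
proof -
  have "f \<in> measurable M (borel_of Y)"
    using continuous_map_measurable[OF f] measurable_cong_sets[OF radon_sets[OF M] refl] by blast
  then have "emeasure (distr M (borel_of Y) f) E = emeasure M (f -` E \<inter> space M)"
    using E by (rule emeasure_distr)
  also have "f -` E \<inter> space M = {x \<in> topspace X. f x \<in> E}"
    by (auto simp: radon_space[OF M])
  finally show ?thesis .
qed

text \<open>The continuous inverse g makes images under f of open, compact and Borel sets again of
  the same kind, so both regularity conditions can be carried across.\<close>

lemma radon_measure_distr:
  assumes M: "radon_measure X M" and h: "homeomorphic_maps X Y f g"
  shows "radon_measure Y (distr M (borel_of Y) f)"
proof -
  have cf: "continuous_map X Y f" and cg: "continuous_map Y X g"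
    and gf: "\<And>x. x \<in> topspace X \<Longrightarrow> g (f x) = x" and fg: "\<And>y. y \<in> topspace Y \<Longrightarrow> f (g y) = y"
    using h by (auto simp: homeomorphic_maps_def)
  have fX: "f x \<in> topspace Y" if "x \<in> topspace X" for x using cf that by (auto simp: continuous_map_def)
  have gY: "g y \<in> topspace X" if "y \<in> topspace Y" for y using cg that by (auto simp: continuous_map_def)
  let ?P = "\<lambda>E. {x \<in> topspace X. f x \<in> E}"
  have P: "?P E = g ` E" if "E \<subseteq> topspace Y" for E
    using that gf fg fX gY by (force simp: image_iff)
  have em: "emeasure (distr M (borel_of Y) f) E = emeasure M (g ` E)" if "E \<in> sets (borel_of Y)" for E
    using emeasure_distr_radon[OF M cf that] P sets.sets_into_space[OF that] by (simp add: space_borel_of)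
  have open_iff: "openin X (g ` U)" if "openin Y U" for U
    using openin_continuous_map_preimage[OF cf that] P[OF openin_subset[OF that]] by simp
  have comp_g: "compactin X (g ` K)" if "compactin Y K" for K using image_compactin[OF that cg] .
  have comp_f: "compactin Y (f ` K)" if "compactin X K" for K using image_compactin[OF that cf] .
  have open_f: "openin Y (f ` V)" if V: "openin X V" for V
  proof -
    have "f ` V = {y \<in> topspace Y. g y \<in> V}"
      using openin_subset[OF V] gf fg fX by (force simp: image_iff)
    then show ?thesis using openin_continuous_map_preimage[OF cg V] by simp
  qed
  have gsub: "g ` E \<subseteq> U \<longleftrightarrow> E \<subseteq> f ` U" if "E \<subseteq> topspace Y" "U \<subseteq> topspace X" for E U
    using that gf fg by (force simp: image_iff subset_iff)
  have gfim: "g ` f ` U = U" if "U \<subseteq> topspace X" for U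
    using that gf by (force simp: image_iff)
  show ?thesis
    unfolding radon_measure_def
  proof (intro conjI ballI allI impI)
    show "sets (distr M (borel_of Y) f) = sets (borel_of Y)" by simp
  next
    fix K assume K: "compactin Y K"
    have "emeasure (distr M (borel_of Y) f) K \<le> emeasure M (g ` K)"
    \<comment> \<open>Y may be a coset space, whose Hausdorff property is not at hand, so a compact
      set could fail to be Borel; \<open>emeasure\<close> then has the default value 0.\<close>
    proof (cases "K \<in> sets (borel_of Y)")
      case True then show ?thesis by (simp add: em)
    next
      case False then show ?thesis by (simp add: emeasure_notin_sets)
    qed
    also have "\<dots> < \<infinity>" by (rule radon_finite[OF M comp_g[OF K]])
    finally show "emeasure (distr M (borel_of Y) f) K < \<infinity>" .
  next
    fix E assume "E \<in> sets (distr M (borel_of Y) f)"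
    then have E: "E \<in> sets (borel_of Y)" by simp
    have Et: "E \<subseteq> topspace Y" using sets.sets_into_space[OF E] by (simp add: space_borel_of)
    have gE: "g ` E \<in> sets M"
      using measurable_sets[OF continuous_map_measurable[OF cf] E] P[OF Et] radon_sets[OF M]
      by (simp add: space_borel_of vimage_def Int_def conj_commute)
    have "emeasure (distr M (borel_of Y) f) E = (INF U\<in>{U. openin X U \<and> g ` E \<subseteq> U}. emeasure M U)"
      by (simp add: em[OF E] radon_outer[OF M gE])
    also have "\<dots> = (INF U\<in>{U. openin Y U \<and> E \<subseteq> U}. emeasure (distr M (borel_of Y) f) U)"
    proof (rule antisym; rule INF_greatest; clarify)
      fix U assume U: "openin Y U" "E \<subseteq> U"
      then show "(INF U\<in>{U. openin X U \<and> g ` E \<subseteq> U}. emeasure M U) \<le> emeasure (distr M (borel_of Y) f) U"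
        unfolding em[OF borel_of_openin[OF U(1)]]
        by (intro INF_lower) (auto intro: open_iff)
    next
      fix U assume U: "openin X U" "g ` E \<subseteq> U"
      then have "E \<subseteq> f ` U" using gsub[OF Et openin_subset[OF U(1)]] by simp
      then have "(INF U\<in>{U. openin Y U \<and> E \<subseteq> U}. emeasure (distr M (borel_of Y) f) U)
          \<le> emeasure (distr M (borel_of Y) f) (f ` U)"
        using open_f[OF U(1)] by (intro INF_lower) auto
      also have "\<dots> = emeasure M U"
        using em[OF borel_of_openin[OF open_f[OF U(1)]]] gfim[OF openin_subset[OF U(1)]] by simp
      finally show "(INF U\<in>{U. openin Y U \<and> E \<subseteq> U}. emeasure (distr M (borel_of Y) f) U) \<le> emeasure M U" .
    qed
    finally show "emeasure (distr M (borel_of Y) f) E = \<dots>" .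
  next
    fix U assume U: "openin Y U"
    show "emeasure (distr M (borel_of Y) f) U
      = (SUP K\<in>{K. compactin Y K \<and> K \<subseteq> U}. emeasure (distr M (borel_of Y) f) K)" (is "?l = ?r")
    proof (rule antisym)
      show "?r \<le> ?l" using U by (auto intro!: SUP_least emeasure_mono simp: borel_of_openin)
      have "emeasure M K \<le> ?r" if K: "compactin X K" "K \<subseteq> g ` U" for K
      proof -
        have Kt: "K \<subseteq> topspace X" by (rule compactin_subset_topspace[OF K(1)])
        have fK: "f ` K \<subseteq> U" using K fg openin_subset[OF U] by (force simp: subset_iff image_iff)
        have "emeasure M K \<le> emeasure (distr M (borel_of Y) f) (f ` K)"
        proof (cases "K \<in> sets M")
          case True
          have "f ` K = {y \<in> topspace Y. g y \<in> K}"
            using Kt gf fg fX by (force simp: image_iff)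
          then have "f ` K \<in> sets (borel_of Y)"
            using measurable_sets[OF continuous_map_measurable[OF cg], of K] True radon_sets[OF M]
            by (simp add: space_borel_of vimage_def Int_def conj_commute)
          then show ?thesis using em gfim[OF Kt] by simp
        qed (simp add: emeasure_notin_sets)
        also have "\<dots> \<le> ?r" using fK comp_f[OF K(1)] by (intro SUP_upper) auto
        finally show ?thesis .
      qed
      then show "?l \<le> ?r"
        unfolding em[OF borel_of_openin[OF U]] radon_inner[OF M open_iff[OF U]]
        by (intro SUP_least) auto
    qed
  qed
qed

section \<open>Translations in a locally compact group and the Haar integral\<close>

context locally_compact_group
begin

sublocale lch_space T
  by unfold_locales (rule Hausdorff locally_compact)+

lemma continuous_map_group_mult:
  assumes "continuous_map Y T f" "continuous_map Y T g"
  shows "continuous_map Y T (\<lambda>y. f y \<otimes> g y)"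
  using continuous_map_compose[OF continuous_map_pairedI[OF assms] continuous_mult]
  by (simp add: o_def)

lemma continuous_map_group_inv:
  assumes "continuous_map Y T f"
  shows "continuous_map Y T (\<lambda>y. inv f y)"
  using continuous_map_compose[OF assms continuous_inv] by (simp add: o_def)

text \<open>Cosets become preimages under translation by the inverse, so openness and measurability
  follow from continuity.\<close>

lemma l_coset_eq: "U \<subseteq> carrier G \<Longrightarrow> g \<in> carrier G \<Longrightarrow> g <# U = {x \<in> carrier G. inv g \<otimes> x \<in> U}"
  unfolding l_coset_def by (auto simp: subset_iff m_assoc[symmetric])

lemma r_coset_eq: "U \<subseteq> carrier G \<Longrightarrow> g \<in> carrier G \<Longrightarrow> U #> g = {x \<in> carrier G. x \<otimes> inv g \<in> U}"
  unfolding r_coset_def by (auto simp: subset_iff m_assoc)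

lemma homeomorphic_maps_left:
  assumes g: "g \<in> carrier G"
  shows "homeomorphic_maps T T (\<lambda>x. g \<otimes> x) (\<lambda>x. inv g \<otimes> x)"
  using g by (auto simp: homeomorphic_maps_def topspace_eq m_assoc[symmetric] intro!: continuous_map_group_mult)

lemma homeomorphic_maps_right:
  assumes g: "g \<in> carrier G"
  shows "homeomorphic_maps T T (\<lambda>x. x \<otimes> g) (\<lambda>x. x \<otimes> inv g)"
  using g by (auto simp: homeomorphic_maps_def topspace_eq m_assoc intro!: continuous_map_group_mult)

lemma borel_subset_carrier: "E \<in> sets (borel_of T) \<Longrightarrow> E \<subseteq> carrier G"
  using sets.sets_into_space[of E "borel_of T"] by (simp add: space_borel_of topspace_eq)

lemma borel_l_coset:
  assumes E: "E \<in> sets (borel_of T)" and g: "g \<in> carrier G"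
  shows "g <# E \<in> sets (borel_of T)"
proof -
  have "continuous_map T T (\<lambda>x. inv g \<otimes> x)"
    using homeomorphic_maps_left[OF g] by (simp add: homeomorphic_maps_def)
  from measurable_sets[OF continuous_map_measurable[OF this] E] show ?thesis
    using l_coset_eq[OF borel_subset_carrier[OF E] g]
    by (simp add: space_borel_of topspace_eq vimage_def Int_def conj_commute)
qed

lemma borel_r_coset:
  assumes E: "E \<in> sets (borel_of T)" and g: "g \<in> carrier G"
  shows "E #> g \<in> sets (borel_of T)"
proof -
  have "continuous_map T T (\<lambda>x. x \<otimes> inv g)"
    using homeomorphic_maps_right[OF g] by (simp add: homeomorphic_maps_def)
  from measurable_sets[OF continuous_map_measurable[OF this] E] show ?thesis
    using r_coset_eq[OF borel_subset_carrier[OF E] g]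
    by (simp add: space_borel_of topspace_eq vimage_def Int_def conj_commute)
qed

lemma openin_l_coset:
  assumes "openin T U" "g \<in> carrier G" shows "openin T (g <# U)"
proof -
  have "continuous_map T T (\<lambda>x. inv g \<otimes> x)"
    using homeomorphic_maps_left[OF assms(2)] by (simp add: homeomorphic_maps_def)
  then show ?thesis
    using openin_continuous_map_preimage[of T T "\<lambda>x. inv g \<otimes> x", OF _ assms(1)] l_coset_eq[of U g] openin_subset[OF assms(1)] assms(2)
    by (simp add: topspace_eq)
qed

lemma compactin_set_mult:
  assumes K: "compactin T K" and L: "compactin T L"
  shows "compactin T (K <#> L)"
proof -
  have "compactin (prod_topology T T) (K \<times> L)" using K L by (simp add: compactin_Times)
  from image_compactin[OF this continuous_mult] show ?thesis
    by (simp add: set_mult_def image_def) (erule back_subst[of "compactin T"], auto)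
qed

lemma compactin_set_inv: "compactin T K \<Longrightarrow> compactin T ((\<lambda>x. inv x) ` K)"
  by (rule image_compactin[OF _ continuous_inv])

lemma compactin_l_coset:
  assumes "compactin T K" "g \<in> carrier G" shows "compactin T (g <# K)"
  using compactin_set_mult[of "{g}" K] assms by (simp add: topspace_eq l_coset_eq_set_mult)

lemma compactin_r_coset:
  assumes "compactin T K" "g \<in> carrier G" shows "compactin T (K #> g)"
  using compactin_set_mult[of K "{g}"] assms by (simp add: topspace_eq r_coset_eq_set_mult)

lemma set_mult_memI: "x \<in> K \<Longrightarrow> y \<in> L \<Longrightarrow> x \<otimes> y \<in> K <#> L"
  by (auto simp: set_mult_def)

lemma Cc_left:
  assumes f: "f \<in> Cc T" and g: "g \<in> carrier G"
  shows "(\<lambda>x. f (g \<otimes> x)) \<in> Cc T"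
proof -
  obtain K where K: "compactin T K" "\<And>x. x \<in> topspace T \<Longrightarrow> x \<notin> K \<Longrightarrow> f x = 0"
    using Cc_support[OF f] by blast
  have Kc: "K \<subseteq> carrier G" using compactin_subset_topspace[OF K(1)] by (simp add: topspace_eq)
  show ?thesis
  proof (rule Cc_I)
    show "compactin T (inv g <# K)" using K g by (intro compactin_l_coset) auto
    show "continuous_map T euclideanreal (\<lambda>x. f (g \<otimes> x))"
      using continuous_map_compose[of T T "\<lambda>x. g \<otimes> x" euclideanreal f] homeomorphic_maps_left[OF g] Cc_continuous[OF f]
      by (simp add: o_def homeomorphic_maps_def)
    show "f (g \<otimes> x) = 0" if "x \<in> topspace T" "x \<notin> inv g <# K" for x
      using that g Kc K(2)[of "g \<otimes> x"] by (auto simp: l_coset_eq topspace_eq)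
  qed
qed

lemma Cc_right:
  assumes f: "f \<in> Cc T" and g: "g \<in> carrier G"
  shows "(\<lambda>x. f (x \<otimes> g)) \<in> Cc T"
proof -
  obtain K where K: "compactin T K" "\<And>x. x \<in> topspace T \<Longrightarrow> x \<notin> K \<Longrightarrow> f x = 0"
    using Cc_support[OF f] by blast
  have Kc: "K \<subseteq> carrier G" using compactin_subset_topspace[OF K(1)] by (simp add: topspace_eq)
  show ?thesis
  proof (rule Cc_I)
    show "compactin T (K #> inv g)" using K g by (intro compactin_r_coset) auto
    show "continuous_map T euclideanreal (\<lambda>x. f (x \<otimes> g))"
      using continuous_map_compose[of T T "\<lambda>x. x \<otimes> g" euclideanreal f] homeomorphic_maps_right[OF g] Cc_continuous[OF f]
      by (simp add: o_def homeomorphic_maps_def)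
    show "f (x \<otimes> g) = 0" if "x \<in> topspace T" "x \<notin> K #> inv g" for x
      using that g Kc K(2)[of "x \<otimes> g"] by (auto simp: r_coset_eq topspace_eq)
  qed
qed

lemma Cc_inv:
  assumes f: "f \<in> Cc T"
  shows "(\<lambda>x. f (inv x)) \<in> Cc T"
proof -
  obtain K where K: "compactin T K" "\<And>x. x \<in> topspace T \<Longrightarrow> x \<notin> K \<Longrightarrow> f x = 0"
    using Cc_support[OF f] by blast
  show ?thesis
  proof (rule Cc_I)
    show "compactin T ((\<lambda>x. inv x) ` K)" using K by (intro compactin_set_inv)
    show "continuous_map T euclideanreal (\<lambda>x. f (inv x))"
      using continuous_map_compose[OF continuous_inv Cc_continuous[OF f]] by (simp add: o_def)
    show "f (inv x) = 0" if "x \<in> topspace T" "x \<notin> (\<lambda>x. inv x) ` K" for x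
    proof -
      have "inv x \<notin> K" using that by (metis image_eqI inv_inv topspace_eq)
      then show ?thesis using K(2)[of "inv x"] that by (simp add: topspace_eq)
    qed
  qed
qed

lemma left_haar_radon: "left_haar_measure G T M \<Longrightarrow> radon_measure T M"
  by (simp add: left_haar_measure_def)

text \<open>Invariance on sets is turned into invariance under push-forward, the form in which
  change of variables applies to integrals.\<close>

lemma haar_distr_left:
  assumes M: "left_haar_measure G T M" and g: "g \<in> carrier G"
  shows "distr M (borel_of T) (\<lambda>x. g \<otimes> x) = M"
proof (rule measure_eqI)
  have R: "radon_measure T M" by (rule left_haar_radon[OF M])
  show "sets (distr M (borel_of T) (\<lambda>x. g \<otimes> x)) = sets M" by (simp add: radon_sets[OF R])
  fix E assume "E \<in> sets (distr M (borel_of T) (\<lambda>x. g \<otimes> x))"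
  then have E: "E \<in> sets (borel_of T)" by simp
  have Et: "E \<subseteq> carrier G" by (rule borel_subset_carrier[OF E])
  have "emeasure (distr M (borel_of T) (\<lambda>x. g \<otimes> x)) E = emeasure M {x \<in> topspace T. g \<otimes> x \<in> E}"
    using homeomorphic_maps_left[OF g] by (intro emeasure_distr_radon[OF R _ E]) (simp add: homeomorphic_maps_def)
  also have "{x \<in> topspace T. g \<otimes> x \<in> E} = inv g <# E"
    using l_coset_eq[OF Et, of "inv g"] g by (simp add: topspace_eq)
  also have "emeasure M (inv g <# E) = emeasure M E"
    using M E g radon_sets[OF R] by (simp add: left_haar_measure_def)
  finally show "emeasure (distr M (borel_of T) (\<lambda>x. g \<otimes> x)) E = emeasure M E" .
qed

lemma haar_integral_left:
  fixes f :: "'a \<Rightarrow> real"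
  assumes M: "left_haar_measure G T M" and g: "g \<in> carrier G" and f: "f \<in> Cc T"
  shows "(\<integral>x. f (g \<otimes> x) \<partial>M) = (\<integral>x. f x \<partial>M)"
proof -
  have R: "radon_measure T M" by (rule left_haar_radon[OF M])
  have "(\<lambda>x. g \<otimes> x) \<in> measurable (borel_of T) (borel_of T)"
    using homeomorphic_maps_left[OF g] by (intro continuous_map_measurable) (simp add: homeomorphic_maps_def)
  then have m: "(\<lambda>x. g \<otimes> x) \<in> measurable M (borel_of T)"
    using measurable_cong_sets[OF radon_sets[OF R] refl] by blast
  have "(\<integral>x. f x \<partial>M) = (\<integral>x. f x \<partial>distr M (borel_of T) (\<lambda>x. g \<otimes> x))"
    by (simp add: haar_distr_left[OF M g])
  also have "\<dots> = (\<integral>x. f (g \<otimes> x) \<partial>M)"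
    by (rule integral_distr[OF m continuous_map_borel_measurable[OF Cc_continuous[OF f] refl]])
  finally show ?thesis by simp
qed

text \<open>The translates of a null open set would be null open sets covering the whole
  group.\<close>

lemma haar_open_pos:
  assumes M: "left_haar_measure G T M" and U: "openin T U" "U \<noteq> {}"
  shows "0 < emeasure M U"
proof (rule ccontr)
  assume "\<not> 0 < emeasure M U"
  then have 0: "emeasure M U = 0" by simp
  have R: "radon_measure T M" by (rule left_haar_radon[OF M])
  obtain u where u: "u \<in> U" "u \<in> carrier G" using U openin_subset[OF U(1)] topspace_eq by blast
  have "emeasure M (space M) = 0"
  proof (rule radon_null_cover[OF R])
    show "topspace T \<subseteq> \<Union>((\<lambda>g. g <# U) ` carrier G)"
    proof
      fix x assume "x \<in> topspace T"
      then have x: "x \<in> carrier G" by (simp add: topspace_eq)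
      have "(x \<otimes> inv u) \<otimes> u \<in> (x \<otimes> inv u) <# U" using u by (auto simp: l_coset_def)
      then show "x \<in> \<Union>((\<lambda>g. g <# U) ` carrier G)" using x u by (auto simp: m_assoc)
    qed
    show "openin T V \<and> emeasure M V = 0" if "V \<in> (\<lambda>g. g <# U) ` carrier G" for V
      using that U M 0 R by (auto simp: openin_l_coset left_haar_measure_def radon_sets borel_of_openin)
  qed
  then show False using M by (simp add: left_haar_measure_def)
qed

text \<open>The set where f is nonzero is open and nonempty, hence of positive measure.\<close>

lemma haar_integral_pos:
  assumes M: "left_haar_measure G T M" and f: "f \<in> Cc T" and nn: "\<And>x. x \<in> carrier G \<Longrightarrow> 0 \<le> f x"
    and x: "x \<in> carrier G" "f x \<noteq> 0"
  shows "0 < (\<integral>x. f x \<partial>M)"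
proof -
  have R: "radon_measure T M" by (rule left_haar_radon[OF M])
  have "openin T {x \<in> topspace T. f x \<in> - {0}}"
    by (rule openin_continuous_map_preimage[OF Cc_continuous[OF f]]) auto
  then have "0 < emeasure M {x \<in> topspace T. f x \<in> - {0}}"
    using x by (intro haar_open_pos[OF M]) (auto simp: topspace_eq)
  also have "{x \<in> topspace T. f x \<in> - {0}} = {x \<in> space M. f x \<noteq> 0}"
    by (simp add: radon_space[OF R])
  finally have pos: "0 < emeasure M {x \<in> space M. f x \<noteq> 0}" .
  have "(\<integral>x. f x \<partial>M) \<noteq> 0"
  proof
    assume "(\<integral>x. f x \<partial>M) = 0"
    then have "AE x in M. f x = 0"
      using integral_nonneg_eq_0_iff_AE[OF integrable_Cc[OF R f] AE_I2] nn
      by (simp add: radon_space[OF R] topspace_eq)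
    moreover have "{x \<in> space M. f x \<noteq> 0} \<in> sets M"
      using integrable_Cc[OF R f] by measurable
    ultimately have "emeasure M {x \<in> space M. f x \<noteq> 0} = 0"
      by (simp add: AE_iff_measurable[OF _ refl])
    then show False using pos by simp
  qed
  moreover have "0 \<le> (\<integral>x. f x \<partial>M)"
    using nn by (intro integral_nonneg_AE AE_I2) (auto simp: radon_space[OF R] topspace_eq)
  ultimately show ?thesis by simp
qed

lemma exists_bump:
  obtains f where "f \<in> Cc T" "\<And>x. x \<in> carrier G \<Longrightarrow> 0 \<le> f x" "f \<one> = 1"
  using Urysohn_Cc_one[of "{\<one>}"] by (auto simp: topspace_eq)

end

section \<open>Invariant functionals are multiples of the Haar integral\<close>

locale invariant_functional = locally_compact_group G T + positive_functional T I
  for G (structure) and T :: "'a topology" and I +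
  assumes invariant: "f \<in> Cc T \<Longrightarrow> g \<in> carrier G \<Longrightarrow> I (\<lambda>x. f (g \<otimes> x)) = I f"
begin

text \<open>
  Substituting \<open>t \<mapsto> s\<inverse> t\<close> in the functional and then \<open>s \<mapsto> t s\<close> in the integral moves the group variable
  from \<open>g\<close> to \<open>f\<close>. Since the left side treats \<open>f\<close> only through its integral, the right translates of
  \<open>f\<close> on the right side are determined by that integral as well.
\<close>

lemma haar_times_functional:
  assumes M: "left_haar_measure G T M" and f: "f \<in> Cc T" and g: "g \<in> Cc T"
  shows "(\<integral>x. f x \<partial>M) * I g = (\<integral>s. g (inv s) * I (\<lambda>t. f (t \<otimes> s)) \<partial>M)"
proof -
  have R: "radon_measure T M" by (rule left_haar_radon[OF M])
  obtain K where K: "compactin T K" "\<And>x. x \<in> topspace T \<Longrightarrow> x \<notin> K \<Longrightarrow> f x = 0"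
    using Cc_support[OF f] by blast
  obtain L where L: "compactin T L" "\<And>x. x \<in> topspace T \<Longrightarrow> x \<notin> L \<Longrightarrow> g x = 0"
    using Cc_support[OF g] by blast
  have KL: "compactin T (K <#> L)" by (rule compactin_set_mult[OF K(1) L(1)])
  have iL: "compactin T ((\<lambda>x. inv x) ` L)" by (rule compactin_set_inv[OF L(1)])
  have cf: "continuous_map Z euclideanreal (\<lambda>z. f (h z))" if "continuous_map Z T h" for Z :: "('a \<times> 'a) topology" and h
    using continuous_map_compose[OF that Cc_continuous[OF f]] by (simp add: o_def)
  have cg: "continuous_map Z euclideanreal (\<lambda>z. g (h z))" if "continuous_map Z T h" for Z :: "('a \<times> 'a) topology" and h
    using continuous_map_compose[OF that Cc_continuous[OF g]] by (simp add: o_def)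
  have c1: "continuous_map (prod_topology T T) euclideanreal (\<lambda>(s, t). f s * g (inv s \<otimes> t))"
    unfolding case_prod_beta'
    by (intro continuous_map_real_mult cf cg continuous_map_group_mult continuous_map_group_inv
        continuous_map_fst continuous_map_snd)
  have c2: "continuous_map (prod_topology T T) euclideanreal (\<lambda>(s, t). f (t \<otimes> s) * g (inv s))"
    unfolding case_prod_beta'
    by (intro continuous_map_real_mult cf cg continuous_map_group_mult continuous_map_group_inv
        continuous_map_fst continuous_map_snd)
  \<comment> \<open>If s is in K and s^-1 t is in L, then t = s (s^-1 t) is in K L; this bounds the
    support in t uniformly in s.\<close>
  have s1: "f s * g (inv s \<otimes> t) = 0"
    if "s \<in> topspace T" "t \<in> topspace T" "s \<notin> K \<or> t \<notin> K <#> L" for s t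
  proof (cases "s \<in> K \<and> inv s \<otimes> t \<in> L")
    case True
    then have "s \<otimes> (inv s \<otimes> t) \<in> K <#> L" by (intro set_mult_memI) auto
    then show ?thesis using that True by (simp add: topspace_eq m_assoc[symmetric])
  next
    case False
    then show ?thesis using K(2)[of s] L(2)[of "inv s \<otimes> t"] that by (auto simp: topspace_eq)
  qed
  have s2: "f (t \<otimes> s) * g (inv s) = 0"
    if "s \<in> topspace T" "t \<in> topspace T" "s \<notin> (\<lambda>x. inv x) ` L \<or> t \<notin> K <#> L" for s t
  proof (cases "t \<otimes> s \<in> K \<and> inv s \<in> L")
    case True
    then have "(t \<otimes> s) \<otimes> inv s \<in> K <#> L" by (intro set_mult_memI) auto
    moreover have "s \<in> (\<lambda>x. inv x) ` L" using True that by (metis image_eqI inv_inv topspace_eq)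
    ultimately show ?thesis using that True by (simp add: topspace_eq m_assoc)
  next
    case False
    then show ?thesis using K(2)[of "t \<otimes> s"] L(2)[of "inv s"] that by (auto simp: topspace_eq)
  qed
  have "(\<integral>x. f x \<partial>M) * I g = (\<integral>s. f s * I g \<partial>M)" by simp
  also have "\<dots> = (\<integral>s. I (\<lambda>t. f s * g (inv s \<otimes> t)) \<partial>M)"
    by (intro Bochner_Integration.integral_cong)
      (auto simp: radon_space[OF R] topspace_eq scale Cc_left[OF g] invariant[OF g])
  also have "\<dots> = I (\<lambda>t. \<integral>s. f s * g (inv s \<otimes> t) \<partial>M)"
    by (rule Fubini_functional[OF lch_space_axioms R c1 K(1) KL s1])
  also have "\<dots> = I (\<lambda>t. \<integral>s. f (t \<otimes> s) * g (inv s) \<partial>M)"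
  proof (rule cong)
    show "(\<lambda>t. \<integral>s. f s * g (inv s \<otimes> t) \<partial>M) \<in> Cc T"
      by (rule Cc_integral_kernel[OF lch_space_axioms R c1 K(1) KL s1])
    show "(\<lambda>t. \<integral>s. f (t \<otimes> s) * g (inv s) \<partial>M) \<in> Cc T"
      by (rule Cc_integral_kernel[OF lch_space_axioms R c2 iL KL s2])
    fix t assume "t \<in> topspace T"
    then have t: "t \<in> carrier G" by (simp add: topspace_eq)
    have h: "(\<lambda>s. f s * g (inv s \<otimes> t)) \<in> Cc T"
      using continuous_map_slice[OF continuous_map_swap_args[OF c1], of t] K(1) s1 t
      by (intro Cc_I[of _ _ K]) (auto simp: topspace_eq)
    have "(\<integral>s. f s * g (inv s \<otimes> t) \<partial>M) = (\<integral>s. f (t \<otimes> s) * g (inv (t \<otimes> s) \<otimes> t) \<partial>M)"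
      by (rule haar_integral_left[OF M t h, symmetric])
    also have "\<dots> = (\<integral>s. f (t \<otimes> s) * g (inv s) \<partial>M)"
      using t by (intro Bochner_Integration.integral_cong)
        (auto simp: radon_space[OF R] topspace_eq inv_mult_group m_assoc)
    finally show "(\<integral>s. f s * g (inv s \<otimes> t) \<partial>M) = (\<integral>s. f (t \<otimes> s) * g (inv s) \<partial>M)" .
  qed
  also have "\<dots> = (\<integral>s. I (\<lambda>t. f (t \<otimes> s) * g (inv s)) \<partial>M)"
    by (rule Fubini_functional[OF lch_space_axioms R c2 iL KL s2, symmetric])
  also have "\<dots> = (\<integral>s. g (inv s) * I (\<lambda>t. f (t \<otimes> s)) \<partial>M)"
    by (intro Bochner_Integration.integral_cong)
      (auto simp: radon_space[OF R] topspace_eq scale Cc_right[OF f] mult.commute[of "f _"])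
  finally show ?thesis .
qed

text \<open>For u in a compact set C, the translate t |-> f(t u) is supported in K C^-1, so supports
  are locally contained in one compact set.\<close>

lemma continuous_map_right_translates:
  assumes f: "f \<in> Cc T"
  shows "continuous_map T euclideanreal (\<lambda>s. I (\<lambda>t. f (t \<otimes> s)))"
proof (rule continuous_map_functional)
  show "continuous_map (prod_topology T T) euclideanreal (\<lambda>(s, t). f (t \<otimes> s))"
    using continuous_map_compose[OF continuous_map_group_mult[OF continuous_map_snd[of T T] continuous_map_fst[of T T]] Cc_continuous[OF f]]
    by (simp add: o_def case_prod_beta')
  obtain K where K: "compactin T K" "\<And>x. x \<in> topspace T \<Longrightarrow> x \<notin> K \<Longrightarrow> f x = 0"
    using Cc_support[OF f] by blast
  fix s assume s: "s \<in> topspace T"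
  obtain U C where UC: "openin T U" "compactin T C" "s \<in> U" "U \<subseteq> C"
    using locally_compact s unfolding locally_compact_space_def by metis
  have "f (t \<otimes> u) = 0" if u: "u \<in> U" and t: "t \<in> topspace T" "t \<notin> K <#> (\<lambda>x. inv x) ` C" for u t
  proof (rule K(2))
    have uc: "u \<in> carrier G" using u openin_subset[OF UC(1)] by (auto simp: topspace_eq)
    then show "t \<otimes> u \<in> topspace T" using t by (simp add: topspace_eq)
    show "t \<otimes> u \<notin> K"
    proof
      assume "t \<otimes> u \<in> K"
      then have "(t \<otimes> u) \<otimes> inv u \<in> K <#> (\<lambda>x. inv x) ` C" using u UC(4) by (intro set_mult_memI) auto
      then show False using t uc by (simp add: topspace_eq m_assoc)
    qed
  qed
  then show "\<exists>U L. openin T U \<and> s \<in> U \<and> compactin T L \<and> (\<forall>u\<in>U. \<forall>t\<in>topspace T - L. f (t \<otimes> u) = 0)"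
    using UC compactin_set_mult[OF K(1) compactin_set_inv[OF UC(2)]] by blast
qed

text \<open>By \<open>haar_times_functional\<close>, integrating q(s) I(t |-> h(t s)) over s gives a
  number that depends on h only through its Haar integral. Hence the continuous function D below
  integrates to 0 against every q in \<open>Cc T\<close>, and its value at the identity is the
  difference of the two sides.\<close>

lemma functional_cross_ratio:
  assumes M: "left_haar_measure G T M" and f: "f \<in> Cc T" and g: "g \<in> Cc T"
  shows "(\<integral>x. g x \<partial>M) * I f = (\<integral>x. f x \<partial>M) * I g"
proof -
  have R: "radon_measure T M" by (rule left_haar_radon[OF M])
  define D where "D s = (\<integral>x. g x \<partial>M) * I (\<lambda>t. f (t \<otimes> s)) - (\<integral>x. f x \<partial>M) * I (\<lambda>t. g (t \<otimes> s))" for s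
  have D: "continuous_map T euclideanreal D"
    unfolding D_def
    by (intro continuous_map_diff continuous_map_real_mult continuous_map_right_translates f g) auto
  obtain p where p: "p \<in> Cc T" "\<And>x. x \<in> carrier G \<Longrightarrow> 0 \<le> p x" "p \<one> = 1" using exists_bump by metis
  \<comment> \<open>With q = D p the integrand q D is the square of D times the bump p: nonnegative
    and continuous, so it must vanish, in particular at the identity, where p = 1.\<close>
  define q where "q = (\<lambda>s. D s * p s)"
  have q: "q \<in> Cc T" unfolding q_def by (rule Cc_mult[OF p(1) D])
  \<comment> \<open>\<open>haar_times_functional\<close> evaluates its second function at inverses,
    so q enters through its inversion.\<close>
  define q' where "q' = (\<lambda>s. q (inv s))"
  have q': "q' \<in> Cc T" unfolding q'_def by (rule Cc_inv[OF q])
  have prod: "(\<lambda>s. q s * I (\<lambda>t. h (t \<otimes> s))) \<in> Cc T" if "h \<in> Cc T" for h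
    using Cc_mult[OF q continuous_map_right_translates[OF that]] by (simp add: mult.commute)
  have key: "(\<integral>s. q s * I (\<lambda>t. h (t \<otimes> s)) \<partial>M) = (\<integral>x. h x \<partial>M) * I q'" if h: "h \<in> Cc T" for h
    unfolding haar_times_functional[OF M h q']
    by (intro Bochner_Integration.integral_cong) (auto simp: radon_space[OF R] topspace_eq q'_def)
  have sq: "(\<lambda>s. q s * D s) \<in> Cc T" using Cc_mult[OF q D] by (simp add: mult.commute)
  have "(\<integral>s. q s * D s \<partial>M) =
      (\<integral>s. (\<integral>x. g x \<partial>M) * (q s * I (\<lambda>t. f (t \<otimes> s))) - (\<integral>x. f x \<partial>M) * (q s * I (\<lambda>t. g (t \<otimes> s))) \<partial>M)"
    by (simp add: D_def algebra_simps)
  also have "\<dots> = 0"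
    using integrable_Cc[OF R prod[OF f]] integrable_Cc[OF R prod[OF g]] by (simp add: key f g)
  finally have "(\<integral>s. q s * D s \<partial>M) = 0" .
  moreover have "0 \<le> q s * D s" if "s \<in> carrier G" for s
    using mult_nonneg_nonneg[OF p(2)[OF that] zero_le_square[of "D s"]] by (simp add: q_def ac_simps)
  ultimately have "q \<one> * D \<one> = 0"
    using haar_integral_pos[OF M sq, of \<one>] by force
  then have "D \<one> = 0" by (simp add: q_def p)
  moreover have "I (\<lambda>t. h (t \<otimes> \<one>)) = I h" if "h \<in> Cc T" for h
    using that by (intro cong Cc_right) (auto simp: topspace_eq)
  ultimately show ?thesis using f g by (simp add: D_def)
qed

text \<open>The constant is the ratio of both functionals at a bump. It may be 0, because the zero
  functional qualifies; strict positivity is recovered where I is known to be nonzero.\<close>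

theorem haar_unique:
  assumes M: "left_haar_measure G T M"
  obtains c where "0 \<le> c" "\<And>f. f \<in> Cc T \<Longrightarrow> I f = c * (\<integral>x. f x \<partial>M)"
proof -
  obtain p where p: "p \<in> Cc T" "\<And>x. x \<in> carrier G \<Longrightarrow> 0 \<le> p x" "p \<one> = 1" using exists_bump by metis
  have pos: "0 < (\<integral>x. p x \<partial>M)" using haar_integral_pos[OF M p(1,2), of \<one>] p by simp
  have Ip: "0 \<le> I p" using p by (intro nonneg) (auto simp: topspace_eq)
  show thesis
  proof (rule that[of "I p / (\<integral>x. p x \<partial>M)"])
    show "0 \<le> I p / (\<integral>x. p x \<partial>M)" using pos Ip by simp
    show "I f = I p / (\<integral>x. p x \<partial>M) * (\<integral>x. f x \<partial>M)" if "f \<in> Cc T" for f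
      using pos functional_cross_ratio[OF M that p(1)] by (simp add: field_simps)
  qed
qed

end

section \<open>Proportionality of Haar measures and right translates\<close>

context locally_compact_group
begin

lemma invariant_functional_haar:
  assumes M: "left_haar_measure G T M"
  shows "invariant_functional G T (\<lambda>f. \<integral>x. f x \<partial>M)"
proof -
  interpret positive_functional T "\<lambda>f. \<integral>x. f x \<partial>M"
    by (rule positive_functional_integral_UNIV[OF left_haar_radon[OF M]])
  show ?thesis by unfold_locales (rule haar_integral_left[OF M])
qed

lemma haar_integral_proportional:
  assumes M: "left_haar_measure G T M" and N: "left_haar_measure G T N"
  obtains c where "0 < c" "\<And>f. f \<in> Cc T \<Longrightarrow> (\<integral>x. f x \<partial>N) = c * (\<integral>x. f x \<partial>M)"
proof -
  interpret N: invariant_functional G T "\<lambda>f. \<integral>x. f x \<partial>N"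
    by (rule invariant_functional_haar[OF N])
  obtain c where c: "0 \<le> c" "\<And>f. f \<in> Cc T \<Longrightarrow> (\<integral>x. f x \<partial>N) = c * (\<integral>x. f x \<partial>M)"
    using N.haar_unique[OF M] by metis
  obtain p where p: "p \<in> Cc T" "\<And>x. x \<in> carrier G \<Longrightarrow> 0 \<le> p x" "p \<one> = 1" using exists_bump by metis
  have "0 < (\<integral>x. p x \<partial>N)" using haar_integral_pos[OF N p(1,2), of \<one>] p by simp
  then have "c \<noteq> 0" using c(2)[OF p(1)] by auto
  then have "0 < c" using c by simp
  then show thesis using that c(2) by blast
qed

lemma haar_proportional:
  assumes M: "left_haar_measure G T M" and N: "left_haar_measure G T N"
  obtains c where "0 < c" "\<And>E. E \<in> sets (borel_of T) \<Longrightarrow> emeasure N E = ennreal c * emeasure M E"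
proof -
  obtain c where "0 < c" "\<And>f. f \<in> Cc T \<Longrightarrow> (\<integral>x. f x \<partial>N) = c * (\<integral>x. f x \<partial>M)"
    using haar_integral_proportional[OF M N] by metis
  then show thesis
    using that radon_proportional[OF left_haar_radon[OF M] left_haar_radon[OF N]] by blast
qed

text \<open>In \<open>ennreal\<close>, factors of proportionality can be cancelled only against a
  set of positive finite measure.\<close>

lemma haar_finite_pos_set:
  assumes M: "left_haar_measure G T M"
  obtains E where "E \<in> sets (borel_of T)" "0 < emeasure M E" "emeasure M E < \<infinity>"
proof -
  obtain U C where UC: "openin T U" "compactin T C" "\<one> \<in> U" "U \<subseteq> C"
    using locally_compact one_closed unfolding locally_compact_space_def topspace_eq by metis
  have R: "radon_measure T M" by (rule left_haar_radon[OF M])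
  have "emeasure M U \<le> emeasure M C"
    using UC borel_of_compactin[OF Hausdorff UC(2)] by (intro emeasure_mono) (auto simp: radon_sets[OF R])
  also have "\<dots> < \<infinity>" by (rule radon_finite[OF R UC(2)])
  finally show thesis using that[of U] UC haar_open_pos[OF M UC(1)] by auto
qed

text \<open>Left and right translations commute, so E |-> M(E s) is again left invariant. The map
  uses \<open>inv s\<close> because a push-forward measures preimages.\<close>

lemma left_haar_measure_right_translate:
  assumes M: "left_haar_measure G T M" and s: "s \<in> carrier G"
  shows "left_haar_measure G T (distr M (borel_of T) (\<lambda>x. x \<otimes> inv s))"
    and "E \<in> sets (borel_of T) \<Longrightarrow> emeasure (distr M (borel_of T) (\<lambda>x. x \<otimes> inv s)) E = emeasure M (E #> s)"
proof -
  let ?N = "distr M (borel_of T) (\<lambda>x. x \<otimes> inv s)"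
  have R: "radon_measure T M" by (rule left_haar_radon[OF M])
  have cont: "continuous_map T T (\<lambda>x. x \<otimes> inv s)"
    using homeomorphic_maps_right[of "inv s"] s by (simp add: homeomorphic_maps_def)
  have em: "emeasure ?N E = emeasure M (E #> s)" if E: "E \<in> sets (borel_of T)" for E
    using emeasure_distr_radon[OF R cont E] r_coset_eq[OF borel_subset_carrier[OF E] s] by (simp add: topspace_eq)
  then show "E \<in> sets (borel_of T) \<Longrightarrow> emeasure ?N E = emeasure M (E #> s)" .
  show "left_haar_measure G T ?N"
    unfolding left_haar_measure_def
  proof (intro conjI ballI)
    show "radon_measure T ?N"
      by (rule radon_measure_distr[OF R homeomorphic_maps_right[of "inv s"]]) (use s in simp)
    have "carrier G #> s = carrier G"
      using r_coset_eq[OF subset_refl s] s by auto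
    then have "emeasure ?N (space ?N) = emeasure M (space M)"
      using em[OF sets.top[of "borel_of T"]] by (simp add: space_borel_of topspace_eq radon_space[OF R])
    then show "emeasure ?N (space ?N) \<noteq> 0" using M by (simp add: left_haar_measure_def)
    fix g E assume g: "g \<in> carrier G" and "E \<in> sets ?N"
    then have E: "E \<in> sets (borel_of T)" by simp
    have "emeasure ?N (g <# E) = emeasure M ((g <# E) #> s)" by (rule em[OF borel_l_coset[OF E g]])
    also have "(g <# E) #> s = g <# (E #> s)"
      using borel_subset_carrier[OF E] g s by (force simp: l_coset_def r_coset_def m_assoc)
    also have "emeasure M \<dots> = emeasure M (E #> s)"
      using M g borel_r_coset[OF E s] by (simp add: left_haar_measure_def radon_sets[OF R])
    also have "\<dots> = emeasure ?N E" by (rule em[OF E, symmetric])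
    finally show "emeasure ?N (g <# E) = emeasure ?N E" .
  qed
qed

end

section \<open>Existence of Haar measure and the modular function\<close>

context locally_compact_group
begin

definition one_nhds :: "'a set set"
  where "one_nhds = {V. openin T V \<and> \<one> \<in> V}"

definition covering :: "'a set \<Rightarrow> 'a set \<Rightarrow> 'a set \<Rightarrow> bool"
  where "covering K V S \<longleftrightarrow> finite S \<and> S \<subseteq> carrier G \<and> K \<subseteq> (\<Union>s\<in>S. s <# V)"

text \<open>Weil's index (K : V), the size of K in units of V. For compact K and V in
  \<open>one_nhds\<close> a covering exists, so the least number is attained.\<close>

definition cover_number :: "'a set \<Rightarrow> 'a set \<Rightarrow> nat"
  where "cover_number K V = (LEAST n. \<exists>S. covering K V S \<and> card S = n)"

lemma one_nhds_subset: "V \<in> one_nhds \<Longrightarrow> V \<subseteq> carrier G"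
  using openin_subset by (fastforce simp: one_nhds_def topspace_eq)

lemma compactin_carrier: "compactin T K \<Longrightarrow> K \<subseteq> carrier G"
  using compactin_subset_topspace[of T K] by (simp add: topspace_eq)

lemma ex_covering:
  assumes K: "compactin T K" and V: "V \<in> one_nhds"
  shows "\<exists>S. covering K V S"
proof -
  have "K \<subseteq> \<Union>((\<lambda>s. s <# V) ` K)"
  proof
    fix x assume x: "x \<in> K"
    then have "x \<in> carrier G" using compactin_carrier[OF K] by blast
    then have "x \<in> x <# V" using V by (force simp: l_coset_def one_nhds_def)
    then show "x \<in> \<Union>((\<lambda>s. s <# V) ` K)" using x by blast
  qed
  moreover have "openin T U" if "U \<in> (\<lambda>s. s <# V) ` K" for U
    using that V compactin_carrier[OF K] by (auto simp: one_nhds_def intro!: openin_l_coset)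
  ultimately obtain \<F> where F: "finite \<F>" "\<F> \<subseteq> (\<lambda>s. s <# V) ` K" "K \<subseteq> \<Union>\<F>"
    using compactinD[OF K, of "(\<lambda>s. s <# V) ` K"] by metis
  then obtain S where "S \<subseteq> K" "finite S" "\<F> = (\<lambda>s. s <# V) ` S"
    by (meson finite_subset_image)
  then show ?thesis using F compactin_carrier[OF K] unfolding covering_def by blast
qed

lemma cover_number_attained:
  assumes "compactin T K" "V \<in> one_nhds"
  obtains S where "covering K V S" "card S = cover_number K V"
proof -
  have "\<exists>n S. covering K V S \<and> card S = n" using ex_covering[OF assms] by blast
  then have "\<exists>S. covering K V S \<and> card S = cover_number K V"
    unfolding cover_number_def by (rule LeastI_ex)
  then show thesis using that by blast
qed

lemma cover_number_le: "covering K V S \<Longrightarrow> cover_number K V \<le> card S"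
  unfolding cover_number_def by (rule Least_le) blast

lemma cover_number_mono:
  assumes "compactin T L" "V \<in> one_nhds" "K \<subseteq> L"
  shows "cover_number K V \<le> cover_number L V"
proof -
  obtain S where S: "covering L V S" "card S = cover_number L V"
    using cover_number_attained[OF assms(1,2)] .
  then have "covering K V S" using assms(3) by (auto simp: covering_def)
  then show ?thesis using cover_number_le S by metis
qed

lemma cover_number_Un:
  assumes "compactin T K" "compactin T L" "V \<in> one_nhds"
  shows "cover_number (K \<union> L) V \<le> cover_number K V + cover_number L V"
proof -
  obtain S R where S: "covering K V S" "card S = cover_number K V"
    and R: "covering L V R" "card R = cover_number L V"
    using cover_number_attained assms by metis
  then have "covering (K \<union> L) V (S \<union> R)" by (auto simp: covering_def)
  then have "cover_number (K \<union> L) V \<le> card (S \<union> R)" by (rule cover_number_le)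
  also have "\<dots> \<le> card S + card R" by (rule card_Un_le)
  finally show ?thesis using S R by simp
qed

text \<open>If no translate of V meets both sets, an optimal covering of the union contains disjoint
  coverings of K and of L.\<close>

lemma cover_number_additive:
  assumes K: "compactin T K" and L: "compactin T L" and V: "V \<in> one_nhds"
    and sep: "\<And>s. s \<in> carrier G \<Longrightarrow> (s <# V) \<inter> K = {} \<or> (s <# V) \<inter> L = {}"
  shows "cover_number (K \<union> L) V = cover_number K V + cover_number L V"
proof (rule antisym[OF cover_number_Un[OF K L V]])
  obtain S where S: "covering (K \<union> L) V S" "card S = cover_number (K \<union> L) V"
    using cover_number_attained[OF compactin_Un[OF K L] V] .
  let ?A = "{s \<in> S. (s <# V) \<inter> K \<noteq> {}}" and ?B = "{s \<in> S. (s <# V) \<inter> L \<noteq> {}}"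
  have "covering K V ?A" using S(1) by (fastforce simp: covering_def)
  moreover have "covering L V ?B" using S(1) by (fastforce simp: covering_def)
  ultimately have "cover_number K V + cover_number L V \<le> card ?A + card ?B"
    by (intro add_mono cover_number_le)
  also have "\<dots> = card (?A \<union> ?B)"
    using S(1) sep by (intro card_Un_disjoint[symmetric]) (auto simp: covering_def)
  also have "\<dots> \<le> card S"
    using S(1) by (intro card_mono) (auto simp: covering_def)
  finally show "cover_number K V + cover_number L V \<le> cover_number (K \<union> L) V" using S by simp
qed

lemma covering_translate:
  assumes S: "covering K V S" and g: "g \<in> carrier G" and V: "V \<subseteq> carrier G"
  shows "covering (g <# K) V ((\<lambda>s. g \<otimes> s) ` S)"
  unfolding covering_def
proof (intro conjI)
  show "finite ((\<lambda>s. g \<otimes> s) ` S)" "(\<lambda>s. g \<otimes> s) ` S \<subseteq> carrier G"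
    using S g by (auto simp: covering_def)
  have "g <# K \<subseteq> g <# (\<Union>s\<in>S. s <# V)"
    using S unfolding covering_def l_coset_def by blast
  also have "\<dots> = (\<Union>s\<in>S. g <# (s <# V))" by (auto simp: l_coset_def)
  also have "\<dots> = (\<Union>s\<in>(\<lambda>s. g \<otimes> s) ` S. s <# V)"
    using S g V by (auto simp: covering_def lcos_m_assoc subset_iff)
  finally show "g <# K \<subseteq> (\<Union>s\<in>(\<lambda>s. g \<otimes> s) ` S. s <# V)" .
qed

lemma cover_number_translate_le:
  assumes K: "compactin T K" and V: "V \<in> one_nhds" and g: "g \<in> carrier G"
  shows "cover_number (g <# K) V \<le> cover_number K V"
proof -
  obtain S where S: "covering K V S" "card S = cover_number K V"
    using cover_number_attained[OF K V] .
  have "cover_number (g <# K) V \<le> card ((\<lambda>s. g \<otimes> s) ` S)"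
    by (rule cover_number_le[OF covering_translate[OF S(1) g one_nhds_subset[OF V]]])
  also have "\<dots> \<le> card S" using S(1) by (intro card_image_le) (simp add: covering_def)
  finally show ?thesis using S by simp
qed

lemma l_coset_inv_cancel: "E \<subseteq> carrier G \<Longrightarrow> g \<in> carrier G \<Longrightarrow> inv g <# (g <# E) = E"
  by (simp add: lcos_m_assoc lcos_mult_one)

lemma cover_number_translate:
  assumes K: "compactin T K" and V: "V \<in> one_nhds" and g: "g \<in> carrier G"
  shows "cover_number (g <# K) V = cover_number K V"
  using cover_number_translate_le[OF K V g]
    cover_number_translate_le[OF compactin_l_coset[OF K g] V, of "inv g"] g
    l_coset_inv_cancel[OF compactin_carrier[OF K] g] by simp

text \<open>It yields (K : V) / (C : V) \<le> (K : W), a bound independent of V; this is what places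
  all normalised indices in one compact product.\<close>

lemma cover_number_trans:
  assumes K: "compactin T K" and C: "compactin T C" and V: "V \<in> one_nhds" and W: "W \<in> one_nhds"
    and "W \<subseteq> C"
  shows "cover_number K V \<le> cover_number K W * cover_number C V"
proof -
  obtain S R where S: "covering K W S" "card S = cover_number K W"
    and R: "covering C V R" "card R = cover_number C V"
    using cover_number_attained K C V W by metis
  have Vc: "V \<subseteq> carrier G" by (rule one_nhds_subset[OF V])
  have "covering K V ((\<lambda>(s, r). s \<otimes> r) ` (S \<times> R))"
    unfolding covering_def
  proof (intro conjI)
    show "finite ((\<lambda>(s, r). s \<otimes> r) ` (S \<times> R))" "(\<lambda>(s, r). s \<otimes> r) ` (S \<times> R) \<subseteq> carrier G"
      using S R by (auto simp: covering_def)
    show "K \<subseteq> (\<Union>s\<in>(\<lambda>(s, r). s \<otimes> r) ` (S \<times> R). s <# V)"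
    proof
      fix x assume "x \<in> K"
      then obtain s where s: "s \<in> S" "x \<in> s <# W" using S(1) by (auto simp: covering_def)
      then have "x \<in> s <# (\<Union>r\<in>R. r <# V)"
        using R(1) assms(5) unfolding covering_def l_coset_def by blast
      then obtain r where r: "r \<in> R" "x \<in> s <# (r <# V)" by (auto simp: l_coset_def)
      have "s \<in> carrier G" "r \<in> carrier G" using s r S(1) R(1) by (auto simp: covering_def)
      then have "x \<in> (s \<otimes> r) <# V" using r lcos_m_assoc[OF Vc] by simp
      then show "x \<in> (\<Union>s\<in>(\<lambda>(s, r). s \<otimes> r) ` (S \<times> R). s <# V)" using s r by auto
    qed
  qed
  then have "cover_number K V \<le> card ((\<lambda>(s, r). s \<otimes> r) ` (S \<times> R))" by (rule cover_number_le)
  also have "\<dots> \<le> card (S \<times> R)" using S(1) R(1) by (intro card_image_le) (simp add: covering_def)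
  finally show ?thesis using S R by (simp add: card_cartesian_product)
qed

lemma cover_number_pos:
  assumes "compactin T C" "C \<noteq> {}" "V \<in> one_nhds"
  shows "0 < cover_number C V"
proof -
  obtain S where S: "covering C V S" "card S = cover_number C V"
    using cover_number_attained[OF assms(1,3)] .
  then have "S \<noteq> {}" "finite S" using assms(2) by (auto simp: covering_def)
  then show ?thesis using S by (simp flip: S(2) add: card_gt_0_iff)
qed

lemma one_nhds_Int: "U \<in> one_nhds \<Longrightarrow> V \<in> one_nhds \<Longrightarrow> U \<inter> V \<in> one_nhds"
  by (auto simp: one_nhds_def)

lemma carrier_one_nhds: "carrier G \<in> one_nhds"
  using openin_topspace[of T] by (simp add: one_nhds_def topspace_eq)

text \<open>If s u is in K and s v is in L, then u^-1 v lies in K^-1 L. This set is compact, hence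
  closed, and misses the identity because K and L are disjoint; so u and v cannot both be near the
  identity.\<close>

lemma separating_nhd:
  assumes K: "compactin T K" and L: "compactin T L" and disj: "disjnt K L"
  obtains V where "V \<in> one_nhds"
    "\<And>U s. U \<subseteq> V \<Longrightarrow> s \<in> carrier G \<Longrightarrow> (s <# U) \<inter> K = {} \<or> (s <# U) \<inter> L = {}"
proof -
  let ?Q = "((\<lambda>x. inv x) ` K) <#> L"
  have Kc: "K \<subseteq> carrier G" and Lc: "L \<subseteq> carrier G"
    using compactin_carrier K L by auto
  have "compactin T ?Q" by (intro compactin_set_mult compactin_set_inv K L)
  then have "openin T (topspace T - ?Q)"
    using compactin_imp_closedin[OF Hausdorff] by (simp add: closedin_def)
  moreover have "continuous_map (prod_topology T T) T (\<lambda>z. inv (fst z) \<otimes> snd z)"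
    by (intro continuous_map_group_mult continuous_map_group_inv continuous_map_fst continuous_map_snd)
  ultimately have op: "openin (prod_topology T T)
      {z \<in> topspace (prod_topology T T). inv (fst z) \<otimes> snd z \<in> topspace T - ?Q}" (is "openin _ ?W")
    by (rule openin_continuous_map_preimage[rotated])
  have "\<one> \<notin> ?Q"
  proof
    assume "\<one> \<in> ?Q"
    then obtain k l where kl: "k \<in> K" "l \<in> L" "\<one> = inv k \<otimes> l" by (auto simp: set_mult_def)
    have "k \<in> carrier G" "l \<in> carrier G" using kl Kc Lc by auto
    then have "k = l" using kl(3) by (metis inv_closed inv_equality inv_inv)
    then show False using kl disj by (auto simp: disjnt_iff)
  qed
  then have "(\<one>, \<one>) \<in> ?W" by (simp add: topspace_eq)
  then obtain A B where AB: "openin T A" "openin T B" "\<one> \<in> A" "\<one> \<in> B" "A \<times> B \<subseteq> ?W"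
    using op[unfolded openin_prod_topology_alt, rule_format, OF \<open>(\<one>, \<one>) \<in> ?W\<close>] by (elim exE conjE)
  show thesis
  proof (rule that[of "A \<inter> B"])
    show "A \<inter> B \<in> one_nhds" using AB by (auto simp: one_nhds_def)
    fix U s assume U: "U \<subseteq> A \<inter> B" and s: "s \<in> carrier G"
    show "(s <# U) \<inter> K = {} \<or> (s <# U) \<inter> L = {}"
    proof (rule ccontr)
      assume "\<not> ?thesis"
      then obtain u v where uv: "u \<in> U" "v \<in> U" "s \<otimes> u \<in> K" "s \<otimes> v \<in> L" by (auto simp: l_coset_def)
      then have uW: "(u, v) \<in> ?W" using U AB by blast
      then have uvc: "u \<in> carrier G" "v \<in> carrier G" by (auto simp: topspace_eq)
      have "inv (s \<otimes> u) \<otimes> (s \<otimes> v) \<in> ?Q" using uv by (intro set_mult_memI) auto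
      also have "inv (s \<otimes> u) \<otimes> (s \<otimes> v) = inv u \<otimes> v"
        using uvc s by (simp add: inv_mult_group m_assoc inv_solve_left')
      finally show False using uW by simp
    qed
  qed
qed

text \<open>The indices are subadditive but additive only for small V, so a limit along shrinking V
  is needed; compactness supplies a cluster point in place of a limit. The compact neighbourhood C
  of the identity fixes the unit and keeps the cluster point from being 0.\<close>

lemma ex_haar_content:
  obtains c :: "'a set \<Rightarrow> real" and C where "compactin T C" "c C = 1"
    "\<And>K. compactin T K \<Longrightarrow> 0 \<le> c K"
    "\<And>K L. compactin T K \<Longrightarrow> compactin T L \<Longrightarrow> K \<subseteq> L \<Longrightarrow> c K \<le> c L"
    "\<And>K L. compactin T K \<Longrightarrow> compactin T L \<Longrightarrow> c (K \<union> L) \<le> c K + c L"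
    "\<And>K L. compactin T K \<Longrightarrow> compactin T L \<Longrightarrow> disjnt K L \<Longrightarrow> c (K \<union> L) = c K + c L"
    "\<And>K g. compactin T K \<Longrightarrow> g \<in> carrier G \<Longrightarrow> c (g <# K) = c K"
proof -
  obtain W C where WC: "openin T W" "compactin T C" "\<one> \<in> W" "W \<subseteq> C"
    using locally_compact one_closed unfolding locally_compact_space_def topspace_eq by metis
  have W: "W \<in> one_nhds" using WC by (simp add: one_nhds_def)
  have C: "compactin T C" "C \<noteq> {}" using WC by auto
  let ?\<K> = "{K. compactin T K}"
  \<comment> \<open>By Tychonoff's theorem this product is compact; the interval at coordinate K has
    the length supplied by \<open>cover_number_trans\<close>.\<close>
  define P where "P = product_topology (\<lambda>K. top_of_set {0..real (cover_number K W)}) ?\<K>"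
  define h where "h V = restrict (\<lambda>K. real (cover_number K V) / real (cover_number C V)) ?\<K>" for V
  define A where "A V = h ` {U \<in> one_nhds. U \<subseteq> V}" for V
  have Cpos: "0 < real (cover_number C V)" if "V \<in> one_nhds" for V
    using cover_number_pos[OF C that] by simp
  have hP: "h V \<in> topspace P" if V: "V \<in> one_nhds" for V
  proof -
    have "real (cover_number K V) / real (cover_number C V) \<le> real (cover_number K W)"
      if K: "compactin T K" for K
      using Cpos[OF V] cover_number_trans[OF K C(1) V W WC(4)]
      by (simp add: pos_divide_le_eq flip: of_nat_mult)
    then show ?thesis by (auto simp: P_def h_def PiE_iff)
  qed
  have "compact_space P"
    unfolding P_def compact_space_product_topology by (simp add: compact_space_subtopology)
  moreover have "\<forall>D\<in>(\<lambda>V. P closure_of A V) ` one_nhds. closedin P D" by auto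
  \<comment> \<open>Finite intersection property: the indices taken for the intersection of finitely
    many neighbourhoods lie in each of the corresponding closures.\<close>
  moreover have "\<Inter>\<F> \<noteq> {}" if F: "finite \<F>" "\<F> \<subseteq> (\<lambda>V. P closure_of A V) ` one_nhds" for \<F>
  proof -
    obtain \<V> where V: "\<V> \<subseteq> one_nhds" "finite \<V>" "\<F> = (\<lambda>V. P closure_of A V) ` \<V>"
      using F by (meson finite_subset_image)
    let ?V = "carrier G \<inter> \<Inter>\<V>"
    have "?V \<in> one_nhds" using V(2,1)
    proof (induction \<V> rule: finite_induct)
      case empty then show ?case by (simp add: carrier_one_nhds)
    next
      case (insert V \<V>)
      then show ?case using one_nhds_Int[of V "carrier G \<inter> \<Inter>\<V>"] by (simp add: Int_left_commute)
    qed
    then have "h ?V \<in> P closure_of A V" if "V \<in> \<V>" for V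
      using that hP by (intro subsetD[OF closure_of_subset]) (auto simp: A_def)
    then show ?thesis using V by auto
  qed
  ultimately have "\<Inter>((\<lambda>V. P closure_of A V) ` one_nhds) \<noteq> {}"
    unfolding compact_space_fip by blast
  then obtain c where c: "\<And>V. V \<in> one_nhds \<Longrightarrow> c \<in> P closure_of A V" by auto
  have proj: "continuous_map P euclideanreal (\<lambda>x. x K)" if "compactin T K" for K
  proof (rule continuous_map_into_fulltopology)
    show "continuous_map P (top_of_set {0..real (cover_number K W)}) (\<lambda>x. x K)"
      unfolding P_def
      using continuous_map_product_projection[of K ?\<K> "\<lambda>K. top_of_set {0..real (cover_number K W)}"] that
      by simp
  qed
  \<comment> \<open>A closed condition on a continuous function of the coordinates passes to c as
    soon as it holds for all sufficiently small U.\<close>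
  have limit: "\<phi> c \<in> S"
    if \<phi>: "continuous_map P euclideanreal \<phi>" and S: "closed S" and V: "V \<in> one_nhds"
      and U: "\<And>U. U \<in> one_nhds \<Longrightarrow> U \<subseteq> V \<Longrightarrow> \<phi> (h U) \<in> S" for \<phi> S V
  proof -
    have "P closure_of A V \<subseteq> {x \<in> topspace P. \<phi> x \<in> S}"
      using S U hP by (intro closure_of_minimal closedin_continuous_map_preimage[OF \<phi>]) (auto simp: A_def)
    then show ?thesis using c[OF V] by blast
  qed
  have hK: "h U K = real (cover_number K U) / real (cover_number C U)" if "compactin T K" for U K
    using that by (simp add: h_def)
  show thesis
  proof (rule that[of C c])
    show "compactin T C" by (rule C)
    have "c C \<in> {1}"
      by (rule limit[OF proj[OF C(1)] _ carrier_one_nhds]) (use hK[OF C(1)] Cpos in force)+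
    then show "c C = 1" by simp
  next
    fix K assume K: "compactin T K"
    have "c K \<in> {0..}"
      by (rule limit[OF proj[OF K] _ carrier_one_nhds]) (auto simp: hK[OF K])
    then show "0 \<le> c K" by simp
    fix g assume g: "g \<in> carrier G"
    have gK: "compactin T (g <# K)" by (rule compactin_l_coset[OF K g])
    have "c (g <# K) - c K \<in> {0}"
      by (rule limit[OF continuous_map_diff[OF proj[OF gK] proj[OF K]] _ carrier_one_nhds])
        (auto simp: hK[OF K] hK[OF gK] cover_number_translate[OF K _ g])
    then show "c (g <# K) = c K" by simp
  next
    fix K L assume K: "compactin T K" and L: "compactin T L"
    have KL: "compactin T (K \<union> L)" by (rule compactin_Un[OF K L])
    have "c K + c L - c (K \<union> L) \<in> {0..}"
    proof (rule limit[OF continuous_map_diff[OF continuous_map_add[OF proj[OF K] proj[OF L]] proj[OF KL]] _ carrier_one_nhds])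
      fix U assume U: "U \<in> one_nhds"
      have "real (cover_number (K \<union> L) U) \<le> real (cover_number K U) + real (cover_number L U)"
        using cover_number_Un[OF K L U] by (simp flip: of_nat_add)
      from divide_right_mono[OF this, of "real (cover_number C U)"]
      show "h U K + h U L - h U (K \<union> L) \<in> {0..}"
        by (simp add: hK K L KL add_divide_distrib)
    qed simp
    then show "c (K \<union> L) \<le> c K + c L" by simp
    show "c K \<le> c L" if "K \<subseteq> L"
    proof -
      have "c L - c K \<in> {0..}"
        by (rule limit[OF continuous_map_diff[OF proj[OF L] proj[OF K]] _ carrier_one_nhds])
          (auto simp: hK[OF K] hK[OF L] intro!: divide_right_mono cover_number_mono[OF L _ that])
      then show ?thesis by simp
    qed
    show "c (K \<union> L) = c K + c L" if disj: "disjnt K L"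
    proof -
      \<comment> \<open>Additivity of the indices holds only once U is small enough to separate K
        from L, so the limit is taken below this V and not below the whole group.\<close>
      obtain V where V: "V \<in> one_nhds"
        "\<And>U s. U \<subseteq> V \<Longrightarrow> s \<in> carrier G \<Longrightarrow> (s <# U) \<inter> K = {} \<or> (s <# U) \<inter> L = {}"
        using separating_nhd[OF K L disj] by metis
      have "c K + c L - c (K \<union> L) \<in> {0}"
      proof (rule limit[OF continuous_map_diff[OF continuous_map_add[OF proj[OF K] proj[OF L]] proj[OF KL]] _ V(1)])
        fix U assume U: "U \<in> one_nhds" "U \<subseteq> V"
        have "cover_number (K \<union> L) U = cover_number K U + cover_number L U"
          by (rule cover_number_additive[OF K L U(1) V(2)[OF U(2)]])
        then show "h U K + h U L - h U (K \<union> L) \<in> {0}"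
          by (simp add: hK K L KL add_divide_distrib)
      qed simp
      then show ?thesis by simp
    qed
  qed
qed

theorem ex_left_haar_measure: "\<exists>M. left_haar_measure G T M"
proof (rule ex_haar_content)
  fix c :: "'a set \<Rightarrow> real" and C assume C: "compactin T C" "c C = 1"
    and c: "\<And>K. compactin T K \<Longrightarrow> 0 \<le> c K"
    "\<And>K L. compactin T K \<Longrightarrow> compactin T L \<Longrightarrow> K \<subseteq> L \<Longrightarrow> c K \<le> c L"
    "\<And>K L. compactin T K \<Longrightarrow> compactin T L \<Longrightarrow> c (K \<union> L) \<le> c K + c L"
    "\<And>K L. compactin T K \<Longrightarrow> compactin T L \<Longrightarrow> disjnt K L \<Longrightarrow> c (K \<union> L) = c K + c L"
    "\<And>K g. compactin T K \<Longrightarrow> g \<in> carrier G \<Longrightarrow> c (g <# K) = c K"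
  interpret ct: compact_content T "\<lambda>K. ennreal (c K)"
  proof
    fix K L assume K: "compactin T K" and L: "compactin T L"
    show "ennreal (c (K \<union> L)) \<le> ennreal (c K) + ennreal (c L)"
      using c(3)[OF K L] c(1)[OF K] c(1)[OF L] by (simp flip: ennreal_plus add: ennreal_leI)
    show "disjnt K L \<Longrightarrow> ennreal (c (K \<union> L)) = ennreal (c K) + ennreal (c L)"
      using c(4)[OF K L] c(1)[OF K] c(1)[OF L] by (simp flip: ennreal_plus)
  qed (auto simp: Hausdorff loc_compact c(2) ennreal_leI)
  let ?M = ct.content_measure
  \<comment> \<open>An inequality valid for every g yields equality on applying it also to
    \<open>inv g\<close>.\<close>
  have inner_le: "ct.inner U \<le> ct.inner (g <# U)" if U: "U \<subseteq> carrier G" and g: "g \<in> carrier G" for U g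
    unfolding ct.inner_def[of U]
  proof (rule SUP_least, clarify)
    fix K assume K: "compactin T K" "K \<subseteq> U"
    have "ennreal (c K) = ennreal (c (g <# K))" using c(5)[OF K(1) g] by simp
    also have "\<dots> \<le> ct.inner (g <# U)"
      using K by (intro ct.content_le_inner compactin_l_coset g) (auto simp: l_coset_def)
    finally show "ennreal (c K) \<le> ct.inner (g <# U)" .
  qed
  have inner_eq: "ct.inner (g <# U) = ct.inner U" if U: "U \<subseteq> carrier G" and g: "g \<in> carrier G" for U g
    using inner_le[OF U g] inner_le[OF l_coset_subset_G[OF U g], of "inv g"] l_coset_inv_cancel[OF U g] g
    by (simp add: antisym)
  have outer_le: "ct.outer (g <# E) \<le> ct.outer E" if g: "g \<in> carrier G" for E g
    unfolding ct.outer_def[of E]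
  proof (rule INF_greatest, clarify)
    fix U assume U: "openin T U" "E \<subseteq> U"
    have "ct.outer (g <# E) \<le> ct.inner (g <# U)"
      using U by (intro ct.outer_le_inner openin_l_coset g) (auto simp: l_coset_def)
    also have "\<dots> = ct.inner U"
      using openin_subset[OF U(1)] by (intro inner_eq g) (simp add: topspace_eq)
    finally show "ct.outer (g <# E) \<le> ct.inner U" .
  qed
  have outer_eq: "ct.outer (g <# E) = ct.outer E" if E: "E \<subseteq> carrier G" and g: "g \<in> carrier G" for E g
    using outer_le[OF g, of E] outer_le[OF inv_closed[OF g], of "g <# E"] l_coset_inv_cancel[OF E g]
    by (simp add: antisym)
  have "left_haar_measure G T ?M"
    unfolding left_haar_measure_def
  proof (intro conjI ballI)
    show R: "radon_measure T ?M" by (rule ct.radon_content_measure)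
    have "1 \<le> emeasure ?M C" using ct.content_le_emeasure[OF C(1)] C(2) by simp
    also have "\<dots> \<le> emeasure ?M (space ?M)" by (rule emeasure_space)
    finally show "emeasure ?M (space ?M) \<noteq> 0" by auto
    fix g E assume g: "g \<in> carrier G" and "E \<in> sets ?M"
    then have E: "E \<in> sets (borel_of T)" by (simp add: ct.sets_content_measure)
    then have "E \<subseteq> carrier G" by (rule borel_subset_carrier)
    then show "emeasure ?M (g <# E) = emeasure ?M E"
      using E borel_l_coset[OF E g] outer_eq[OF _ g] by (simp add: ct.emeasure_content_measure)
  qed
  then show ?thesis by blast
qed

section \<open>The modular function as a homomorphism\<close>

lemma modular_function_pos:
  assumes s: "s \<in> carrier G"
  shows "0 < modular_function G T s"
    and modular_function_emeasure: "left_haar_measure G T M \<Longrightarrow> E \<in> sets (borel_of T) \<Longrightarrow>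
      emeasure M (E #> s) = ennreal (modular_function G T s) * emeasure M E"
proof -
  obtain M0 where M0: "left_haar_measure G T M0" using ex_left_haar_measure by blast
  obtain c where c: "0 < c" "\<And>E. E \<in> sets (borel_of T) \<Longrightarrow> emeasure M0 (E #> s) = ennreal c * emeasure M0 E"
    using haar_proportional[OF M0 left_haar_measure_right_translate(1)[OF M0 s]]
      left_haar_measure_right_translate(2)[OF M0 s] by metis
  let ?P = "\<lambda>c. 0 < c \<and> (\<forall>\<mu>. left_haar_measure G T \<mu> \<longrightarrow>
        (\<forall>E\<in>sets \<mu>. emeasure \<mu> (E #> s) = ennreal c * emeasure \<mu> E))"
  have "?P (modular_function G T s)"
    unfolding modular_function_def
  \<comment> \<open>The number exists by comparing one Haar measure with its right translate; it
    serves all Haar measures because they are multiples of that one; a set of positive finite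
    measure makes it unique.\<close>
  proof (rule theI[of ?P c])
    show "?P c"
    proof (intro conjI allI impI ballI)
      fix M E assume M: "left_haar_measure G T M" and "E \<in> sets M"
      then have E: "E \<in> sets (borel_of T)" using radon_sets[OF left_haar_radon[OF M]] by simp
      obtain a where a: "\<And>E. E \<in> sets (borel_of T) \<Longrightarrow> emeasure M E = ennreal a * emeasure M0 E"
        using haar_proportional[OF M0 M] by metis
      show "emeasure M (E #> s) = ennreal c * emeasure M E"
        by (simp add: a[OF E] a[OF borel_r_coset[OF E s]] c(2)[OF E] ac_simps)
    qed (rule c)
    fix d assume d: "?P d"
    obtain E where E: "E \<in> sets (borel_of T)" "0 < emeasure M0 E" "emeasure M0 E < \<infinity>"
      using haar_finite_pos_set[OF M0] .
    have "ennreal d * emeasure M0 E = ennreal c * emeasure M0 E"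
      using d M0 E(1) c(2)[OF E(1)] radon_sets[OF left_haar_radon[OF M0]] by auto
    then have "ennreal d = ennreal c"
      using E by (auto simp: mult.commute[of _ "emeasure M0 E"] ennreal_mult_cancel_left)
    then show "d = c" using d c(1) by simp
  qed
  then show "0 < modular_function G T s"
    "left_haar_measure G T M \<Longrightarrow> E \<in> sets (borel_of T) \<Longrightarrow>
      emeasure M (E #> s) = ennreal (modular_function G T s) * emeasure M E"
    using radon_sets[OF left_haar_radon] by auto
qed

lemma modular_function_mult:
  assumes s: "s \<in> carrier G" and t: "t \<in> carrier G"
  shows "modular_function G T (s \<otimes> t) = modular_function G T s * modular_function G T t"
proof -
  obtain M where M: "left_haar_measure G T M" using ex_left_haar_measure by blast
  obtain E where E: "E \<in> sets (borel_of T)" "0 < emeasure M E" "emeasure M E < \<infinity>"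
    using haar_finite_pos_set[OF M] .
  have Es: "E #> s \<in> sets (borel_of T)" by (rule borel_r_coset[OF E(1) s])
  have "ennreal (modular_function G T (s \<otimes> t)) * emeasure M E = emeasure M (E #> (s \<otimes> t))"
    using modular_function_emeasure[OF _ M E(1)] s t by simp
  also have "E #> (s \<otimes> t) = (E #> s) #> t" using borel_subset_carrier[OF E(1)] s t by (simp add: coset_mult_assoc)
  also have "emeasure M \<dots> = ennreal (modular_function G T t) * (ennreal (modular_function G T s) * emeasure M E)"
    using modular_function_emeasure[OF t M Es] modular_function_emeasure[OF s M E(1)] by simp
  also have "\<dots> = ennreal (modular_function G T s * modular_function G T t) * emeasure M E"
    using modular_function_pos[OF s] modular_function_pos[OF t] by (simp add: ennreal_mult ac_simps)
  finally have "ennreal (modular_function G T (s \<otimes> t)) = ennreal (modular_function G T s * modular_function G T t)"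
    using E by (auto simp: mult.commute[of _ "emeasure M E"] ennreal_mult_cancel_left)
  then show ?thesis
    using modular_function_pos s t by (simp add: less_imp_le)
qed

lemma modular_function_hom: "group_hom G pos_real_group (modular_function G T)"
proof -
  interpret P: comm_group pos_real_group by (rule comm_group_pos_real_group)
  show ?thesis
    by unfold_locales
      (auto simp: hom_def modular_function_pos modular_function_mult, auto simp: pos_real_group_def modular_function_pos)
qed

end

section \<open>Weil's formula for coset spaces with an invariant measure\<close>

context locally_compact_group
begin

text \<open>Integrating f(x s) is integrating f against the push-forward under x |-> x s, which
  measures E as E s^-1; hence the factor at the inverse. The form \<open>inv (inv s)\<close> comes
  from using the translation lemma at \<open>inv s\<close>.\<close>

lemma haar_integral_right:
  fixes f :: "'a \<Rightarrow> real"
  assumes M: "left_haar_measure G T M" and s: "s \<in> carrier G" and f: "f \<in> Cc T"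
  shows "(\<integral>x. f (x \<otimes> s) \<partial>M) = modular_function G T (inv s) * (\<integral>x. f x \<partial>M)"
proof -
  let ?N = "distr M (borel_of T) (\<lambda>x. x \<otimes> inv (inv s))"
  have R: "radon_measure T M" by (rule left_haar_radon[OF M])
  have N: "left_haar_measure G T ?N"
    and NE: "\<And>E. E \<in> sets (borel_of T) \<Longrightarrow> emeasure ?N E = emeasure M (E #> inv s)"
    using left_haar_measure_right_translate[OF M, of "inv s"] s by auto
  obtain c where c: "0 < c" "\<And>f. f \<in> Cc T \<Longrightarrow> (\<integral>x. f x \<partial>?N) = c * (\<integral>x. f x \<partial>M)"
    using haar_integral_proportional[OF M N] by metis
  obtain E where E: "E \<in> sets (borel_of T)" "0 < emeasure M E" "emeasure M E < \<infinity>"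
    using haar_finite_pos_set[OF M] .
  have "ennreal c * emeasure M E = ennreal (modular_function G T (inv s)) * emeasure M E"
    using radon_proportional[OF R left_haar_radon[OF N] c(1,2) E(1)] NE[OF E(1)]
      modular_function_emeasure[OF inv_closed[OF s] M E(1)] by simp
  then have "ennreal c = ennreal (modular_function G T (inv s))"
    using E by (auto simp: mult.commute[of _ "emeasure M E"] ennreal_mult_cancel_left)
  then have ceq: "c = modular_function G T (inv s)"
    using c(1) modular_function_pos[OF inv_closed[OF s]] by simp
  have "continuous_map T T (\<lambda>x. x \<otimes> inv (inv s))"
    using homeomorphic_maps_right[of "inv (inv s)"] s by (simp add: homeomorphic_maps_def)
  then have "(\<lambda>x. x \<otimes> inv (inv s)) \<in> measurable M (borel_of T)"
    using continuous_map_measurable measurable_cong_sets[OF radon_sets[OF R] refl] by blast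
  then have "(\<integral>x. f x \<partial>?N) = (\<integral>x. f (x \<otimes> inv (inv s)) \<partial>M)"
    by (rule integral_distr[OF _ continuous_map_borel_measurable[OF Cc_continuous[OF f] refl]])
  then show ?thesis using c(2)[OF f] ceq s by simp
qed

text \<open>Local compactness of the subspace is a hypothesis so that one lemma serves both the
  closed subgroup H and open subgroups such as the kernel.\<close>

lemma locally_compact_group_subgroup:
  assumes S: "subgroup S G" and lc: "locally_compact_space (subtopology T S)"
  shows "locally_compact_group (G\<lparr>carrier := S\<rparr>) (subtopology T S)"
proof (intro locally_compact_group.intro locally_compact_group_axioms.intro)
  interpret S: subgroup S G by (rule S)
  show "group (G\<lparr>carrier := S\<rparr>)" by (rule subgroup_imp_group[OF S])
  show ts: "topspace (subtopology T S) = carrier (G\<lparr>carrier := S\<rparr>)"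
    using S.subset by (auto simp: topspace_eq)
  have Sc: "x \<in> carrier G" if "x \<in> S" for x using that S.subset by blast
  show "continuous_map (prod_topology (subtopology T S) (subtopology T S)) (subtopology T S)
      (\<lambda>(x, y). x \<otimes>\<^bsub>G\<lparr>carrier := S\<rparr>\<^esub> y)"
    unfolding subtopology_Times[symmetric]
    using continuous_map_from_subtopology[OF continuous_mult, of "S \<times> S"]
    by (auto simp: continuous_map_in_subtopology)
  have "continuous_map (subtopology T S) (subtopology T S) (\<lambda>x. inv x)"
    using continuous_map_from_subtopology[OF continuous_inv, of S]
    by (auto simp: continuous_map_in_subtopology)
  then show "continuous_map (subtopology T S) (subtopology T S) (\<lambda>x. inv\<^bsub>G\<lparr>carrier := S\<rparr>\<^esub> x)"
    by (rule continuous_map_eq) (simp add: m_inv_consistent[OF S] topspace_eq)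
qed (auto simp: lc Hausdorff_space_subtopology[OF Hausdorff])

lemma openin_r_coset:
  assumes "openin T U" "g \<in> carrier G" shows "openin T (U #> g)"
proof -
  have "continuous_map T T (\<lambda>x. x \<otimes> inv g)"
    using homeomorphic_maps_right[OF assms(2)] by (simp add: homeomorphic_maps_def)
  from openin_continuous_map_preimage[OF this assms(1)] show ?thesis
    using r_coset_eq[of U g] openin_subset[OF assms(1)] assms(2) by (simp add: topspace_eq)
qed

section \<open>Topology of left coset spaces\<close>

lemma l_coset_mult_mem:
  assumes "subgroup H G" "x \<in> carrier G" "h \<in> H"
  shows "(x \<otimes> h) <# H = x <# H"
proof -
  interpret subgroup H G by fact
  have h: "h \<in> carrier G" using assms(3) subset by blast
  have "(x \<otimes> h) <# H = x <# (h <# H)" by (rule lcos_m_assoc[OF subset assms(2) h, symmetric])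
  also have "h <# H = H" by (rule coset_join3[OF h assms(1,3)])
  finally show ?thesis .
qed

lemma l_coset_eq_iff:
  assumes H: "subgroup H G" and "x \<in> carrier G" "y \<in> carrier G"
  shows "x <# H = y <# H \<longleftrightarrow> (\<exists>h\<in>H. x = y \<otimes> h)"
proof
  assume "x <# H = y <# H"
  then have "x \<in> y <# H" using lcos_self[OF assms(2) H] by simp
  then show "\<exists>h\<in>H. x = y \<otimes> h" by (auto simp: l_coset_def)
qed (use l_coset_mult_mem[OF H assms(3)] in auto)

lemma quotient_map_coset: "quotient_map T (left_coset_space G T H) (\<lambda>g. g <# H)"
  unfolding left_coset_space_def by (rule quotient_map_quotient_topology)

lemma topspace_cosets: "topspace (left_coset_space G T H) = (\<lambda>g. g <# H) ` carrier G"
  unfolding left_coset_space_def topspace_quotient_topology topspace_eq ..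

text \<open>The preimage of the image of V is V H, a union of right translates of V; thus the
  projection is an open map.\<close>

lemma openin_coset_image:
  assumes H: "subgroup H G" and V: "openin T V"
  shows "openin (left_coset_space G T H) ((\<lambda>g. g <# H) ` V)"
proof -
  have Vc: "V \<subseteq> carrier G" using openin_subset[OF V] by (simp add: topspace_eq)
  have Hc: "H \<subseteq> carrier G" using H by (rule subgroup.subset)
  have "{x \<in> topspace T. x <# H \<in> (\<lambda>g. g <# H) ` V} = (\<Union>h\<in>H. V #> h)"
  proof (rule subset_antisym; rule subsetI)
    fix x assume "x \<in> {x \<in> topspace T. x <# H \<in> (\<lambda>g. g <# H) ` V}"
    then obtain v where v: "x \<in> carrier G" "v \<in> V" "x <# H = v <# H" by (auto simp: topspace_eq)
    then obtain h where "h \<in> H" "x = v \<otimes> h" using v l_coset_eq_iff[OF H, of x v] Vc by blast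
    then show "x \<in> (\<Union>h\<in>H. V #> h)" using v by (auto simp: r_coset_def)
  next
    fix x assume "x \<in> (\<Union>h\<in>H. V #> h)"
    then obtain h v where "h \<in> H" "v \<in> V" "x = v \<otimes> h" by (auto simp: r_coset_def)
    then show "x \<in> {x \<in> topspace T. x <# H \<in> (\<lambda>g. g <# H) ` V}"
      using l_coset_mult_mem[OF H] Vc Hc by (auto simp: topspace_eq subset_iff)
  qed
  moreover have "openin T (\<Union>h\<in>H. V #> h)"
    using Hc by (intro openin_Union) (auto intro!: openin_r_coset V)
  ultimately show ?thesis
    unfolding left_coset_space_def openin_quotient_topology using Vc by (auto simp: topspace_eq)
qed

text \<open>Continuity of the action on cosets is tested on the group, through the quotient
  map.\<close>

lemma homeomorphic_maps_coset:
  assumes H: "subgroup H G" and g: "g \<in> carrier G"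
  shows "homeomorphic_maps (left_coset_space G T H) (left_coset_space G T H)
    (\<lambda>C. g <# C) (\<lambda>C. inv g <# C)"
proof -
  let ?X = "left_coset_space G T H"
  have Hc: "H \<subseteq> carrier G" using H by (rule subgroup.subset)
  have cont: "continuous_map ?X ?X (\<lambda>C. a <# C)" if a: "a \<in> carrier G" for a
  proof (rule continuous_compose_quotient_map[OF quotient_map_coset])
    have "continuous_map T T (\<lambda>x. a \<otimes> x)"
      using homeomorphic_maps_left[OF a] by (simp add: homeomorphic_maps_def)
    from continuous_map_compose[OF this quotient_imp_continuous_map[OF quotient_map_coset]]
    have "continuous_map T ?X ((\<lambda>g. g <# H) \<circ> (\<lambda>x. a \<otimes> x))" .
    then show "continuous_map T ?X ((\<lambda>C. a <# C) \<circ> (\<lambda>g. g <# H))"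
      by (rule continuous_map_eq) (simp add: topspace_eq lcos_m_assoc[OF Hc a])
  qed
  have "x <# H \<subseteq> carrier G" if "x \<in> carrier G" for x using that Hc by (rule l_coset_subset_G[rotated])
  then show ?thesis
    using g cont[OF g] cont[OF inv_closed[OF g]]
    by (auto simp: homeomorphic_maps_def topspace_cosets lcos_m_assoc lcos_mult_one)
qed

end

lemma Cc_subtopology_closed:
  assumes f: "f \<in> Cc X" and H: "closedin X H"
  shows "f \<in> Cc (subtopology X H)"
proof -
  obtain K where K: "compactin X K" "\<And>x. x \<in> topspace X \<Longrightarrow> x \<notin> K \<Longrightarrow> f x = 0"
    using Cc_support[OF f] by blast
  show ?thesis
  proof (rule Cc_I)
    show "compactin (subtopology X H) (H \<inter> K)"
      using closed_Int_compactin[OF H K(1)] by (simp add: compactin_subtopology)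
  qed (use K continuous_map_from_subtopology[OF Cc_continuous[OF f]] in auto)
qed

section \<open>Finite invariant measures on coset spaces\<close>

locale covolume = locally_compact_group G T for G (structure) and T :: "'a topology" +
  fixes H :: "'a set" and m :: "'a set measure"
  assumes closed_subgroup: "closed_subgroup H G T"
    and radon: "radon_measure (left_coset_space G T H) m"
    and finite: "finite_measure m"
    and nonzero: "emeasure m (space m) \<noteq> 0"
    and invariant: "g \<in> carrier G \<Longrightarrow> E \<in> sets m \<Longrightarrow> emeasure m ((\<lambda>C. g <# C) ` E) = emeasure m E"
begin

abbreviation "X \<equiv> left_coset_space G T H"

lemma subgroup_H: "subgroup H G" and closedin_H: "closedin T H"
  using closed_subgroup by (auto simp: closed_subgroup_def)

lemma H_sub: "H \<subseteq> carrier G" by (rule subgroup.subset[OF subgroup_H])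

lemma space_m: "space m = (\<lambda>g. g <# H) ` carrier G"
  using radon_space[OF radon] by (simp add: topspace_cosets)

text \<open>The group acts transitively on cosets, so the translates of a null open set would cover
  the coset space by null open sets.\<close>

lemma coset_open_pos:
  assumes U: "openin X U" "U \<noteq> {}"
  shows "0 < emeasure m U"
proof (rule ccontr)
  assume "\<not> 0 < emeasure m U"
  then have 0: "emeasure m U = 0" by simp
  obtain u where u: "u \<in> carrier G" "u <# H \<in> U"
    using U openin_subset[OF U(1)] by (auto simp: topspace_cosets)
  have "emeasure m (space m) = 0"
  proof (rule radon_null_cover[OF radon])
    show "topspace X \<subseteq> \<Union>((\<lambda>g. (\<lambda>C. g <# C) ` U) ` carrier G)"
    proof
      fix C assume "C \<in> topspace X"
      then obtain x where x: "x \<in> carrier G" "C = x <# H" by (auto simp: topspace_cosets)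
      then have "C = (x \<otimes> inv u) <# (u <# H)"
        using u by (simp add: lcos_m_assoc H_sub m_assoc)
      then show "C \<in> \<Union>((\<lambda>g. (\<lambda>C. g <# C) ` U) ` carrier G)" using x u by blast
    qed
    fix V assume "V \<in> (\<lambda>g. (\<lambda>C. g <# C) ` U) ` carrier G"
    then obtain g where g: "g \<in> carrier G" "V = (\<lambda>C. g <# C) ` U" by blast
    have "open_map X X (\<lambda>C. g <# C)"
      using homeomorphic_maps_coset[OF subgroup_H g(1)]
      by (meson homeomorphic_imp_open_map homeomorphic_map_maps)
    then show "openin X V \<and> emeasure m V = 0"
      using g U 0 invariant[OF g(1), of U] by (auto simp: open_map_def radon_sets[OF radon] borel_of_openin)
  qed
  then show False using nonzero by simp
qed

lemma emeasure_translate_preimage: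
  assumes g: "g \<in> carrier G" and E: "E \<in> sets m"
  shows "emeasure m {C \<in> topspace X. g <# C \<in> E} = emeasure m E"
proof -
  have "homeomorphic_maps X X (\<lambda>C. g <# C) (\<lambda>C. inv g <# C)"
    by (rule homeomorphic_maps_coset[OF subgroup_H g])
  moreover have "E \<subseteq> topspace X" using sets.sets_into_space[OF E] radon_space[OF radon] by simp
  ultimately have "{C \<in> topspace X. g <# C \<in> E} = (\<lambda>C. inv g <# C) ` E"
    by (auto simp: homeomorphic_maps_def continuous_map_def image_iff subset_iff Pi_iff; metis)
  then show ?thesis using invariant[OF inv_closed[OF g] E] by simp
qed

lemma distr_translate:
  assumes g: "g \<in> carrier G"
  shows "distr m (borel_of X) (\<lambda>C. g <# C) = m"
proof (rule measure_eqI)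
  have cont: "continuous_map X X (\<lambda>C. g <# C)"
    using homeomorphic_maps_coset[OF subgroup_H g] by (simp add: homeomorphic_maps_def)
  show "sets (distr m (borel_of X) (\<lambda>C. g <# C)) = sets m" by (simp add: radon_sets[OF radon])
  fix E assume "E \<in> sets (distr m (borel_of X) (\<lambda>C. g <# C))"
  then have E: "E \<in> sets (borel_of X)" by simp
  show "emeasure (distr m (borel_of X) (\<lambda>C. g <# C)) E = emeasure m E"
    using emeasure_distr_radon[OF radon cont E] emeasure_translate_preimage[OF g, of E] E radon_sets[OF radon]
    by simp
qed

end

section \<open>The iterated integral over fibres and cosets\<close>

locale covolume_haar = covolume +
  fixes \<nu> :: "'a measure"
  assumes haar_H: "left_haar_measure (G\<lparr>carrier := H\<rparr>) (subtopology T H) \<nu>"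
begin

lemma locally_compact_group_H: "locally_compact_group (G\<lparr>carrier := H\<rparr>) (subtopology T H)"
  by (rule locally_compact_group_subgroup[OF subgroup_H])
    (rule locally_compact_space_closed_subset[OF locally_compact closedin_H])

sublocale H: locally_compact_group "G\<lparr>carrier := H\<rparr>" "subtopology T H"
  by (rule locally_compact_group_H)

lemma radon_H: "radon_measure (subtopology T H) \<nu>"
  by (rule H.left_haar_radon[OF haar_H])

lemma space_\<nu>: "space \<nu> = H"
  using radon_space[OF radon_H] H.topspace_eq by simp

definition fiber_integral :: "('a \<Rightarrow> real) \<Rightarrow> 'a \<Rightarrow> real"
  where "fiber_integral f x = (\<integral>h. f (x \<otimes> h) \<partial>\<nu>)"

text \<open>The choice of representative is immaterial: left invariance of \<nu> makes the fibre
  integral constant on cosets, see \<open>coset_integral_coset\<close>.\<close>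

definition coset_integral :: "('a \<Rightarrow> real) \<Rightarrow> 'a set \<Rightarrow> real"
  where "coset_integral f C = fiber_integral f (SOME x. x \<in> carrier G \<and> C = x <# H)"

definition weil_functional :: "('a \<Rightarrow> real) \<Rightarrow> real"
  where "weil_functional f = (\<integral>C. coset_integral f C \<partial>m)"

lemma Cc_fiber: "f \<in> Cc T \<Longrightarrow> x \<in> carrier G \<Longrightarrow> (\<lambda>h. f (x \<otimes> h)) \<in> Cc (subtopology T H)"
  by (intro Cc_subtopology_closed Cc_left closedin_H)

lemma fiber_integral_mult:
  assumes f: "f \<in> Cc T" and x: "x \<in> carrier G" and k: "k \<in> H"
  shows "fiber_integral f (x \<otimes> k) = fiber_integral f x"
proof -
  have "fiber_integral f x = (\<integral>h. f (x \<otimes> (k \<otimes> h)) \<partial>\<nu>)"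
    unfolding fiber_integral_def
    using H.haar_integral_left[OF haar_H _ Cc_fiber[OF f x], of k] k by simp
  also have "\<dots> = fiber_integral f (x \<otimes> k)"
    unfolding fiber_integral_def using x k H_sub
    by (intro Bochner_Integration.integral_cong) (auto simp: space_\<nu> m_assoc subset_iff)
  finally show ?thesis by simp
qed

lemma coset_integral_coset:
  assumes f: "f \<in> Cc T" and x: "x \<in> carrier G"
  shows "coset_integral f (x <# H) = fiber_integral f x"
proof -
  let ?y = "SOME y. y \<in> carrier G \<and> x <# H = y <# H"
  have y: "?y \<in> carrier G \<and> x <# H = ?y <# H" by (rule someI[of _ x]) (use x in simp)
  then obtain h where "h \<in> H" "x = ?y \<otimes> h" using l_coset_eq_iff[OF subgroup_H x] by blast
  then show ?thesis
    unfolding coset_integral_def using fiber_integral_mult[OF f] y by metis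
qed

text \<open>For u in a neighbourhood of x contained in a compact C, all h in H with u h in K lie in
  H \<inter> C^-1 K. This is compact since H is closed, and serves as a support common to all such
  u.\<close>

lemma continuous_map_fiber_integral:
  assumes f: "f \<in> Cc T"
  shows "continuous_map T euclideanreal (fiber_integral f)"
proof -
  interpret J: positive_functional "subtopology T H" "\<lambda>f. \<integral>x. f x \<partial>\<nu>"
    by (rule H.positive_functional_integral_UNIV[OF radon_H])
  obtain K where K: "compactin T K" "\<And>x. x \<in> topspace T \<Longrightarrow> x \<notin> K \<Longrightarrow> f x = 0"
    using Cc_support[OF f] by blast
  have "continuous_map T euclideanreal (\<lambda>x. \<integral>h. f (x \<otimes> h) \<partial>\<nu>)"
  proof (rule J.continuous_map_functional)
    have snd: "continuous_map (prod_topology T (subtopology T H)) T snd"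
      by (rule continuous_map_into_fulltopology[OF continuous_map_snd])
    show "continuous_map (prod_topology T (subtopology T H)) euclideanreal (\<lambda>(x, h). f (x \<otimes> h))"
      using continuous_map_compose[OF continuous_map_group_mult[OF continuous_map_fst snd] Cc_continuous[OF f]]
      by (simp add: o_def case_prod_beta')
    fix x assume x: "x \<in> topspace T"
    obtain U C where UC: "openin T U" "compactin T C" "x \<in> U" "U \<subseteq> C"
      using locally_compact x unfolding locally_compact_space_def by metis
    let ?L = "H \<inter> ((\<lambda>x. inv x) ` C <#> K)"
    have "compactin T ?L"
      by (intro closed_Int_compactin closedin_H compactin_set_mult compactin_set_inv UC K)
    then have "compactin (subtopology T H) ?L" by (simp add: compactin_subtopology)
    moreover have "f (u \<otimes> h) = 0" if u: "u \<in> U" and h: "h \<in> topspace (subtopology T H) - ?L" for u h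
    proof (rule K(2))
      have uc: "u \<in> carrier G" using u openin_subset[OF UC(1)] by (auto simp: topspace_eq)
      have hc: "h \<in> carrier G" "h \<in> H" using h by (auto simp: topspace_eq)
      show "u \<otimes> h \<in> topspace T" using uc hc by (simp add: topspace_eq)
      show "u \<otimes> h \<notin> K"
      proof
        assume "u \<otimes> h \<in> K"
        then have "inv u \<otimes> (u \<otimes> h) \<in> (\<lambda>x. inv x) ` C <#> K" using u UC(4) by (intro set_mult_memI) auto
        then show False using h hc uc by (simp add: m_assoc[symmetric])
      qed
    qed
    ultimately show "\<exists>U L. openin T U \<and> x \<in> U \<and> compactin (subtopology T H) L \<and>
        (\<forall>u\<in>U. \<forall>h\<in>topspace (subtopology T H) - L. f (u \<otimes> h) = 0)"
      using UC by blast
  qed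
  then show ?thesis by (simp add: fiber_integral_def[abs_def])
qed

lemma continuous_map_coset_integral:
  assumes f: "f \<in> Cc T"
  shows "continuous_map X euclideanreal (coset_integral f)"
  by (rule continuous_compose_quotient_map[OF quotient_map_coset continuous_map_eq[OF continuous_map_fiber_integral[OF f]]])
    (simp add: topspace_eq coset_integral_coset[OF f])

text \<open>A coset meeting K has a representative in K, and the continuous fibre integral is
  bounded there; every other coset contributes 0.\<close>

lemma coset_integral_bounded:
  assumes f: "f \<in> Cc T"
  obtains B where "\<And>C. C \<in> space m \<Longrightarrow> \<bar>coset_integral f C\<bar> \<le> B"
proof -
  obtain K where K: "compactin T K" "\<And>x. x \<in> topspace T \<Longrightarrow> x \<notin> K \<Longrightarrow> f x = 0"
    using Cc_support[OF f] by blast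
  have "bounded (fiber_integral f ` K)"
    using image_compactin[OF K(1) continuous_map_fiber_integral[OF f]] by (simp add: compact_imp_bounded)
  then obtain B where B: "\<And>x. x \<in> K \<Longrightarrow> \<bar>fiber_integral f x\<bar> \<le> B" by (auto simp: bounded_iff)
  have "\<bar>coset_integral f C\<bar> \<le> max 0 B" if "C \<in> space m" for C
  proof -
    obtain x where x: "x \<in> carrier G" "C = x <# H" using \<open>C \<in> space m\<close> by (auto simp: space_m)
    show ?thesis
    proof (cases "\<exists>h\<in>H. x \<otimes> h \<in> K")
      case True
      then obtain h where "h \<in> H" "x \<otimes> h \<in> K" by blast
      then show ?thesis
        using B[of "x \<otimes> h"] fiber_integral_mult[OF f x(1)] x coset_integral_coset[OF f x(1)] by auto
    next
      case False
      have "fiber_integral f x = (\<integral>h. 0 \<partial>\<nu>)"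
        unfolding fiber_integral_def using False K(2) x H_sub
        by (intro Bochner_Integration.integral_cong) (auto simp: space_\<nu> topspace_eq subset_iff)
      then show ?thesis using x coset_integral_coset[OF f x(1)] by simp
    qed
  qed
  then show thesis using that by blast
qed

text \<open>Finiteness of m makes a bounded continuous function integrable.\<close>

lemma integrable_coset_integral:
  assumes f: "f \<in> Cc T"
  shows "integrable m (coset_integral f)"
proof -
  interpret finite_measure m by (rule finite)
  obtain B where "\<And>C. C \<in> space m \<Longrightarrow> \<bar>coset_integral f C\<bar> \<le> B"
    using coset_integral_bounded[OF f] by metis
  then show ?thesis
    by (intro integrable_const_bound[of _ B] AE_I2
        continuous_map_borel_measurable[OF continuous_map_coset_integral[OF f] radon_sets[OF radon]]) auto
qed

text \<open>Left translation of f passes through the fibre integral to a translation of cosets,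
  where the invariance of m absorbs it.\<close>

lemma invariant_functional_weil: "invariant_functional G T weil_functional"
proof
  interpret J: positive_functional "subtopology T H" "\<lambda>f. \<integral>x. f x \<partial>\<nu>"
    by (rule H.positive_functional_integral_UNIV[OF radon_H])
  fix f g assume f: "f \<in> Cc T" and g: "g \<in> Cc T"
  have "weil_functional (\<lambda>x. f x + g x) = (\<integral>C. coset_integral f C + coset_integral g C \<partial>m)"
    unfolding weil_functional_def
    by (intro Bochner_Integration.integral_cong)
      (auto simp: space_m coset_integral_coset f g Cc_add fiber_integral_def J.add Cc_fiber)
  then show "weil_functional (\<lambda>x. f x + g x) = weil_functional f + weil_functional g"
    by (simp add: weil_functional_def integrable_coset_integral f g)
  assume le: "\<And>x. x \<in> topspace T \<Longrightarrow> f x \<le> g x"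
  show "weil_functional f \<le> weil_functional g"
    unfolding weil_functional_def
  proof (rule integral_mono[OF integrable_coset_integral[OF f] integrable_coset_integral[OF g]])
    fix C assume "C \<in> space m"
    then obtain x where x: "x \<in> carrier G" "C = x <# H" by (auto simp: space_m)
    have "fiber_integral f x \<le> fiber_integral g x"
      unfolding fiber_integral_def using le x(1) H_sub
      by (intro J.mono Cc_fiber f g) (auto simp: topspace_eq)
    then show "coset_integral f C \<le> coset_integral g C" by (simp add: x coset_integral_coset f g)
  qed
next
  interpret J: positive_functional "subtopology T H" "\<lambda>f. \<integral>x. f x \<partial>\<nu>"
    by (rule H.positive_functional_integral_UNIV[OF radon_H])
  fix f a assume f: "f \<in> Cc T"
  have "weil_functional (\<lambda>x. a * f x) = (\<integral>C. a * coset_integral f C \<partial>m)"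
    unfolding weil_functional_def
    by (intro Bochner_Integration.integral_cong)
      (auto simp: space_m coset_integral_coset f Cc_cmult fiber_integral_def)
  then show "weil_functional (\<lambda>x. a * f x) = a * weil_functional f" by (simp add: weil_functional_def)
next
  fix f g assume f: "f \<in> Cc T" and g: "g \<in> carrier G"
  have cont: "continuous_map X X (\<lambda>C. g <# C)"
    using homeomorphic_maps_coset[OF subgroup_H g] by (simp add: homeomorphic_maps_def)
  have "weil_functional (\<lambda>x. f (g \<otimes> x)) = (\<integral>C. coset_integral f (g <# C) \<partial>m)"
    unfolding weil_functional_def
  proof (intro Bochner_Integration.integral_cong refl)
    fix C assume "C \<in> space m"
    then obtain x where x: "x \<in> carrier G" "C = x <# H" by (auto simp: space_m)
    have "coset_integral (\<lambda>x. f (g \<otimes> x)) C = fiber_integral (\<lambda>x. f (g \<otimes> x)) x"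
      unfolding x(2) by (rule coset_integral_coset[OF Cc_left[OF f g] x(1)])
    also have "\<dots> = fiber_integral f (g \<otimes> x)"
      unfolding fiber_integral_def using x g H_sub
      by (intro Bochner_Integration.integral_cong) (auto simp: space_\<nu> m_assoc subset_iff)
    also have "\<dots> = coset_integral f ((g \<otimes> x) <# H)"
      using coset_integral_coset[OF f] x g by simp
    also have "(g \<otimes> x) <# H = g <# C"
      unfolding x(2) by (rule lcos_m_assoc[OF H_sub g x(1), symmetric])
    finally show "coset_integral (\<lambda>x. f (g \<otimes> x)) C = coset_integral f (g <# C)" .
  qed
  also have "\<dots> = (\<integral>C. coset_integral f C \<partial>distr m (borel_of X) (\<lambda>C. g <# C))"
  proof (rule integral_distr[symmetric])
    show "(\<lambda>C. g <# C) \<in> measurable m (borel_of X)"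
      using continuous_map_measurable[OF cont] measurable_cong_sets[OF radon_sets[OF radon] refl] by blast
    show "coset_integral f \<in> borel_measurable (borel_of X)"
      by (rule continuous_map_borel_measurable[OF continuous_map_coset_integral[OF f] refl])
  qed
  also have "\<dots> = weil_functional f" by (simp add: distr_translate[OF g] weil_functional_def)
  finally show "weil_functional (\<lambda>x. f (g \<otimes> x)) = weil_functional f" .
qed

text \<open>Positivity at the coset of the identity spreads by continuity to an open set of cosets,
  which has positive measure.\<close>

lemma weil_functional_pos:
  assumes f: "f \<in> Cc T" and nn: "\<And>x. x \<in> carrier G \<Longrightarrow> 0 \<le> f x" and one: "f \<one> = 1"
  shows "0 < weil_functional f"
proof -
  have nn': "0 \<le> coset_integral f C" if "C \<in> space m" for C
  proof -
    obtain x where x: "x \<in> carrier G" "C = x <# H" using \<open>C \<in> space m\<close> by (auto simp: space_m)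
    have "0 \<le> fiber_integral f x"
      unfolding fiber_integral_def using nn x H_sub
      by (intro integral_nonneg_AE AE_I2) (auto simp: space_\<nu> subset_iff)
    then show ?thesis using x coset_integral_coset[OF f] by simp
  qed
  have "0 < fiber_integral f \<one>"
    unfolding fiber_integral_def
    by (rule H.haar_integral_pos[OF haar_H Cc_fiber[OF f one_closed], of \<one>])
      (use nn one H_sub subgroup.one_closed[OF subgroup_H] in auto)
  then have pos: "0 < coset_integral f (\<one> <# H)" by (simp add: coset_integral_coset[OF f])
  have "openin X {C \<in> topspace X. coset_integral f C \<in> - {0}}"
    by (rule openin_continuous_map_preimage[OF continuous_map_coset_integral[OF f]]) auto
  then have "0 < emeasure m {C \<in> topspace X. coset_integral f C \<in> - {0}}"
    using pos by (intro coset_open_pos) (auto simp: topspace_cosets intro!: bexI[of _ \<one>])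
  also have "{C \<in> topspace X. coset_integral f C \<in> - {0}} = {C \<in> space m. coset_integral f C \<noteq> 0}"
    by (simp add: radon_space[OF radon])
  finally have p: "0 < emeasure m {C \<in> space m. coset_integral f C \<noteq> 0}" .
  have "weil_functional f \<noteq> 0"
  proof
    assume "weil_functional f = 0"
    then have "AE C in m. coset_integral f C = 0"
      using integral_nonneg_eq_0_iff_AE[OF integrable_coset_integral[OF f] AE_I2[OF nn']]
      by (simp add: weil_functional_def)
    moreover have "{C \<in> space m. coset_integral f C \<noteq> 0} \<in> sets m"
      using integrable_coset_integral[OF f] by measurable
    ultimately have "emeasure m {C \<in> space m. coset_integral f C \<noteq> 0} = 0"
      by (simp add: AE_iff_measurable[OF _ refl])
    then show False using p by simp
  qed
  moreover have "0 \<le> weil_functional f"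
    unfolding weil_functional_def using nn' by (intro integral_nonneg_AE AE_I2)
  ultimately show ?thesis by simp
qed

text \<open>Right translation by k acts inside the fibres: h |-> f(x h k) is the right translate by
  k, on the group H, of h |-> f(x h). So the factor is the one belonging to H.\<close>

lemma weil_functional_right:
  assumes f: "f \<in> Cc T" and k: "k \<in> H"
  shows "weil_functional (\<lambda>x. f (x \<otimes> k)) =
    modular_function (G\<lparr>carrier := H\<rparr>) (subtopology T H) (inv k) * weil_functional f"
proof -
  have kc: "k \<in> carrier G" using k H_sub by blast
  have "weil_functional (\<lambda>x. f (x \<otimes> k)) =
    (\<integral>C. modular_function (G\<lparr>carrier := H\<rparr>) (subtopology T H) (inv k) * coset_integral f C \<partial>m)"
    unfolding weil_functional_def
  proof (intro Bochner_Integration.integral_cong refl)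
    fix C assume "C \<in> space m"
    then obtain x where x: "x \<in> carrier G" "C = x <# H" by (auto simp: space_m)
    have "coset_integral (\<lambda>x. f (x \<otimes> k)) C = fiber_integral (\<lambda>x. f (x \<otimes> k)) x"
      unfolding x(2) by (rule coset_integral_coset[OF Cc_right[OF f kc] x(1)])
    also have "\<dots> = (\<integral>h. f (x \<otimes> (h \<otimes> k)) \<partial>\<nu>)"
      unfolding fiber_integral_def using x kc H_sub
      by (intro Bochner_Integration.integral_cong) (auto simp: space_\<nu> m_assoc subset_iff)
    also have "\<dots> = modular_function (G\<lparr>carrier := H\<rparr>) (subtopology T H) (inv k) * fiber_integral f x"
      using H.haar_integral_right[OF haar_H _ Cc_fiber[OF f x(1)], of k] k
      by (simp add: m_inv_consistent[OF subgroup_H] fiber_integral_def)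
    finally show "coset_integral (\<lambda>x. f (x \<otimes> k)) C =
        modular_function (G\<lparr>carrier := H\<rparr>) (subtopology T H) (inv k) * coset_integral f C"
      by (simp add: x(2) coset_integral_coset[OF f x(1)])
  qed
  then show ?thesis by (simp add: weil_functional_def)
qed

text \<open>Both scaling laws, taken at \<open>inv h\<close>, describe the same functional; its
  positive value at a bump is cancelled.\<close>

lemma modular_function_eq:
  assumes h: "h \<in> H"
  shows "modular_function G T h = modular_function (G\<lparr>carrier := H\<rparr>) (subtopology T H) h"
proof -
  interpret W: invariant_functional G T weil_functional by (rule invariant_functional_weil)
  obtain M where M: "left_haar_measure G T M" using ex_left_haar_measure by blast
  obtain c where c: "\<And>f. f \<in> Cc T \<Longrightarrow> weil_functional f = c * (\<integral>x. f x \<partial>M)"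
    using W.haar_unique[OF M] by metis
  obtain p where p: "p \<in> Cc T" "\<And>x. x \<in> carrier G \<Longrightarrow> 0 \<le> p x" "p \<one> = 1" using exists_bump by metis
  have k: "inv h \<in> H" "inv h \<in> carrier G" "inv (inv h) = h"
    using h H_sub subgroup.m_inv_closed[OF subgroup_H] by auto
  have "modular_function (G\<lparr>carrier := H\<rparr>) (subtopology T H) h * weil_functional p = weil_functional (\<lambda>x. p (x \<otimes> inv h))"
    using weil_functional_right[OF p(1) k(1)] k(3) by simp
  also have "\<dots> = c * (\<integral>x. p (x \<otimes> inv h) \<partial>M)" by (rule c[OF Cc_right[OF p(1) k(2)]])
  also have "\<dots> = modular_function G T h * weil_functional p"
    using haar_integral_right[OF M k(2) p(1)] k(3) c[OF p(1)] by simp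
  finally show ?thesis using weil_functional_pos[OF p] by simp
qed

end

section \<open>Open subgroups and finite index\<close>

text \<open>Relatively open sets are open in X because U is; conversely, an open V containing E can
  be cut down to U \<inter> V. Thus the infimum in outer regularity does not change.\<close>

lemma radon_measure_restrict_open:
  assumes M: "radon_measure X M" and U: "openin X U"
  shows "radon_measure (subtopology X U) (restrict_space M U)"
proof -
  let ?Y = "subtopology X U"
  have Ut: "U \<subseteq> topspace X" by (rule openin_subset[OF U])
  have UM: "U \<in> sets M" using U M by (simp add: radon_sets borel_of_openin)
  have op: "openin ?Y V \<longleftrightarrow> openin X V \<and> V \<subseteq> U" for V
    by (rule openin_open_subtopology[OF U])
  have Yt: "topspace ?Y = U" using Ut by auto
  have r: "A \<in> sets (restrict_space M U) \<longleftrightarrow> A \<subseteq> U \<and> A \<in> sets M" for A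
    using UM by (intro sets_restrict_space_iff) auto
  have em: "emeasure (restrict_space M U) A = emeasure M A" if "A \<subseteq> U" for A
    using UM that by (intro emeasure_restrict_space) auto
  have sets: "sets (restrict_space M U) = sets (borel_of ?Y)"
  proof (rule subset_antisym)
    have "(\<lambda>x. x) \<in> measurable (borel_of ?Y) (borel_of X)"
      by (rule continuous_map_measurable) simp
    then have m: "A \<inter> U \<in> sets (borel_of ?Y)" if "A \<in> sets (borel_of X)" for A
      using measurable_sets[of "\<lambda>x. x" "borel_of ?Y" "borel_of X" A] that
      by (simp add: space_borel_of Int_absorb1[OF Ut])
    show "sets (restrict_space M U) \<subseteq> sets (borel_of ?Y)"
    proof
      fix A assume "A \<in> sets (restrict_space M U)"
      then show "A \<in> sets (borel_of ?Y)"
        using m[of A] by (simp add: r radon_sets[OF M] Int_absorb2)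
    qed
    have "space (restrict_space M U) = U"
      using Ut by (auto simp: space_restrict_space radon_space[OF M])
    then have "sigma_algebra U (sets (restrict_space M U))"
      using sets.sigma_algebra_axioms[of "restrict_space M U"] by simp
    then show "sets (borel_of ?Y) \<subseteq> sets (restrict_space M U)"
      unfolding sets_borel_of Yt
      by (rule sigma_algebra.sigma_sets_subset) (auto simp: r op radon_sets[OF M] borel_of_openin)
  qed
  show ?thesis
    unfolding radon_measure_def
  proof (intro conjI ballI allI impI)
    show "sets (restrict_space M U) = sets (borel_of ?Y)" by (rule sets)
  next
    fix K assume "compactin ?Y K"
    then show "emeasure (restrict_space M U) K < \<infinity>"
      using em radon_finite[OF M] by (simp add: compactin_subtopology)
  next
    fix E assume "E \<in> sets (restrict_space M U)"
    then have E: "E \<subseteq> U" "E \<in> sets M" by (auto simp: r)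
    show "emeasure (restrict_space M U) E = (INF V\<in>{V. openin ?Y V \<and> E \<subseteq> V}. emeasure (restrict_space M U) V)"
      (is "_ = ?I")
    proof (rule antisym)
      show "emeasure (restrict_space M U) E \<le> ?I"
        using sets by (auto intro!: INF_greatest emeasure_mono borel_of_openin)
      show "?I \<le> emeasure (restrict_space M U) E"
        unfolding em[OF E(1)] radon_outer[OF M E(2)]
      proof (rule INF_greatest, clarify)
        fix V assume V: "openin X V" "E \<subseteq> V"
        have "?I \<le> emeasure (restrict_space M U) (U \<inter> V)"
          using V E U by (intro INF_lower) (auto simp: op)
        also have "\<dots> \<le> emeasure M V"
          using V by (auto simp: em radon_sets[OF M] intro!: emeasure_mono borel_of_openin)
        finally show "?I \<le> emeasure M V" .
      qed
    qed
  next
    fix V assume V: "openin ?Y V"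
    then have "emeasure (restrict_space M U) V = (SUP K\<in>{K. compactin X K \<and> K \<subseteq> V}. emeasure M K)"
      by (simp add: op em radon_inner[OF M])
    also have "\<dots> = (SUP K\<in>{K. compactin ?Y K \<and> K \<subseteq> V}. emeasure (restrict_space M U) K)"
      using V by (intro SUP_cong) (auto simp: op compactin_subtopology em)
    finally show "emeasure (restrict_space M U) V = \<dots>" .
  qed
qed

context covolume
begin

text \<open>The maps D |-> D \<inter> N and C |-> C H are inverse to each other between the open set
  U of cosets n H with n in N and the coset space of N by H \<inter> N. The required measure is m
  restricted to U and pushed forward along the first map.\<close>

lemma finite_covolume_open_subgroup:
  assumes N: "subgroup N G" and oN: "openin T N"
  shows "finite_covolume (G\<lparr>carrier := N\<rparr>) (subtopology T N) (H \<inter> N)"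
proof -
  let ?GN = "G\<lparr>carrier := N\<rparr>" and ?TN = "subtopology T N" and ?L = "H \<inter> N"
  let ?XN = "left_coset_space ?GN ?TN ?L"
  interpret N: locally_compact_group ?GN ?TN
    by (rule locally_compact_group_subgroup[OF N])
      (use Hausdorff locally_compact oN in \<open>intro locally_compact_space_open_subset, auto\<close>)
  have Nc: "N \<subseteq> carrier G" by (rule subgroup.subset[OF N])
  have L: "subgroup ?L ?GN"
    by (intro subgroup_incl subgroups_Inter_pair subgroup_H N) auto
  have topN: "topspace ?TN = N" using N.topspace_eq by simp
  have lc: "x <#\<^bsub>?GN\<^esub> C = x <# C" for x C by (simp add: l_coset_def)
  define U where "U = (\<lambda>g. g <# H) ` N"
  have oU: "openin X U" unfolding U_def by (rule openin_coset_image[OF subgroup_H oN])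
  have topU: "topspace (subtopology X U) = U" using openin_subset[OF oU] by auto
  have topXN: "topspace ?XN = (\<lambda>n. n <# ?L) ` N" using N.topspace_cosets[of ?L] by (simp add: lc)
  have 1: "(n <# H) \<inter> N = n <# ?L" if n: "n \<in> N" for n
  proof (rule subset_antisym; rule subsetI)
    fix x assume "x \<in> (n <# H) \<inter> N"
    then obtain h where h: "h \<in> H" "x = n \<otimes> h" "x \<in> N" by (auto simp: l_coset_def)
    then have "h = inv n \<otimes> x" using n Nc H_sub by (auto simp: m_assoc[symmetric] subset_iff)
    then have "h \<in> N" using n h subgroup.m_closed[OF N] subgroup.m_inv_closed[OF N] by metis
    then show "x \<in> n <# ?L" using h by (auto simp: l_coset_def)
  qed (use n subgroup.m_closed[OF N] in \<open>auto simp: l_coset_def\<close>)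
  have 2: "(n <# ?L) <#> H = n <# H" if n: "n \<in> N" for n
  proof (rule subset_antisym; rule subsetI)
    fix x assume "x \<in> (n <# ?L) <#> H"
    then obtain l h where lh: "l \<in> H" "h \<in> H" "x = n \<otimes> l \<otimes> h" by (auto simp: l_coset_def set_mult_def)
    then have "x = n \<otimes> (l \<otimes> h)" using n Nc H_sub by (auto simp: m_assoc subset_iff)
    then show "x \<in> n <# H" using lh subgroup.m_closed[OF subgroup_H] by (auto simp: l_coset_def)
  next
    fix x assume "x \<in> n <# H"
    then obtain h where h: "h \<in> H" "x = n \<otimes> h" by (auto simp: l_coset_def)
    have "n \<otimes> \<one> \<in> n <# ?L"
      using subgroup.one_closed[OF subgroup_H] subgroup.one_closed[OF N] by (auto simp: l_coset_def)
    then have "n \<otimes> \<one> \<otimes> h \<in> (n <# ?L) <#> H" using h by (intro set_mult_memI)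
    then show "x \<in> (n <# ?L) <#> H" using h n Nc by auto
  qed
  have openN: "openin ?TN V \<longleftrightarrow> openin T V \<and> V \<subseteq> N" for V by (rule openin_open_subtopology[OF oN])
  \<comment> \<open>The projection from N onto U is continuous and open, hence a quotient map, so
    continuity of a map on U can be tested on N.\<close>
  have q: "quotient_map ?TN (subtopology X U) (\<lambda>g. g <# H)"
  proof (rule continuous_open_imp_quotient_map)
    show "continuous_map ?TN (subtopology X U) (\<lambda>g. g <# H)"
      using continuous_map_from_subtopology[OF quotient_imp_continuous_map[OF quotient_map_coset], of N H]
      by (auto simp: continuous_map_in_subtopology U_def)
    show "open_map ?TN (subtopology X U) (\<lambda>g. g <# H)"
      unfolding open_map_def openN openin_open_subtopology[OF oU]
      using openin_coset_image[OF subgroup_H] by (auto simp: U_def)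
    show "(\<lambda>g. g <# H) ` topspace ?TN = topspace (subtopology X U)" by (simp only: topN topU) (simp add: U_def)
  qed
  have qN: "quotient_map ?TN ?XN (\<lambda>g. g <# ?L)" using N.quotient_map_coset[of ?L] by (simp add: lc)
  have c\<psi>: "continuous_map (subtopology X U) ?XN (\<lambda>D. D \<inter> N)"
    by (rule continuous_compose_quotient_map[OF q continuous_map_eq[OF quotient_imp_continuous_map[OF qN]]])
      (simp only: topN o_def 1)
  have c\<phi>: "continuous_map ?XN (subtopology X U) (\<lambda>C. C <#> H)"
    by (rule continuous_compose_quotient_map[OF qN continuous_map_eq[OF quotient_imp_continuous_map[OF q]]])
      (simp only: topN o_def 2)
  have homeo: "homeomorphic_maps (subtopology X U) ?XN (\<lambda>D. D \<inter> N) (\<lambda>C. C <#> H)"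
    unfolding homeomorphic_maps_def topU topXN using c\<psi> c\<phi> by (auto simp: U_def 1 2)
  let ?m1 = "restrict_space m U"
  have R1: "radon_measure (subtopology X U) ?m1" by (rule radon_measure_restrict_open[OF radon oU])
  have Um: "U \<in> sets m" using oU by (simp add: radon_sets[OF radon] borel_of_openin)
  let ?m2 = "distr ?m1 (borel_of ?XN) (\<lambda>D. D \<inter> N)"
  have R2: "radon_measure ?XN ?m2" by (rule radon_measure_distr[OF R1 homeo])
  have em: "emeasure ?m2 E = emeasure m {D \<in> U. D \<inter> N \<in> E}" if E: "E \<in> sets (borel_of ?XN)" for E
  proof -
    have "emeasure ?m2 E = emeasure ?m1 {D \<in> U. D \<inter> N \<in> E}"
      using emeasure_distr_radon[OF R1 c\<psi> E] by (simp only: topU)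
    also have "\<dots> = emeasure m {D \<in> U. D \<inter> N \<in> E}"
      using Um by (intro emeasure_restrict_space) auto
    finally show ?thesis .
  qed
  have meas: "{D \<in> U. D \<inter> N \<in> E} \<in> sets m" if E: "E \<in> sets (borel_of ?XN)" for E
  proof -
    have "(\<lambda>D. D \<inter> N) -` E \<inter> U \<in> sets ?m1"
      using measurable_sets[OF continuous_map_measurable[OF c\<psi>] E]
      by (simp only: space_borel_of topU radon_sets[OF R1])
    also have "(\<lambda>D. D \<inter> N) -` E \<inter> U = {D \<in> U. D \<inter> N \<in> E}" by auto
    finally show ?thesis using Um by (subst (asm) sets_restrict_space_iff) auto
  qed
  have total: "emeasure ?m2 (space ?m2) = emeasure m U"
  proof -
    have "{D \<in> U. D \<inter> N \<in> topspace ?XN} = U" by (auto simp: U_def topXN 1)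
    then show ?thesis using em[of "topspace ?XN"] sets.top[of "borel_of ?XN"] by (simp add: space_borel_of)
  qed
  have "emeasure ?m2 ((\<lambda>C. g <# C) ` E) = emeasure ?m2 E" if g: "g \<in> N" and "E \<in> sets ?m2" for g E
  proof -
    have E: "E \<in> sets (borel_of ?XN)" using that by simp
    have Et: "E \<subseteq> topspace ?XN" using sets.sets_into_space[OF E] by (simp add: space_borel_of)
    have gc: "g \<in> carrier G" using g Nc by blast
    have Lc: "?L \<subseteq> carrier G" using H_sub by blast
    have h: "homeomorphic_maps ?XN ?XN (\<lambda>C. g <# C) (\<lambda>C. inv g <# C)"
      using N.homeomorphic_maps_coset[OF L, of g] g by (simp add: lc m_inv_consistent[OF N])
    have "(\<lambda>C. g <# C) ` E = (\<lambda>C. inv g <# C) -` E \<inter> space (borel_of ?XN)"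
      using h Et unfolding homeomorphic_maps_def space_borel_of continuous_map_def
      by (auto simp: subset_iff Pi_iff image_iff; metis)
    also have "\<dots> \<in> sets (borel_of ?XN)"
      by (rule measurable_sets[OF continuous_map_measurable E]) (use h in \<open>simp add: homeomorphic_maps_def\<close>)
    finally have gE: "(\<lambda>C. g <# C) ` E \<in> sets (borel_of ?XN)" .
    have tr: "(g \<otimes> n) <# H = g <# (n <# H)" "(g \<otimes> n) <# ?L = g <# (n <# ?L)" "g \<otimes> n \<in> N" if "n \<in> N" for n
      using that Nc gc H_sub Lc g subgroup.m_closed[OF N] by (auto simp: lcos_m_assoc subset_iff)
    \<comment> \<open>The identification of U with the coset space of N commutes with translation by
      g in N, which transfers invariance from m.\<close>
    have "{D \<in> U. D \<inter> N \<in> (\<lambda>C. g <# C) ` E} = (\<lambda>D. g <# D) ` {D \<in> U. D \<inter> N \<in> E}"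
    proof (rule subset_antisym; rule subsetI)
      fix D assume "D \<in> {D \<in> U. D \<inter> N \<in> (\<lambda>C. g <# C) ` E}"
      then obtain n C where n: "n \<in> N" "D = n <# H" "C \<in> E" "D \<inter> N = g <# C" by (auto simp: U_def)
      obtain n' where n': "n' \<in> N" "C = n' <# ?L" using n(3) Et topXN by blast
      have "n <# ?L = (g \<otimes> n') <# ?L" using n n' 1[OF n(1)] tr(2)[OF n'(1)] by simp
      then have "n <# H = g <# (n' <# H)" using 2[OF n(1)] 2[OF tr(3)[OF n'(1)]] tr(1)[OF n'(1)] by simp
      moreover have "n' <# H \<in> {D \<in> U. D \<inter> N \<in> E}" using n n' 1[OF n'(1)] by (auto simp: U_def)
      ultimately show "D \<in> (\<lambda>D. g <# D) ` {D \<in> U. D \<inter> N \<in> E}" using n by blast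
    next
      fix D assume "D \<in> (\<lambda>D. g <# D) ` {D \<in> U. D \<inter> N \<in> E}"
      then obtain n where n: "n \<in> N" "D = g <# (n <# H)" "(n <# H) \<inter> N \<in> E" by (auto simp: U_def)
      then have "D = (g \<otimes> n) <# H" "D \<inter> N = g <# ((n <# H) \<inter> N)"
        using tr[OF n(1)] 1[OF n(1)] 1[OF tr(3)[OF n(1)]] by simp_all
      then show "D \<in> {D \<in> U. D \<inter> N \<in> (\<lambda>C. g <# C) ` E}"
        using n tr(3)[OF n(1)] by (auto simp: U_def)
    qed
    then show ?thesis using em[OF E] em[OF gE] invariant[OF gc meas[OF E]] by simp
  qed
  moreover have "finite_measure ?m2"
  proof (rule finite_measureI)
    show "emeasure ?m2 (space ?m2) \<noteq> \<infinity>"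
      unfolding total using finite_measure.emeasure_finite[OF finite] by simp
  qed
  moreover have "emeasure ?m2 (space ?m2) \<noteq> 0"
  proof -
    have "U \<noteq> {}" using subgroup.one_closed[OF N] by (auto simp: U_def)
    then show ?thesis unfolding total using coset_open_pos[OF oU] by simp
  qed
  moreover have "closed_subgroup ?L ?GN ?TN"
    unfolding closed_subgroup_def using L closedin_H by (auto simp: closedin_subtopology)
  ultimately show ?thesis
    unfolding finite_covolume_def using R2 by (auto simp: lc)
qed

text \<open>U is the orbit of the coset H under the kernel, so a coset lying in two translates of U
  has the form g n H = g' n' H with n and n' in the kernel. Applying \<phi> shows that the images of
  g and g' agree modulo the image of H.\<close>

lemma finite_index_image:
  assumes P: "comm_group P" and hom: "group_hom G P \<phi>" and open_ker: "openin T (kernel G P \<phi>)"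
  shows "finite_index_subgroup (\<phi> ` H) (P\<lparr>carrier := \<phi> ` carrier G\<rparr>)"
proof -
  interpret P: comm_group P by (rule P)
  interpret \<phi>: group_hom G P \<phi> by (rule hom)
  interpret m: finite_measure m by (rule finite)
  let ?P = "P\<lparr>carrier := \<phi> ` carrier G\<rparr>" and ?N = "kernel G P \<phi>"
  have sH: "subgroup (\<phi> ` H) P" by (rule \<phi>.subgroup_img_is_subgroup[OF subgroup_H])
  have sG: "subgroup (\<phi> ` carrier G) P" by (rule \<phi>.img_is_subgroup)
  have sub: "subgroup (\<phi> ` H) ?P"
    using H_sub by (intro P.subgroup_incl sH sG) auto
  define U where "U = (\<lambda>g. g <# H) ` ?N"
  have oU: "openin X U" unfolding U_def by (rule openin_coset_image[OF subgroup_H open_ker])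
  have Um: "U \<in> sets m" using oU by (simp add: radon_sets[OF radon] borel_of_openin)
  have "\<one> <# H \<in> U" by (auto simp: U_def kernel_def)
  then have "0 < emeasure m U" by (intro coset_open_pos oU) auto
  then have Upos: "0 < measure m U" by (simp add: m.emeasure_eq_measure)
  have "\<exists>g. g \<in> carrier G \<and> r = \<phi> ` H #>\<^bsub>P\<^esub> \<phi> g" if "r \<in> rcosets\<^bsub>?P\<^esub> (\<phi> ` H)" for r
    using that by (auto simp: RCOSETS_def r_coset_def)
  then obtain g where g: "\<And>r. r \<in> rcosets\<^bsub>?P\<^esub> (\<phi> ` H) \<Longrightarrow> g r \<in> carrier G \<and> r = \<phi> ` H #>\<^bsub>P\<^esub> \<phi> (g r)"
    by metis
  define V where "V r = (\<lambda>C. g r <# C) ` U" for r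
  have V: "V r \<in> sets m" "measure m (V r) = measure m U" if r: "r \<in> rcosets\<^bsub>?P\<^esub> (\<phi> ` H)" for r
  proof -
    have "open_map X X (\<lambda>C. g r <# C)"
      using homeomorphic_maps_coset[OF subgroup_H] g[OF r]
      by (meson homeomorphic_imp_open_map homeomorphic_map_maps)
    then show "V r \<in> sets m"
      using oU by (auto simp: V_def open_map_def radon_sets[OF radon] borel_of_openin)
    show "measure m (V r) = measure m U"
      using invariant[of "g r", OF _ Um] g[OF r] by (simp add: V_def measure_def)
  qed
  have disj: "r = r'"
    if r: "r \<in> rcosets\<^bsub>?P\<^esub> (\<phi> ` H)" and r': "r' \<in> rcosets\<^bsub>?P\<^esub> (\<phi> ` H)" and D: "D \<in> V r" "D \<in> V r'" for r r' D
  proof -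
    have gc: "g r \<in> carrier G" "g r' \<in> carrier G" using g r r' by auto
    obtain n n' where n: "n \<in> ?N" "n' \<in> ?N" "D = g r <# (n <# H)" "D = g r' <# (n' <# H)"
      using D by (auto simp: V_def U_def)
    have nc: "n \<in> carrier G" "n' \<in> carrier G" "\<phi> n = \<one>\<^bsub>P\<^esub>" "\<phi> n' = \<one>\<^bsub>P\<^esub>" using n by (auto simp: kernel_def)
    have "(g r \<otimes> n) <# H = (g r' \<otimes> n') <# H" using n gc nc H_sub by (simp add: lcos_m_assoc)
    then obtain h where h: "h \<in> H" "g r \<otimes> n = g r' \<otimes> n' \<otimes> h"
      using l_coset_eq_iff[OF subgroup_H, of "g r \<otimes> n" "g r' \<otimes> n'"] gc nc by auto
    have hc: "h \<in> carrier G" using h H_sub by blast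
    have "\<phi> (g r \<otimes> n) = \<phi> (g r' \<otimes> n' \<otimes> h)" using h by simp
    \<comment> \<open>Commutativity of P moves \<phi> h to the front and turns the left coset
      relation in G into the right coset relation behind \<open>rcosets\<close>.\<close>
    then have "\<phi> (g r) = \<phi> h \<otimes>\<^bsub>P\<^esub> \<phi> (g r')" using gc nc hc by (simp add: P.m_comm)
    then have "\<phi> (g r) \<in> \<phi> ` H #>\<^bsub>P\<^esub> \<phi> (g r')" using h by (auto simp: r_coset_def)
    then have "\<phi> ` H #>\<^bsub>P\<^esub> \<phi> (g r') = \<phi> ` H #>\<^bsub>P\<^esub> \<phi> (g r)"
      by (rule P.repr_independence) (use gc sH in auto)
    then show ?thesis using g[OF r] g[OF r'] by simp
  qed
  \<comment> \<open>Disjoint sets of measure \<open>measure m U\<close> fit into the coset space at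
    most this many times; a uniform bound on finite subfamilies gives finiteness of the whole
    family.\<close>
  have "card \<F> \<le> nat \<lfloor>measure m (space m) / measure m U\<rfloor>"
    if F: "\<F> \<subseteq> rcosets\<^bsub>?P\<^esub> (\<phi> ` H)" "finite \<F>" for \<F>
  proof -
    have "real (card \<F>) * measure m U = (\<Sum>r\<in>\<F>. measure m (V r))"
      using F V by (simp add: subset_iff)
    also have "\<dots> = measure m (\<Union>r\<in>\<F>. V r)"
    proof (rule m.finite_measure_finite_Union[symmetric])
      show "V ` \<F> \<subseteq> sets m" using F V by blast
      show "disjoint_family_on V \<F>"
        unfolding disjoint_family_on_def using F(1) disj by blast
    qed (rule F)
    also have "\<dots> \<le> measure m (space m)" by (rule m.bounded_measure)
    finally have "real (card \<F>) \<le> measure m (space m) / measure m U"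
      using Upos by (simp add: pos_le_divide_eq)
    then show ?thesis by (simp add: le_nat_floor)
  qed
  then have "finite (rcosets\<^bsub>?P\<^esub> (\<phi> ` H))"
    using finite_if_finite_subsets_card_bdd by blast
  then show ?thesis using sub by (simp add: finite_index_subgroup_def)
qed

end

theorem proposition5p7:
  fixes G :: "('a, 'b) monoid_scheme" and T :: "'a topology" and H :: "'a set"
  assumes "almost_unimodular G T"
    and "finite_covolume G T H"
  shows "let G\<^sub>H = G\<lparr>carrier := H\<rparr>; T\<^sub>H = subtopology T H;
             \<Delta>\<^sub>G = modular_function G T; \<Delta>\<^sub>H = modular_function G\<^sub>H T\<^sub>H;
             K\<^sub>G = kernel G pos_real_group \<Delta>\<^sub>G; K\<^sub>H = kernel G\<^sub>H pos_real_group \<Delta>\<^sub>H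
         in almost_unimodular G\<^sub>H T\<^sub>H
          \<and> (\<forall>h\<in>H. \<Delta>\<^sub>G h = \<Delta>\<^sub>H h)
          \<and> finite_covolume (G\<lparr>carrier := K\<^sub>G\<rparr>) (subtopology T K\<^sub>G) K\<^sub>H
          \<and> finite_index_subgroup (\<Delta>\<^sub>H ` H) (pos_real_group\<lparr>carrier := \<Delta>\<^sub>G ` carrier G\<rparr>)"
proof -
  interpret locally_compact_group G T
    using assms(1) by (simp add: almost_unimodular_def)
  let ?D = "modular_function G T" and ?DH = "modular_function (G\<lparr>carrier := H\<rparr>) (subtopology T H)"
  let ?K = "kernel G pos_real_group ?D"
  have oK: "openin T ?K" using assms(1) by (simp add: almost_unimodular_def)
  obtain m where "covolume G T H m"
    using assms(2) locally_compact_group_axioms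
    by (auto simp: finite_covolume_def covolume_def covolume_axioms_def)
  then interpret covolume G T H m .
  have "locally_compact_group (G\<lparr>carrier := H\<rparr>) (subtopology T H)"
    by (rule locally_compact_group_subgroup[OF subgroup_H])
      (rule locally_compact_space_closed_subset[OF locally_compact closedin_H])
  then obtain \<nu> where "left_haar_measure (G\<lparr>carrier := H\<rparr>) (subtopology T H) \<nu>"
    using locally_compact_group.ex_left_haar_measure by blast
  then interpret covolume_haar G T H m \<nu> by unfold_locales
  interpret D: group_hom G pos_real_group ?D by (rule modular_function_hom)
  \<comment> \<open>Equality of the modular functions on H turns the kernel of the second into the
    trace on H of the first. It is therefore relatively open in H, and has the form required by the
    lemma on open subgroups.\<close>
  have KH: "kernel (G\<lparr>carrier := H\<rparr>) pos_real_group ?DH = H \<inter> ?K"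
    using H_sub by (auto simp: kernel_def modular_function_eq)
  have "almost_unimodular (G\<lparr>carrier := H\<rparr>) (subtopology T H)"
    unfolding almost_unimodular_def KH
    using locally_compact_group_H oK by (auto intro: openin_subtopology_Int2)
  moreover have "finite_covolume (G\<lparr>carrier := ?K\<rparr>) (subtopology T ?K) (H \<inter> ?K)"
    by (rule finite_covolume_open_subgroup[OF D.subgroup_kernel oK])
  moreover have "?DH ` H = ?D ` H" by (rule image_cong) (auto simp: modular_function_eq)
  moreover have "finite_index_subgroup (?D ` H) (pos_real_group\<lparr>carrier := ?D ` carrier G\<rparr>)"
    by (rule finite_index_image[OF comm_group_pos_real_group modular_function_hom oK])
  ultimately show ?thesis
    by (simp add: Let_def KH modular_function_eq)
qed

end
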